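(* Let $\vec{\alpha}=(\alpha_1,\alpha_2)\in\mathbb{R}^2$ and let $p\in\mathbb{C}[z_1,z_2]$ be an irreducible polynomial, depending on both $z_1$ and $z_2$, with no zeros in the bidisk $\mathbb{D}^2$. \begin{enumerate} \item If $\alpha_1+\alpha_2\le 1$, then $p$ is cyclic in $\mathfrak{D}_{\vec{\alpha}}$. \item If $\alpha_1+\alpha_2>1$ and $\min\{\alpha_1,\alpha_2\}\le 1$, then $p$ is cyclic in $\mathfrak{D}_{\vec{\alpha}}$ if and only if $\mathcal{Z}(p)\cap\mathbb{T}^2$ is empty or finite. \item If $\min\{\alpha_1,\alpha_2\}>1$, then $p$ is cyclic in $\mathfrak{D}_{\vec{\alpha}}$ if and only if $\mathcal{Z}(p)\cap\mathbb{T}^2$ is empty. \end{enumerate}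
   Context: $\mathbb{D}=\{z\in\mathbb{C}:|z|<1\}$, $\mathbb{D}^2=\mathbb{D}\times\mathbb{D}$, $\mathbb{T}=\{z\in\mathbb{C}:|z|=1\}$, $\mathbb{T}^2=\mathbb{T}\times\mathbb{T}$, and $\mathcal{Z}(p)=\{z\in\mathbb{C}^2:p(z)=0\}$. For $\vec{\alpha}=(\alpha_1,\alpha_2)\in\mathbb{R}^2$, the anisotropic weighted Dirichlet space $\mathfrak{D}_{\vec{\alpha}}$ is the Hilbert space of holomorphic functions $f(z_1,z_2)=\sum_{k,l\ge 0}a_{k,l}z_1^kz_2^l$ on $\mathbb{D}^2$ with $$\|f\|_{\vec{\alpha}}^2=\sum_{k\ge0}\sum_{l\ge0}(k+1)^{\alpha_1}(l+1)^{\alpha_2}|a_{k,l}|^2<\infty.$$ Multiplication by $z_1$ and by $z_2$ are bounded operators on $\mathfrak{D}_{\vec{\alpha}}$. A function $f\in\mathfrak{D}_{\vec{\alpha}}$ is cyclic in $\mathfrak{D}_{\vec{\alpha}}$ if the closed linear span of $\{z_1^kz_2^lf: k,l\ge0\}$ in $\mathfrak{D}_{\vec{\alpha}}$ is all of $\mathfrak{D}_{\vec{\alpha}}$. *)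

theory Defs
  imports "HOL-Complex_Analysis.Complex_Analysis" "HOL-Library.Function_Algebras"
begin

definition bidisk :: "(complex \<times> complex) set" where
  "bidisk = ball 0 1 \<times> ball 0 1"

definition torus2 :: "(complex \<times> complex) set" where
  "torus2 = sphere 0 1 \<times> sphere 0 1"

text \<open>
  A polynomial in \<open>\<complex>[z\<^sub>1, z\<^sub>2]\<close> is an element of \<open>\<complex>[z\<^sub>1][z\<^sub>2]\<close>: the outer
  variable is \<open>z\<^sub>2\<close>, and \<open>coeff (coeff p l) k\<close> is the coefficient of \<open>z\<^sub>1\<^sup>k z\<^sub>2\<^sup>l\<close>.
\<close>

definition eval2 :: "complex poly poly \<Rightarrow> complex \<times> complex \<Rightarrow> complex" where
  "eval2 p = (\<lambda>(z1, z2). poly (poly p [:z2:]) z1)"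

definition depends_on_z1 :: "complex poly poly \<Rightarrow> bool" where
  "depends_on_z1 p \<longleftrightarrow> (\<exists>k l. k > 0 \<and> coeff (coeff p l) k \<noteq> 0)"

definition depends_on_z2 :: "complex poly poly \<Rightarrow> bool" where
  "depends_on_z2 p \<longleftrightarrow> (\<exists>k l. l > 0 \<and> coeff (coeff p l) k \<noteq> 0)"

definition zero_set :: "complex poly poly \<Rightarrow> (complex \<times> complex) set" where
  "zero_set p = {z. eval2 p z = 0}"

text \<open>
  Holomorphic functions on the bidisk are given by their (absolutely convergent) power
  series. Functions have type \<open>complex \<times> complex \<Rightarrow> complex\<close>, but only their values
  on \<open>bidisk\<close> are ever used.
\<close>

definition has_expansion ::
  "(complex \<times> complex \<Rightarrow> complex) \<Rightarrow> (nat \<Rightarrow> nat \<Rightarrow> complex) \<Rightarrow> bool" where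
  "has_expansion f a \<longleftrightarrow>
     (\<forall>(z1, z2) \<in> bidisk. ((\<lambda>(k, l). a k l * z1 ^ k * z2 ^ l) has_sum f (z1, z2)) UNIV)"

definition taylor :: "(complex \<times> complex \<Rightarrow> complex) \<Rightarrow> nat \<Rightarrow> nat \<Rightarrow> complex" where
  "taylor f = (THE a. has_expansion f a)"

lemma has_sum_powser_unique:
  fixes a b :: "nat \<Rightarrow> complex"
  assumes "\<And>z. z \<in> ball 0 1 \<Longrightarrow> ((\<lambda>k. a k * z ^ k) has_sum f z) UNIV"
    and "\<And>z. z \<in> ball 0 1 \<Longrightarrow> ((\<lambda>k. b k * z ^ k) has_sum f z) UNIV"
  shows "a = b"
proof (rule ccontr)
  define c where "c k = a k - b k" for k
  assume "a \<noteq> b"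
  then obtain m0 where m0: "c m0 \<noteq> 0" by (auto simp: c_def fun_eq_iff)
  have s: "(\<lambda>k. c k * z ^ k) sums 0" if "z \<in> ball 0 1" for z
    using sums_diff[OF has_sum_imp_sums[OF assms(1)[OF that]]
        has_sum_imp_sums[OF assms(2)[OF that]]]
    by (simp add: c_def ring_distribs)
  have c0: "c 0 = 0"
    using sums_unique2[OF s[of 0] powser_sums_zero[of c]] by simp
  with m0 have "m0 > 0" by (cases m0) auto
  show False
  proof (rule powser_0_nonzero[of 1 0 c "\<lambda>_. 0" m0])
    fix r :: real
    assume "r > 0" and "\<And>z. (z :: complex) \<in> cball 0 r - {0} \<Longrightarrow> (0 :: complex) \<noteq> 0"
    from this(2)[of "of_real r"] \<open>r > 0\<close> show False by simp
  qed (use s m0 \<open>m0 > 0\<close> in auto)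
qed

lemma has_expansion_unique:
  assumes "has_expansion f a" "has_expansion f b"
  shows "a = b"
proof -
  define A where "A = (\<lambda>(a :: nat \<Rightarrow> nat \<Rightarrow> complex) z2 k. \<Sum>\<^sub>\<infinity>l. a k l * z2 ^ l)"
  have inner: "(\<lambda>l. c k l * z2 ^ l) summable_on UNIV"
    and outer: "((\<lambda>k. A c z2 k * z1 ^ k) has_sum f (z1, z2)) UNIV"
    if c: "has_expansion f c" and z: "z1 \<in> ball 0 1" "z2 \<in> ball 0 1" for c k z1 z2
  proof -
    have hs: "((\<lambda>(k, l). c k l * w ^ k * z2 ^ l) has_sum f (w, z2)) (UNIV \<times> UNIV)"
      if "w \<in> ball 0 1" for w
      using c z that by (auto simp: has_expansion_def bidisk_def)
    have sm: "(\<lambda>l. c k l * w ^ k * z2 ^ l) summable_on UNIV" if "w \<in> ball 0 1" for w k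
      using summable_on_SigmaD1[OF has_sum_imp_summable[OF hs[OF that]], of k] by simp
    show inner: "(\<lambda>l. c k l * z2 ^ l) summable_on UNIV" for k
      using summable_on_cmult_right[OF sm[of "1/2" k], of "2 ^ k"]
      by (simp add: field_simps)
    have "((\<lambda>l. c k l * z1 ^ k * z2 ^ l) has_sum A c z2 k * z1 ^ k) UNIV" for k
      using has_sum_cmult_left[OF has_sum_infsum[OF inner[of k]], of "z1 ^ k"]
      by (simp add: A_def mult_ac)
    then show "((\<lambda>k. A c z2 k * z1 ^ k) has_sum f (z1, z2)) UNIV"
      using has_sum_SigmaD[OF hs[OF z(1)]] by simp
  qed
  have AB: "A a z2 = A b z2" if "z2 \<in> ball 0 1" for z2
    using outer[OF assms(1) _ that] outer[OF assms(2) _ that]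
    by (rule has_sum_powser_unique)
  have "a k = b k" for k
  proof (rule has_sum_powser_unique)
    fix z2 :: complex assume z2: "z2 \<in> ball 0 1"
    show "((\<lambda>l. a k l * z2 ^ l) has_sum A a z2 k) UNIV"
      using inner[OF assms(1) _ z2, of 0 k] unfolding A_def by (simp add: has_sum_infsum)
    show "((\<lambda>l. b k l * z2 ^ l) has_sum A a z2 k) UNIV"
      using inner[OF assms(2) _ z2, of 0 k] unfolding AB[OF z2] unfolding A_def
      by (simp add: has_sum_infsum)
  qed
  then show ?thesis by blast
qed

lemma taylor_eq: "has_expansion f a \<Longrightarrow> taylor f = a"
  unfolding taylor_def by (blast intro: has_expansion_unique)

definition dirichlet_term ::
  "real \<Rightarrow> real \<Rightarrow> (complex \<times> complex \<Rightarrow> complex) \<Rightarrow> nat \<times> nat \<Rightarrow> real" where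
  "dirichlet_term \<alpha>1 \<alpha>2 f =
     (\<lambda>(k, l). (real k + 1) powr \<alpha>1 * (real l + 1) powr \<alpha>2 * (cmod (taylor f k l))\<^sup>2)"

definition dirichlet_space ::
  "real \<Rightarrow> real \<Rightarrow> (complex \<times> complex \<Rightarrow> complex) set" where
  "dirichlet_space \<alpha>1 \<alpha>2 =
     {f. (\<exists>a. has_expansion f a) \<and> dirichlet_term \<alpha>1 \<alpha>2 f summable_on UNIV}"

definition dirichlet_norm ::
  "real \<Rightarrow> real \<Rightarrow> (complex \<times> complex \<Rightarrow> complex) \<Rightarrow> real" where
  "dirichlet_norm \<alpha>1 \<alpha>2 f = sqrt (infsum (dirichlet_term \<alpha>1 \<alpha>2 f) UNIV)"

text \<open>
  The closure in \<open>dirichlet_space \<alpha>1 \<alpha>2\<close> of the complex linear span of \<open>S\<close>, for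
  \<open>S \<subseteq> dirichlet_space \<alpha>1 \<alpha>2\<close>. (The norm ignores the values off the bidisk, so
  functions agreeing on \<open>bidisk\<close> are identified.)
\<close>

definition closed_linear_span ::
  "real \<Rightarrow> real \<Rightarrow> (complex \<times> complex \<Rightarrow> complex) set \<Rightarrow> (complex \<times> complex \<Rightarrow> complex) set" where
  "closed_linear_span \<alpha>1 \<alpha>2 S =
     {g \<in> dirichlet_space \<alpha>1 \<alpha>2. \<forall>\<epsilon>>0. \<exists>h \<in> module.span (\<lambda>c f z. c * f z) S.
        dirichlet_norm \<alpha>1 \<alpha>2 (\<lambda>z. g z - h z) < \<epsilon>}"

definition cyclic ::
  "real \<Rightarrow> real \<Rightarrow> (complex \<times> complex \<Rightarrow> complex) \<Rightarrow> bool" where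
  "cyclic \<alpha>1 \<alpha>2 f \<longleftrightarrow>
     f \<in> dirichlet_space \<alpha>1 \<alpha>2 \<and>
     closed_linear_span \<alpha>1 \<alpha>2 {(\<lambda>(z1, z2). z1 ^ k * z2 ^ l * f (z1, z2)) | k l. True}
       = dirichlet_space \<alpha>1 \<alpha>2"

end

theory Submission
  imports Defs "HOL-Computational_Algebra.Fundamental_Theorem_Algebra"
    "HOL-Computational_Algebra.Polynomial_Factorial" "HOL-Computational_Algebra.Field_as_Ring"
begin

text \<open>
  \<open>p\<close> is cyclic iff \<open>1\<close> is a limit of polynomial multiples of \<open>p\<close>, which is a statement about
  coefficient arrays.

  If \<open>\<alpha>1 + \<alpha>2 \<le> 1\<close>, the quotients \<open>p(z1, z2) / p(r z1, z2)\<close> stay bounded as \<open>r \<rightarrow> 1\<close>, so a weak limit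
  argument applies. Indeed, for fixed \<open>z2\<close> the coefficients \<open>c\<^sub>k\<close> of such a quotient satisfy bounds on
  \<open>\<Sum>k. |c\<^sub>k|\<close> and on \<open>k |c\<^sub>k|\<close> that are stable under products of linear factors, which controls
  \<open>\<Sum>k l. (k + 1) |x\<^sub>k\<^sub>l|\<^sup>2\<close>; and as \<open>p\<close> does not vanish near \<open>{0} \<times> cball 0 1\<close> and \<open>cball 0 1 \<times> {0}\<close>, Cauchy estimates
  leave only the region where \<open>k\<close> and \<open>l\<close> are comparable.

  In general let \<open>q\<close> be the reflection of \<open>p\<close> in the torus. If \<open>q\<close> is a multiple of \<open>p\<close>, then \<open>p\<close> has
  infinitely many zeros on the torus, and the conjugated coefficients of \<open>\<partial>\<^sub>1p / p\<close> give a functional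
  annihilating all multiples of \<open>p\<close>; it is bounded when \<open>\<alpha>1 + \<alpha>2 > 1\<close>. Otherwise \<open>A p + B q = r(z1)\<close> for some
  \<open>r \<noteq> 0\<close>, so the zeros on the torus are finite in number and \<open>|r| \<le> C |p|\<close> on the bidisk because
  \<open>|q| \<le> |p|\<close> there. After removing the roots of \<open>r\<close> off the circle, a high power of \<open>r\<close> divided by \<open>p\<close> is smooth
  up to the boundary, which reduces the problem to the cyclicity of a one-variable polynomial.
\<close>

section \<open>Weighted square-summable families\<close>

text \<open>The threshold 1 has one source in each direction. A linear quotient
  \<open>(z - a) / (r z - a)\<close> with \<open>|a| = 1\<close> has coefficients of modulus
  \<open>(1 - r) r^j\<close>, and their squares summed against \<open>(k + 1)^\<beta>\<close> stay
  bounded as \<open>r\<close> tends to 1 exactly for \<open>\<beta> \<le> 1\<close>. The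
  coefficients of a one-variable logarithmic derivative are bounded by the degree, and bounded
  coefficients pair with the dual weight \<open>(k + 1)^(-\<beta>)\<close> exactly for
  \<open>\<beta> > 1\<close>. The Dirichlet norm of a product is not controlled by the norms of its
  factors; this forces the detour through bounds that are. Only \<open>z1\<close> is dilated, so
  that a slice at fixed \<open>z2\<close> stays a one-variable problem with constants depending on
  the degree alone. When the torus zeros are finite in number, domination by \<open>r(z1)\<close>
  replaces any local analysis at these zeros, and having a single variable in \<open>r\<close>
  leaves only the exponent of that variable to be compared with 1; exchanging the variables makes it
  the smaller one.\<close>

definition sqle :: "('i \<Rightarrow> real) \<Rightarrow> ('i \<Rightarrow> complex) \<Rightarrow> real \<Rightarrow> bool" where
  "sqle w x C \<longleftrightarrow> (\<forall>F. finite F \<longrightarrow> (\<Sum>i\<in>F. w i * (cmod (x i))\<^sup>2) \<le> C)"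

lemma sqleD: "sqle w x C \<Longrightarrow> finite F \<Longrightarrow> (\<Sum>i\<in>F. w i * (cmod (x i))\<^sup>2) \<le> C"
  by (simp add: sqle_def)

lemma sqle_nonneg: "sqle w x C \<Longrightarrow> 0 \<le> C"
  using sqleD[of w x C "{}"] by simp

lemma sqle_mono: "sqle w x C \<Longrightarrow> C \<le> D \<Longrightarrow> sqle w x D"
  unfolding sqle_def by (meson order_trans)

text \<open>Young's inequality for the cross term. The free \<open>\<eta>\<close> brings the
  constant of one summand arbitrarily close to 1, which the weak-limit argument and the Bessel
  inequality both need.\<close>

lemma norm_add_sq_le:
  fixes a b :: "'a::real_normed_vector"
  assumes "\<eta> > 0"
  shows "(norm (a + b))\<^sup>2 \<le> (1 + 1/\<eta>) * (norm a)\<^sup>2 + (1 + \<eta>) * (norm b)\<^sup>2"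
proof -
  have "(norm (a + b))\<^sup>2 \<le> (norm a + norm b)\<^sup>2"
    by (simp add: norm_triangle_ineq power_mono)
  also have "\<dots> \<le> (1 + 1/\<eta>) * (norm a)\<^sup>2 + (1 + \<eta>) * (norm b)\<^sup>2"
  proof -
    have "0 \<le> (norm a - \<eta> * norm b)\<^sup>2 / \<eta>" using assms by simp
    also have "\<dots> = (norm a)\<^sup>2 / \<eta> - 2 * norm a * norm b + \<eta> * (norm b)\<^sup>2"
      using assms by (simp add: power2_eq_square field_simps)
    finally show ?thesis by (simp add: power2_eq_square algebra_simps)
  qed
  finally show ?thesis .
qed

lemma sqle_add_weighted:
  assumes w: "\<And>i. w i \<ge> 0" and "\<eta> > 0" "sqle w x C" "sqle w y D"
  shows "sqle w (\<lambda>i. x i + y i) ((1 + 1/\<eta>) * C + (1 + \<eta>) * D)"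
  unfolding sqle_def
proof (intro allI impI)
  fix F :: "'a set" assume F: "finite F"
  have "(\<Sum>i\<in>F. w i * (cmod (x i + y i))\<^sup>2)
      \<le> (\<Sum>i\<in>F. w i * ((1 + 1/\<eta>) * (cmod (x i))\<^sup>2 + (1 + \<eta>) * (cmod (y i))\<^sup>2))"
    by (intro sum_mono mult_left_mono norm_add_sq_le w assms)
  also have "\<dots> = (1 + 1/\<eta>) * (\<Sum>i\<in>F. w i * (cmod (x i))\<^sup>2) + (1 + \<eta>) * (\<Sum>i\<in>F. w i * (cmod (y i))\<^sup>2)"
    by (simp add: sum_distrib_left sum.distrib[symmetric] algebra_simps)
  also have "\<dots> \<le> (1 + 1/\<eta>) * C + (1 + \<eta>) * D"
    using assms F by (intro add_mono mult_left_mono sqleD) auto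
  finally show "(\<Sum>i\<in>F. w i * (cmod (x i + y i))\<^sup>2) \<le> (1 + 1/\<eta>) * C + (1 + \<eta>) * D" .
qed

lemma sqle_add:
  assumes "\<And>i. w i \<ge> 0" "sqle w x C" "sqle w y D"
  shows "sqle w (\<lambda>i. x i + y i) (2 * C + 2 * D)"
  using sqle_add_weighted[of w 1 x C y D] assms by simp

lemma sqle_scale:
  assumes "sqle w x C"
  shows "sqle w (\<lambda>i. c * x i) ((cmod c)\<^sup>2 * C)"
  unfolding sqle_def
proof (intro allI impI)
  fix F :: "'a set" assume F: "finite F"
  have "(\<Sum>i\<in>F. w i * (cmod (c * x i))\<^sup>2) = (cmod c)\<^sup>2 * (\<Sum>i\<in>F. w i * (cmod (x i))\<^sup>2)"
    by (simp add: sum_distrib_left norm_mult power_mult_distrib mult_ac)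
  also have "\<dots> \<le> (cmod c)\<^sup>2 * C" by (intro mult_left_mono sqleD[OF assms] F) simp
  finally show "(\<Sum>i\<in>F. w i * (cmod (c * x i))\<^sup>2) \<le> (cmod c)\<^sup>2 * C" .
qed

lemma sqle_uminus: "sqle w x C \<Longrightarrow> sqle w (\<lambda>i. - x i) C"
  by (simp add: sqle_def)

lemma sqle_diff:
  assumes "\<And>i. w i \<ge> 0" "sqle w x C" "sqle w y D"
  shows "sqle w (\<lambda>i. x i - y i) (2 * C + 2 * D)"
  using sqle_add[OF assms(1) assms(2) sqle_uminus[OF assms(3)]] by simp

text \<open>Operators enter only through their norm estimates. The application is multiplication by
  a polynomial, a finite combination of shifts.\<close>

lemma sqle_sum:
  fixes w :: "'i \<Rightarrow> real" and x :: "'j \<Rightarrow> 'i \<Rightarrow> complex"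
  assumes w: "\<And>i. w i \<ge> 0" and "finite J" and "\<And>j. j \<in> J \<Longrightarrow> \<exists>K\<ge>0. \<forall>y C. sqle w y C \<longrightarrow> sqle w (T j y) (K * C)"
  shows "\<exists>K\<ge>0. \<forall>y C. sqle w y C \<longrightarrow> sqle w (\<lambda>i. \<Sum>j\<in>J. T j y i) (K * C)"
  using assms(2,3)
proof (induction J rule: finite_induct)
  case empty
  show ?case by (rule exI[of _ 0]) (auto simp: sqle_def)
next
  case (insert j J)
  obtain K where K: "K \<ge> 0" "\<And>y C. sqle w y C \<Longrightarrow> sqle w (T j y) (K * C)" using insert.prems by blast
  obtain L where L: "L \<ge> 0" "\<And>y C. sqle w y C \<Longrightarrow> sqle w (\<lambda>i. \<Sum>j\<in>J. T j y i) (L * C)"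
    using insert by auto
  show ?case
  proof (rule exI[of _ "2 * K + 2 * L"], intro conjI allI impI)
    fix y C assume y: "sqle w y C"
    show "sqle w (\<lambda>i. \<Sum>j\<in>insert j J. T j y i) ((2 * K + 2 * L) * C)"
      using sqle_add[OF w K(2)[OF y] L(2)[OF y]] insert.hyps by (simp add: algebra_simps)
  qed (use K L in simp)
qed

text \<open>A finite \<open>F\<close> whose partial sum is within \<open>\<delta>\<close> of the
  supremum leaves less than \<open>\<delta>\<close> for all indices outside it.\<close>

lemma sqle_tail:
  assumes w: "\<And>i. w i \<ge> 0" and "sqle w x C" and "\<delta> > 0"
  obtains F where "finite F" "sqle w (\<lambda>i. if i \<in> F then 0 else x i) \<delta>"
proof -
  define S where "S F = (\<Sum>i\<in>F. w i * (cmod (x i))\<^sup>2)" for F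
  have bdd: "bdd_above (S ` {F. finite F})"
    using assms(2) by (intro bdd_aboveI[of _ C]) (auto simp: S_def sqle_def)
  obtain F where F: "finite F" "S F > (SUP F\<in>{F. finite F}. S F) - \<delta>"
  proof -
    have "(SUP F\<in>{F. finite F}. S F) - \<delta> < (SUP F\<in>{F. finite F}. S F)" using assms by simp
    from less_cSUP_iff[OF _ bdd, THEN iffD1, OF _ this] show ?thesis using that by auto
  qed
  show ?thesis
  proof (rule that[OF F(1)], unfold sqle_def, intro allI impI)
    fix G :: "'a set" assume G: "finite G"
    have "(\<Sum>i\<in>G. w i * (cmod (if i \<in> F then 0 else x i))\<^sup>2) = S (G - F)"
      unfolding S_def using G by (intro sum.mono_neutral_cong_right) auto
    also have "\<dots> = S (F \<union> G) - S F"
      unfolding S_def using G F by (simp add: sum_diff[symmetric] Un_Diff Diff_subset)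
    also have "S (F \<union> G) \<le> (SUP F\<in>{F. finite F}. S F)"
      by (rule cSUP_upper[OF _ bdd]) (use F G in auto)
    finally show "(\<Sum>i\<in>G. w i * (cmod (if i \<in> F then 0 else x i))\<^sup>2) \<le> \<delta>" using F by simp
  qed
qed

section \<open>Weak limits and convex combinations\<close>

text \<open>Pythagoras up to an error of 1. On a finite set carrying almost all of \<open>u\<close>
  the family \<open>y n\<close> changes little for large \<open>n\<close>; off that set
  \<open>u\<close> is negligible. The squared norms therefore add, without the factor 2 of
  \<open>sqle_add\<close>.\<close>

lemma sqle_add_weakly_null:
  assumes w: "\<And>i. w i \<ge> 0" and u: "sqle w u B" and y: "\<And>n. sqle w (y n) C"
    and lim: "\<And>i. (\<lambda>n. y n i) \<longlonglongrightarrow> 0"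
  shows "\<exists>n::nat. sqle w (\<lambda>i. u i + y n i) (B + C + 1)"
proof -
  have C: "C \<ge> 0" using y sqle_nonneg by blast
  \<comment> \<open>The error budget: 1/2 for the finite part, and 1/4 each for
    \<open>\<eta> * C\<close> and \<open>(1 + 1/\<eta>) * \<delta>\<close> on the tail.\<close>
  define \<eta> where "\<eta> = 1 / (4 * (C + 1))"
  have \<eta>: "\<eta> > 0" "\<eta> * C \<le> 1/4" using C by (auto simp: \<eta>_def field_simps)
  define \<delta> where "\<delta> = 1 / (4 * (1 + 1/\<eta>))"
  have "1 + 1/\<eta> > 0" using \<eta> by (simp add: add_pos_pos)
  then have \<delta>: "\<delta> > 0" "(1 + 1/\<eta>) * \<delta> = 1/4" by (auto simp: \<delta>_def)
  obtain F where F: "finite F" and tail: "sqle w (\<lambda>i. if i \<in> F then 0 else u i) \<delta>"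
    using sqle_tail[OF w u \<delta>(1)] .
  have "(\<lambda>n. \<Sum>i\<in>F. w i * (cmod (u i + y n i))\<^sup>2) \<longlonglongrightarrow> (\<Sum>i\<in>F. w i * (cmod (u i + 0))\<^sup>2)"
    by (intro tendsto_intros lim)
  then have "eventually (\<lambda>n. (\<Sum>i\<in>F. w i * (cmod (u i + y n i))\<^sup>2) < (\<Sum>i\<in>F. w i * (cmod (u i + 0))\<^sup>2) + 1/2) sequentially"
    by (rule order_tendstoD) simp
  then obtain n where n: "(\<Sum>i\<in>F. w i * (cmod (u i + y n i))\<^sup>2) < (\<Sum>i\<in>F. w i * (cmod (u i))\<^sup>2) + 1/2"
    by (auto simp: eventually_sequentially)
  have "(\<Sum>i\<in>G. w i * (cmod (u i + y n i))\<^sup>2) \<le> B + C + 1" if G: "finite G" for G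
  proof -
    have "(\<Sum>i\<in>G. w i * (cmod (u i + y n i))\<^sup>2) \<le> (\<Sum>i\<in>F \<union> (G - F). w i * (cmod (u i + y n i))\<^sup>2)"
      using F G w by (intro sum_mono2) auto
    also have "\<dots> = (\<Sum>i\<in>F. w i * (cmod (u i + y n i))\<^sup>2) + (\<Sum>i\<in>G - F. w i * (cmod (u i + y n i))\<^sup>2)"
      using F G by (intro sum.union_disjoint) auto
    also have "(\<Sum>i\<in>G - F. w i * (cmod (u i + y n i))\<^sup>2)
        = (\<Sum>i\<in>G - F. w i * (cmod ((if i \<in> F then 0 else u i) + y n i))\<^sup>2)"
      by (intro sum.cong) auto
    also have "\<dots> \<le> (1 + 1/\<eta>) * \<delta> + (1 + \<eta>) * C"
      by (rule sqleD[OF sqle_add_weighted[OF w \<eta>(1) tail y]]) (use G in simp)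
    also have "\<dots> \<le> 1/2 + C" using \<delta>(2) \<eta>(2) distrib_right[of 1 \<eta> C] by linarith
    finally show ?thesis using n sqleD[OF u F] by linarith
  qed
  then show ?thesis unfolding sqle_def by blast
qed

text \<open>The Banach--Saks averaging argument: each new member of the sequence is chosen almost
  orthogonal to the convex combination built so far.\<close>

lemma banach_saks_null:
  assumes w: "\<And>i. w i \<ge> 0"
    and K: "\<And>u v t. u \<in> K \<Longrightarrow> v \<in> K \<Longrightarrow> 0 \<le> t \<Longrightarrow> t \<le> 1 \<Longrightarrow> (\<lambda>i. of_real (1 - t) * u i + of_real t * v i) \<in> K"
    and yK: "\<And>n. y n \<in> K" and y: "\<And>n::nat. sqle w (y n) C"
    and lim: "\<And>i. (\<lambda>n. y n i) \<longlonglongrightarrow> 0"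
  shows "\<exists>u\<in>K. sqle w u ((C + 1) / real (Suc N))"
proof (induction N)
  case 0
  then show ?case using yK[of 0] sqle_mono[OF y[of 0], of "C + 1"] by auto
next
  case (Suc N)
  define M where "M = real (Suc N)"
  have M: "M > 0" "real (Suc (Suc N)) = M + 1" by (auto simp: M_def)
  obtain u where u: "u \<in> K" "sqle w u ((C + 1) / M)" using Suc M_def by auto
  have "sqle w (\<lambda>i. of_real M * u i) ((cmod (of_real M))\<^sup>2 * ((C + 1) / M))" by (rule sqle_scale[OF u(2)])
  then have "sqle w (\<lambda>i. of_real M * u i) (M * (C + 1))" using M by (simp add: power2_eq_square)
  from sqle_add_weakly_null[OF w this y lim] obtain n
    where n: "sqle w (\<lambda>i. of_real M * u i + y n i) (M * (C + 1) + C + 1)" by blast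
  \<comment> \<open>This weight turns the convex combination into
    \<open>(M u + y n) / (M + 1)\<close>, whose squared norm is at most
    \<open>(M + 1) (C + 1) / (M + 1)^2\<close>.\<close>
  define t where "t = 1 / (M + 1)"
  have t: "0 \<le> t" "t \<le> 1" using M by (auto simp: t_def field_simps)
  have "(\<lambda>i. of_real (1 - t) * u i + of_real t * y n i) = (\<lambda>i. of_real (1 / (M + 1)) * (of_real M * u i + y n i))"
  proof
    fix i
    have "1 - t = 1 / (M+1) * M" using M by (simp add: t_def field_simps)
    then show "of_real (1 - t) * u i + of_real t * y n i = of_real (1 / (M + 1)) * (of_real M * u i + y n i)"
      unfolding t_def by (simp only: of_real_mult ring_distribs mult.assoc)
  qed
  moreover have "sqle w (\<lambda>i. of_real (1 / (M + 1)) * (of_real M * u i + y n i)) ((C + 1) / (M + 1))"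
  proof -
    have "(cmod (of_real (1 / (M + 1))))\<^sup>2 * (M * (C + 1) + C + 1) = (C + 1) / (M + 1)"
    proof -
      have "(cmod (of_real (1 / (M + 1))))\<^sup>2 = 1 / (M+1)^2" using M by (simp add: norm_divide power_divide del: of_real_add of_real_divide)
      moreover have "M * (C + 1) + C + 1 = (M + 1) * (C + 1)" by (simp add: algebra_simps)
      ultimately show ?thesis using M by (simp add: power2_eq_square)
    qed
    then show ?thesis using sqle_scale[OF n, of "of_real (1 / (M + 1))"] by simp
  qed
  ultimately show ?case using K[OF u(1) yK[of n] t] unfolding M(2) by metis
qed

text \<open>Weak lower semicontinuity of the norm is immediate here, because \<open>sqle\<close>
  speaks of finite partial sums only and asks for no summability.\<close>

lemma sqle_limit:
  assumes y: "\<And>n::nat. sqle w (y n) C" and lim: "\<And>i. (\<lambda>n. y n i) \<longlonglongrightarrow> x i"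
  shows "sqle w x C"
  unfolding sqle_def
proof (intro allI impI)
  fix F :: "'a set" assume F: "finite F"
  have "(\<lambda>n. \<Sum>i\<in>F. w i * (cmod (y n i))\<^sup>2) \<longlonglongrightarrow> (\<Sum>i\<in>F. w i * (cmod (x i))\<^sup>2)"
    by (intro tendsto_intros lim)
  then show "(\<Sum>i\<in>F. w i * (cmod (x i))\<^sup>2) \<le> C"
    by (rule LIMSEQ_le_const2) (use sqleD[OF y F] in auto)
qed

text \<open>A convex set approximates in norm every bounded coefficientwise limit of its members;
  translation by \<open>x\<close> reduces this to a null sequence.\<close>

lemma banach_saks:
  assumes w: "\<And>i. w i \<ge> 0"
    and K: "\<And>u v t. u \<in> K \<Longrightarrow> v \<in> K \<Longrightarrow> 0 \<le> t \<Longrightarrow> t \<le> 1 \<Longrightarrow> (\<lambda>i. of_real (1 - t) * u i + of_real t * v i) \<in> K"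
    and yK: "\<And>n. y n \<in> K" and y: "\<And>n::nat. sqle w (y n) C"
    and lim: "\<And>i. (\<lambda>n. y n i) \<longlonglongrightarrow> x i" and \<epsilon>: "\<epsilon> > 0"
  shows "\<exists>u\<in>K. sqle w (\<lambda>i. u i - x i) \<epsilon>"
proof -
  define K' where "K' = (\<lambda>u i. u i - x i) ` K"
  obtain N :: nat where N: "(2 * C + 2 * C + 1) / \<epsilon> < real N" using reals_Archimedean2 by blast
  have "\<exists>u\<in>K'. sqle w u ((2 * C + 2 * C + 1) / real (Suc N))"
  proof (rule banach_saks_null[OF w])
    fix u v and t :: real assume a: "u \<in> K'" "v \<in> K'" "0 \<le> t" "t \<le> 1"
    obtain u' v' where uv: "u' \<in> K" "v' \<in> K" "u = (\<lambda>i. u' i - x i)" "v = (\<lambda>i. v' i - x i)"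
      using a by (auto simp: K'_def)
    show "(\<lambda>i. of_real (1 - t) * u i + of_real t * v i) \<in> K'"
      unfolding K'_def using K[OF uv(1,2) a(3,4)]
      by (rule image_eqI[rotated]) (simp add: uv algebra_simps)
  next
    show "(\<lambda>i. y n i - x i) \<in> K'" for n using yK by (auto simp: K'_def)
    show "sqle w (\<lambda>i. y n i - x i) (2 * C + 2 * C)" for n by (intro sqle_diff w y sqle_limit[OF y lim])
    show "(\<lambda>n. y n i - x i) \<longlonglongrightarrow> 0" for i using lim[of i] by (simp add: LIM_zero_iff)
  qed
  then obtain u where u: "u \<in> K" "sqle w (\<lambda>i. u i - x i) ((2 * C + 2 * C + 1) / real (Suc N))"
    unfolding K'_def by blast
  have "(2 * C + 2 * C + 1) / real (Suc N) \<le> \<epsilon>"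
  proof -
    have "(2 * C + 2 * C + 1) < \<epsilon> * real N" using N \<epsilon> by (simp add: field_simps)
    also have "\<dots> \<le> \<epsilon> * real (Suc N)" using \<epsilon> by simp
    finally show ?thesis by (simp add: field_simps)
  qed
  then show ?thesis using u sqle_mono by blast
qed

lemma sqle_imp_summable:
  assumes "\<And>i. w i \<ge> 0" "sqle w x C"
  shows "(\<lambda>i. w i * (cmod (x i))\<^sup>2) summable_on UNIV" "infsum (\<lambda>i. w i * (cmod (x i))\<^sup>2) UNIV \<le> C"
proof -
  show s: "(\<lambda>i. w i * (cmod (x i))\<^sup>2) summable_on UNIV"
    using assms by (intro nonneg_bdd_above_summable_on bdd_aboveI[of _ C]) (auto simp: sqle_def)
  show "infsum (\<lambda>i. w i * (cmod (x i))\<^sup>2) UNIV \<le> C"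
    using assms by (intro infsum_le_finite_sums s) (auto simp: sqle_def)
qed

lemma sqle_comparison:
  assumes le: "\<And>i. w i * (cmod (x i))\<^sup>2 \<le> K * g i" and g: "g summable_on UNIV" "\<And>i. 0 \<le> g i" and K: "0 \<le> K"
  shows "sqle w x (K * infsum g UNIV)"
  unfolding sqle_def
proof (intro allI impI)
  fix F :: "'a set" assume F: "finite F"
  have "(\<Sum>i\<in>F. w i * (cmod (x i))\<^sup>2) \<le> K * sum g F"
    unfolding sum_distrib_left by (intro sum_mono le)
  also have "\<dots> \<le> K * infsum g UNIV"
    using K g by (intro mult_left_mono finite_sum_le_infsum F) auto
  finally show "(\<Sum>i\<in>F. w i * (cmod (x i))\<^sup>2) \<le> K * infsum g UNIV" .
qed

lemma summable_imp_sqle: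
  assumes "\<And>i. w i \<ge> 0" "(\<lambda>i. w i * (cmod (x i))\<^sup>2) summable_on UNIV"
  shows "sqle w x (infsum (\<lambda>i. w i * (cmod (x i))\<^sup>2) UNIV)"
  unfolding sqle_def using assms by (auto intro!: finite_sum_le_infsum)

section \<open>Coefficient arrays of polynomials and power series\<close>

definition pc :: "complex poly poly \<Rightarrow> nat \<times> nat \<Rightarrow> complex" where
  "pc p = (\<lambda>(k, l). coeff (coeff p l) k)"

lemma pc_apply: "pc p (k, l) = coeff (coeff p l) k"
  by (simp add: pc_def)

lemma pc_inject: "pc p = pc q \<longleftrightarrow> p = q"
proof
  assume "pc p = pc q"
  then have "coeff (coeff p l) k = coeff (coeff q l) k" for k l by (metis pc_apply)
  then show "p = q" by (simp add: poly_eq_iff)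
qed simp

lemma pc_add: "pc (p + q) i = pc p i + pc q i"
  and pc_diff: "pc (p - q) i = pc p i - pc q i"
  and pc_0: "pc 0 i = 0"
  by (cases i; simp add: pc_def)+

lemma pc_sum: "pc (sum f A) i = (\<Sum>a\<in>A. pc (f a) i)"
  by (induction A rule: infinite_finite_induct) (auto simp: pc_add pc_0)

lemma pc_monom: "pc (monom (monom c k) l) i = (if i = (k, l) then c else 0)"
  by (cases i) (auto simp: pc_def)

lemma pc_smult: "pc (smult [:c:] p) i = c * pc p i"
  by (cases i) (simp add: pc_def)

lemma pc_1: "pc 1 i = (if i = (0, 0) then 1 else 0)"
  using pc_monom[of 1 0 0 i] by (simp add: monom_0 flip: one_pCons)

lemma finite_pc: "finite {i. pc p i \<noteq> 0}"
proof (rule finite_subset)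
  define n where "n = (MAX l\<in>{..degree p}. degree (coeff p l))"
  show "{i. pc p i \<noteq> 0} \<subseteq> {..n} \<times> {..degree p}"
  proof clarify
    fix k l assume "pc p (k, l) \<noteq> 0"
    then have a: "coeff (coeff p l) k \<noteq> 0" by (simp add: pc_apply)
    then have l: "l \<le> degree p" by (metis coeff_0 le_degree)
    have "k \<le> degree (coeff p l)" using a by (simp add: le_degree)
    also have "\<dots> \<le> n" unfolding n_def using l by (intro Max_ge) auto
    finally show "k \<in> {..n} \<and> l \<in> {..degree p}" using l by simp
  qed
qed simp

definition mkp :: "(nat \<times> nat \<Rightarrow> complex) \<Rightarrow> (nat \<times> nat) set \<Rightarrow> complex poly poly" where
  "mkp x F = (\<Sum>(k, l)\<in>F. monom (monom (x (k, l)) k) l)"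

lemma pc_mkp: "finite F \<Longrightarrow> pc (mkp x F) i = (if i \<in> F then x i else 0)"
proof -
  assume F: "finite F"
  have "pc (mkp x F) i = (\<Sum>j\<in>F. if i = j then x j else 0)"
    unfolding mkp_def pc_sum by (intro sum.cong) (auto simp: pc_monom)
  then show ?thesis using F by simp
qed

lemma poly_eq_mkp: "finite F \<Longrightarrow> {i. pc p i \<noteq> 0} \<subseteq> F \<Longrightarrow> p = mkp (pc p) F"
  unfolding pc_inject[symmetric] by (auto simp: fun_eq_iff pc_mkp)

lemma eval2_add: "eval2 (p + q) z = eval2 p z + eval2 q z"
  and eval2_diff: "eval2 (p - q) z = eval2 p z - eval2 q z"
  and eval2_mult: "eval2 (p * q) z = eval2 p z * eval2 q z"
  and eval2_0: "eval2 0 z = 0"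
  and eval2_1: "eval2 1 z = 1"
  by (cases z; simp add: eval2_def)+

lemma eval2_power: "eval2 (p ^ n) z = eval2 p z ^ n"
  by (induction n) (auto simp: eval2_mult eval2_1)

lemma eval2_const: "eval2 [:c:] (z1, z2) = poly c z1"
  by (simp add: eval2_def)

lemma eval2_sum: "eval2 (sum f A) z = (\<Sum>a\<in>A. eval2 (f a) z)"
  by (induction A rule: infinite_finite_induct) (auto simp: eval2_add eval2_0)

lemma eval2_monom: "eval2 (monom (monom c k) l) (z1, z2) = c * z1 ^ k * z2 ^ l"
  by (simp add: eval2_def poly_monom poly_power)

lemma eval2_mkp: "eval2 (mkp x F) (z1, z2) = (\<Sum>(k, l)\<in>F. x (k, l) * z1 ^ k * z2 ^ l)"
  unfolding mkp_def eval2_sum by (intro sum.cong) (auto simp: eval2_monom)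

lemma eval2_expand:
  assumes "finite F" "{i. pc p i \<noteq> 0} \<subseteq> F"
  shows "eval2 p (z1, z2) = (\<Sum>(k, l)\<in>F. pc p (k, l) * z1 ^ k * z2 ^ l)"
  using eval2_mkp[of "pc p" F z1 z2] poly_eq_mkp[OF assms] by metis

section \<open>Double power series on polydiscs\<close>

text \<open>Two radii, because decisive coefficient estimates come from polydiscs that reach beyond
  the unit circle in one variable and are thin in the other.\<close>

definition ps_on :: "real \<Rightarrow> real \<Rightarrow> (complex \<times> complex \<Rightarrow> complex) \<Rightarrow> (nat \<times> nat \<Rightarrow> complex) \<Rightarrow> bool" where
  "ps_on R1 R2 f x \<longleftrightarrow> (\<forall>z1 z2. cmod z1 < R1 \<longrightarrow> cmod z2 < R2 \<longrightarrow>
     ((\<lambda>(k, l). x (k, l) * z1 ^ k * z2 ^ l) has_sum f (z1, z2)) UNIV)"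

abbreviation ps :: "(complex \<times> complex \<Rightarrow> complex) \<Rightarrow> (nat \<times> nat \<Rightarrow> complex) \<Rightarrow> bool" where
  "ps \<equiv> ps_on 1 1"

lemma has_expansion_iff_ps: "has_expansion f a \<longleftrightarrow> ps f (\<lambda>(k, l). a k l)"
  unfolding has_expansion_def ps_on_def bidisk_def by (auto simp: dist_norm)

lemma ps_iff_has_expansion: "ps f x \<longleftrightarrow> has_expansion f (\<lambda>k l. x (k, l))"
  unfolding has_expansion_iff_ps by simp

lemma ps_unique: "ps f x \<Longrightarrow> ps f y \<Longrightarrow> x = y"
  unfolding ps_iff_has_expansion using has_expansion_unique by (force simp: fun_eq_iff)

lemma ps_onD: "ps_on R1 R2 f x \<Longrightarrow> cmod z1 < R1 \<Longrightarrow> cmod z2 < R2 \<Longrightarrow>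
    ((\<lambda>(k, l). x (k, l) * z1 ^ k * z2 ^ l) has_sum f (z1, z2)) UNIV"
  by (simp add: ps_on_def)

lemma ps_on_cong:
  assumes "\<And>z1 z2. cmod z1 < R1 \<Longrightarrow> cmod z2 < R2 \<Longrightarrow> f (z1, z2) = g (z1, z2)"
  shows "ps_on R1 R2 f x \<longleftrightarrow> ps_on R1 R2 g x"
  unfolding ps_on_def by (simp add: assms)

lemma ps_on_mono: "ps_on R1 R2 f x \<Longrightarrow> r1 \<le> R1 \<Longrightarrow> r2 \<le> R2 \<Longrightarrow> ps_on r1 r2 f x"
  unfolding ps_on_def by (meson order_less_le_trans)

lemma ps_on_add:
  assumes "ps_on R1 R2 f x" "ps_on R1 R2 g y"
  shows "ps_on R1 R2 (\<lambda>z. f z + g z) (\<lambda>i. x i + y i)"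
  unfolding ps_on_def
proof (intro allI impI)
  fix z1 z2 :: complex assume z: "cmod z1 < R1" "cmod z2 < R2"
  from has_sum_add[OF ps_onD[OF assms(1) z] ps_onD[OF assms(2) z]]
  show "((\<lambda>(k, l). (x (k, l) + y (k, l)) * z1 ^ k * z2 ^ l) has_sum f (z1, z2) + g (z1, z2)) UNIV"
    by (simp add: case_prod_unfold algebra_simps)
qed

lemma ps_on_cmult:
  assumes "ps_on R1 R2 f x"
  shows "ps_on R1 R2 (\<lambda>z. c * f z) (\<lambda>i. c * x i)"
  unfolding ps_on_def
proof (intro allI impI)
  fix z1 z2 :: complex assume z: "cmod z1 < R1" "cmod z2 < R2"
  from has_sum_cmult_right[OF ps_onD[OF assms(1) z], of c]
  show "((\<lambda>(k, l). (c * x (k, l)) * z1 ^ k * z2 ^ l) has_sum c * f (z1, z2)) UNIV"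
    by (simp add: case_prod_unfold algebra_simps)
qed

lemma ps_on_diff:
  assumes "ps_on R1 R2 f x" "ps_on R1 R2 g y"
  shows "ps_on R1 R2 (\<lambda>z. f z - g z) (\<lambda>i. x i - y i)"
  using ps_on_add[OF assms(1) ps_on_cmult[OF assms(2), of "-1"]] by simp

lemma ps_on_0: "ps_on R1 R2 (\<lambda>z. 0) (\<lambda>i. 0)"
  by (simp add: ps_on_def case_prod_unfold)

lemma ps_on_sum:
  assumes "\<And>j. j \<in> J \<Longrightarrow> ps_on R1 R2 (f j) (x j)"
  shows "ps_on R1 R2 (\<lambda>z. \<Sum>j\<in>J. f j z) (\<lambda>i. \<Sum>j\<in>J. x j i)"
  using assms by (induction J rule: infinite_finite_induct) (auto simp: ps_on_0 intro: ps_on_add)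

lemma ps_on_eval2: "ps_on R1 R2 (eval2 p) (pc p)"
  unfolding ps_on_def
  by (intro allI impI has_sum_finite_neutralI[OF finite_pc[of p]])
    (auto simp: eval2_expand[OF finite_pc order_refl])

definition shift :: "nat \<times> nat \<Rightarrow> (nat \<times> nat \<Rightarrow> complex) \<Rightarrow> nat \<times> nat \<Rightarrow> complex" where
  "shift = (\<lambda>(i, j) x (k, l). if i \<le> k \<and> j \<le> l then x (k - i, l - j) else 0)"

lemma shift_apply: "shift (i, j) x (k, l) = (if i \<le> k \<and> j \<le> l then x (k - i, l - j) else 0)"
  by (simp add: shift_def)

lemma ps_on_shift:
  assumes "ps_on R1 R2 f x"
  shows "ps_on R1 R2 (\<lambda>(z1, z2). z1 ^ i * z2 ^ j * f (z1, z2)) (shift (i, j) x)"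
  unfolding ps_on_def
proof (intro allI impI)
  fix z1 z2 :: complex assume z: "cmod z1 < R1" "cmod z2 < R2"
  define h where "h = (\<lambda>(k::nat, l::nat). (k + i, l + j))"
  define g where "g = (\<lambda>(k, l). shift (i, j) x (k, l) * z1 ^ k * z2 ^ l)"
  have gh: "g (h kl) = z1 ^ i * z2 ^ j * (case kl of (k, l) \<Rightarrow> x (k, l) * z1 ^ k * z2 ^ l)" for kl
    by (auto simp: g_def h_def shift_apply power_add split: prod.splits)
  have "((\<lambda>kl. g (h kl)) has_sum z1 ^ i * z2 ^ j * f (z1, z2)) UNIV"
    unfolding gh by (rule has_sum_cmult_right[OF ps_onD[OF assms z]])
  moreover have inj: "inj h" by (auto simp: inj_on_def h_def)
  ultimately have "(g has_sum z1 ^ i * z2 ^ j * f (z1, z2)) (range h)"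
    using has_sum_reindex[OF inj, of g] by (simp add: o_def)
  moreover have "g kl = 0" if "kl \<notin> range h" for kl
  proof (cases kl)
    case (Pair k l)
    have "\<not> (i \<le> k \<and> j \<le> l)"
    proof
      assume "i \<le> k \<and> j \<le> l"
      then have "h (k - i, l - j) = kl" by (simp add: h_def Pair)
      then show False using that by (metis rangeI)
    qed
    then show ?thesis by (auto simp: Pair g_def shift_apply)
  qed
  ultimately have "(g has_sum z1 ^ i * z2 ^ j * f (z1, z2)) UNIV"
    by (subst has_sum_cong_neutral[of "range h" UNIV g g]) auto
  then show "((\<lambda>(k, l). shift (i, j) x (k, l) * z1 ^ k * z2 ^ l) has_sum
      (case (z1, z2) of (z1, z2) \<Rightarrow> z1 ^ i * z2 ^ j * f (z1, z2))) UNIV"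
    by (simp add: g_def)
qed

text \<open>Convolution with \<open>pc p\<close>. The sum is finite for every array
  \<open>x\<close>, so multiplication by a polynomial raises no convergence question.\<close>

definition mul :: "complex poly poly \<Rightarrow> (nat \<times> nat \<Rightarrow> complex) \<Rightarrow> nat \<times> nat \<Rightarrow> complex" where
  "mul p x = (\<lambda>kl. \<Sum>ij\<in>{ij. pc p ij \<noteq> 0}. pc p ij * shift ij x kl)"

lemma ps_on_mul:
  assumes "ps_on R1 R2 f x"
  shows "ps_on R1 R2 (\<lambda>z. eval2 p z * f z) (mul p x)"
proof -
  have "ps_on R1 R2 (\<lambda>z. \<Sum>ij\<in>{ij. pc p ij \<noteq> 0}. pc p ij * (fst z ^ fst ij * snd z ^ snd ij * f z))
      (\<lambda>kl. \<Sum>ij\<in>{ij. pc p ij \<noteq> 0}. pc p ij * shift ij x kl)"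
  proof (intro ps_on_sum ps_on_cmult)
    fix ij :: "nat \<times> nat"
    show "ps_on R1 R2 (\<lambda>z. fst z ^ fst ij * snd z ^ snd ij * f z) (shift ij x)"
      using ps_on_shift[OF assms, of "fst ij" "snd ij"] by (simp add: case_prod_unfold)
  qed
  moreover have "(\<Sum>ij\<in>{ij. pc p ij \<noteq> 0}. pc p ij * (fst z ^ fst ij * snd z ^ snd ij * f z)) = eval2 p z * f z" for z
    using eval2_expand[OF finite_pc order_refl, of p "fst z" "snd z"]
    by (simp add: sum_distrib_left sum_distrib_right case_prod_unfold mult_ac)
  ultimately show ?thesis by (simp add: mul_def)
qed

text \<open>No rearrangement of sums is required: both arrays expand the same function, and
  expansions are unique.\<close>

lemma mul_pc: "mul p (pc q) = pc (p * q)"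
proof (rule ps_unique)
  show "ps (\<lambda>z. eval2 p z * eval2 q z) (mul p (pc q))" by (intro ps_on_mul ps_on_eval2)
  show "ps (\<lambda>z. eval2 p z * eval2 q z) (pc (p * q))"
    using ps_on_eval2[of 1 1 "p * q"] by (simp add: eval2_mult[abs_def] cong: ps_on_cong)
qed

lemma mul_1: "mul 1 x = x"
proof
  fix kl
  have "mul 1 x kl = (\<Sum>ij\<in>{(0,0)}. pc 1 ij * shift ij x kl)"
    unfolding mul_def by (rule sum.cong) (auto simp: pc_1)
  then show "mul 1 x kl = x kl" by (cases kl) (simp add: pc_1 shift_apply)
qed

lemma shift_diff: "shift ij (\<lambda>i. x i - y i) kl = shift ij x kl - shift ij y kl"
  by (cases ij; cases kl) (simp add: shift_apply)

lemma mul_diff: "mul p (\<lambda>i. x i - y i) kl = mul p x kl - mul p y kl"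
  by (simp add: mul_def shift_diff right_diff_distrib sum_subtractf)

section \<open>Cyclicity in terms of coefficient arrays\<close>

definition wt :: "real \<Rightarrow> real \<Rightarrow> nat \<times> nat \<Rightarrow> real" where
  "wt \<alpha>1 \<alpha>2 = (\<lambda>(k, l). (real k + 1) powr \<alpha>1 * (real l + 1) powr \<alpha>2)"

lemma wt_nonneg: "wt \<alpha>1 \<alpha>2 i \<ge> 0"
  by (cases i) (simp add: wt_def)

lemma wt_pos: "wt \<alpha>1 \<alpha>2 i > 0"
  by (cases i) (simp add: wt_def)

text \<open>The quotient of the two bases lies between 1 and \<open>real i + 1\<close>; the absolute
  value of the exponent then covers both signs.\<close>

lemma powr_shift_le:
  fixes k i :: nat
  shows "(real (k + i) + 1) powr a \<le> (real i + 1) powr \<bar>a\<bar> * (real k + 1) powr a"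
proof -
  define t where "t = (real (k + i) + 1) / (real k + 1)"
  have t: "1 \<le> t" "t \<le> real i + 1" by (auto simp: t_def field_simps)
  have "(real (k + i) + 1) powr a = t powr a * (real k + 1) powr a"
    unfolding t_def by (subst powr_mult[symmetric]) (auto simp: add_nonneg_pos)
  also have "t powr a \<le> t powr \<bar>a\<bar>" using t by (intro powr_mono) auto
  also have "t powr \<bar>a\<bar> \<le> (real i + 1) powr \<bar>a\<bar>" using t by (intro powr_mono2) auto
  finally show ?thesis by (simp add: mult_right_mono)
qed

lemma sqle_shift:
  assumes "sqle (wt \<alpha>1 \<alpha>2) x C"
  shows "sqle (wt \<alpha>1 \<alpha>2) (shift (i, j) x) ((real i + 1) powr \<bar>\<alpha>1\<bar> * (real j + 1) powr \<bar>\<alpha>2\<bar> * C)"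
  unfolding sqle_def
proof (intro allI impI)
  fix F :: "(nat \<times> nat) set" assume F: "finite F"
  define K where "K = (real i + 1) powr \<bar>\<alpha>1\<bar> * (real j + 1) powr \<bar>\<alpha>2\<bar>"
  define h where "h = (\<lambda>(k::nat, l::nat). (k + i, l + j))"
  have inj: "inj h" by (auto simp: inj_on_def h_def)
  define G where "G = h -` F"
  have G: "finite G" unfolding G_def by (rule finite_vimageI[OF F inj])
  have z: "shift (i, j) x kl = 0" if "kl \<notin> range h" for kl
  proof (cases kl)
    case (Pair k l)
    have "\<not> (i \<le> k \<and> j \<le> l)"
    proof
      assume "i \<le> k \<and> j \<le> l"
      then have "h (k - i, l - j) = kl" by (simp add: h_def Pair)
      then show False using that by (metis rangeI)
    qed
    then show ?thesis by (auto simp: Pair shift_apply)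
  qed
  have wh: "wt \<alpha>1 \<alpha>2 (h kl) \<le> K * wt \<alpha>1 \<alpha>2 kl" for kl
  proof (cases kl)
    case (Pair k l)
    have "wt \<alpha>1 \<alpha>2 (h kl) \<le> ((real i + 1) powr \<bar>\<alpha>1\<bar> * (real k + 1) powr \<alpha>1) * ((real j + 1) powr \<bar>\<alpha>2\<bar> * (real l + 1) powr \<alpha>2)"
      unfolding Pair h_def wt_def prod.case by (intro mult_mono powr_shift_le) auto
    then show ?thesis by (simp add: K_def Pair wt_def mult_ac)
  qed
  have xh: "shift (i, j) x (h kl) = x kl" for kl by (cases kl) (simp add: h_def shift_apply)
  have "(\<Sum>kl\<in>F. wt \<alpha>1 \<alpha>2 kl * (cmod (shift (i, j) x kl))\<^sup>2) = (\<Sum>kl\<in>h ` G. wt \<alpha>1 \<alpha>2 kl * (cmod (shift (i, j) x kl))\<^sup>2)"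
    using F z by (intro sum.mono_neutral_right) (auto simp: G_def)
  also have "\<dots> = (\<Sum>kl\<in>G. wt \<alpha>1 \<alpha>2 (h kl) * (cmod (x kl))\<^sup>2)"
    using inj by (subst sum.reindex) (auto simp: xh intro: inj_on_subset)
  also have "\<dots> \<le> (\<Sum>kl\<in>G. K * wt \<alpha>1 \<alpha>2 kl * (cmod (x kl))\<^sup>2)"
    by (intro sum_mono mult_right_mono wh) auto
  also have "\<dots> = K * (\<Sum>kl\<in>G. wt \<alpha>1 \<alpha>2 kl * (cmod (x kl))\<^sup>2)" by (simp add: sum_distrib_left mult_ac)
  also have "\<dots> \<le> K * C" by (intro mult_left_mono sqleD[OF assms G]) (simp add: K_def)
  finally show "(\<Sum>kl\<in>F. wt \<alpha>1 \<alpha>2 kl * (cmod (shift (i, j) x kl))\<^sup>2) \<le>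
     (real i + 1) powr \<bar>\<alpha>1\<bar> * (real j + 1) powr \<bar>\<alpha>2\<bar> * C" by (simp add: K_def)
qed

lemma sqle_mul: "\<exists>K\<ge>0. \<forall>x C. sqle (wt \<alpha>1 \<alpha>2) x C \<longrightarrow> sqle (wt \<alpha>1 \<alpha>2) (mul p x) (K * C)"
  unfolding mul_def
proof (rule sqle_sum[OF wt_nonneg finite_pc])
  fix ij :: "nat \<times> nat"
  obtain i j where ij: "ij = (i, j)" by force
  show "\<exists>K\<ge>0. \<forall>y C. sqle (wt \<alpha>1 \<alpha>2) y C \<longrightarrow> sqle (wt \<alpha>1 \<alpha>2) (\<lambda>kl. pc p ij * shift ij y kl) (K * C)"
    unfolding ij
  proof (intro exI conjI allI impI)
    fix y C assume "sqle (wt \<alpha>1 \<alpha>2) y C"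
    from sqle_scale[OF sqle_shift[OF this, of i j], of "pc p (i, j)"]
    show "sqle (wt \<alpha>1 \<alpha>2) (\<lambda>kl. pc p (i, j) * shift (i, j) y kl)
       (((cmod (pc p (i, j)))\<^sup>2 * ((real i + 1) powr \<bar>\<alpha>1\<bar> * (real j + 1) powr \<bar>\<alpha>2\<bar>)) * C)"
      by (simp add: mult_ac)
  qed simp
qed

lemma sqle_finite_support:
  assumes "finite {i. x i \<noteq> 0}"
  shows "\<exists>C. sqle (wt \<alpha>1 \<alpha>2) x C"
proof
  show "sqle (wt \<alpha>1 \<alpha>2) x (\<Sum>i | x i \<noteq> 0. wt \<alpha>1 \<alpha>2 i * (cmod (x i))\<^sup>2)"
    unfolding sqle_def
  proof (intro allI impI)
    fix F :: "(nat \<times> nat) set" assume F: "finite F"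
    have "(\<Sum>i\<in>F. wt \<alpha>1 \<alpha>2 i * (cmod (x i))\<^sup>2) = (\<Sum>i\<in>F \<inter> {i. x i \<noteq> 0}. wt \<alpha>1 \<alpha>2 i * (cmod (x i))\<^sup>2)"
      using F by (intro sum.mono_neutral_right) auto
    also have "\<dots> \<le> (\<Sum>i | x i \<noteq> 0. wt \<alpha>1 \<alpha>2 i * (cmod (x i))\<^sup>2)"
      using assms by (intro sum_mono2) (auto simp: wt_nonneg)
    finally show "(\<Sum>i\<in>F. wt \<alpha>1 \<alpha>2 i * (cmod (x i))\<^sup>2) \<le> (\<Sum>i | x i \<noteq> 0. wt \<alpha>1 \<alpha>2 i * (cmod (x i))\<^sup>2)" .
  qed
qed

text \<open>The closed invariant subspace generated by \<open>p\<close>, in terms of coefficients: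
  polynomials \<open>q\<close> account for all finite combinations of monomial multiples. Finite
  norm of \<open>x\<close> is automatic, since \<open>pc (q * p)\<close> has finite support.\<close>

definition inv_closure :: "real \<Rightarrow> real \<Rightarrow> complex poly poly \<Rightarrow> (nat \<times> nat \<Rightarrow> complex) set" where
  "inv_closure \<alpha>1 \<alpha>2 p = {x. \<forall>\<epsilon>>0. \<exists>q. sqle (wt \<alpha>1 \<alpha>2) (\<lambda>i. x i - pc (q * p) i) \<epsilon>}"

lemma inv_closureI: "(\<And>\<epsilon>. \<epsilon> > 0 \<Longrightarrow> \<exists>q. sqle (wt \<alpha>1 \<alpha>2) (\<lambda>i. x i - pc (q * p) i) \<epsilon>) \<Longrightarrow> x \<in> inv_closure \<alpha>1 \<alpha>2 p"
  by (simp add: inv_closure_def)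

lemma inv_closureD: "x \<in> inv_closure \<alpha>1 \<alpha>2 p \<Longrightarrow> \<epsilon> > 0 \<Longrightarrow> \<exists>q. sqle (wt \<alpha>1 \<alpha>2) (\<lambda>i. x i - pc (q * p) i) \<epsilon>"
  by (simp add: inv_closure_def)

lemma inv_closure_self: "pc (q * p) \<in> inv_closure \<alpha>1 \<alpha>2 p"
  by (rule inv_closureI, rule exI[of _ q]) (simp add: sqle_def)

lemma inv_closure_limit:
  assumes "\<And>\<epsilon>. \<epsilon> > 0 \<Longrightarrow> \<exists>y\<in>inv_closure \<alpha>1 \<alpha>2 p. sqle (wt \<alpha>1 \<alpha>2) (\<lambda>i. x i - y i) \<epsilon>"
  shows "x \<in> inv_closure \<alpha>1 \<alpha>2 p"
proof (rule inv_closureI)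
  fix \<epsilon> :: real assume \<epsilon>: "\<epsilon> > 0"
  obtain y where y: "y \<in> inv_closure \<alpha>1 \<alpha>2 p" "sqle (wt \<alpha>1 \<alpha>2) (\<lambda>i. x i - y i) (\<epsilon>/4)"
    using assms[of "\<epsilon>/4"] \<epsilon> by auto
  obtain q where q: "sqle (wt \<alpha>1 \<alpha>2) (\<lambda>i. y i - pc (q * p) i) (\<epsilon>/4)"
    using inv_closureD[OF y(1), of "\<epsilon>/4"] \<epsilon> by auto
  have "sqle (wt \<alpha>1 \<alpha>2) (\<lambda>i. (x i - y i) + (y i - pc (q * p) i)) (2 * (\<epsilon>/4) + 2 * (\<epsilon>/4))"
    by (rule sqle_add[OF wt_nonneg y(2) q])
  then show "\<exists>q. sqle (wt \<alpha>1 \<alpha>2) (\<lambda>i. x i - pc (q * p) i) \<epsilon>" by auto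
qed

lemma inv_closure_lincomb:
  assumes "x \<in> inv_closure \<alpha>1 \<alpha>2 p" "y \<in> inv_closure \<alpha>1 \<alpha>2 p"
  shows "(\<lambda>i. c * x i + d * y i) \<in> inv_closure \<alpha>1 \<alpha>2 p"
proof (rule inv_closureI)
  fix \<epsilon> :: real assume \<epsilon>: "\<epsilon> > 0"
  define \<delta> where "\<delta> = \<epsilon> / (2 * ((cmod c)\<^sup>2 + (cmod d)\<^sup>2) + 1)"
  have pos: "2 * ((cmod c)\<^sup>2 + (cmod d)\<^sup>2) + 1 > 0" by (intro add_nonneg_pos mult_nonneg_nonneg add_nonneg_nonneg) auto
  then have \<delta>: "\<delta> > 0" using \<epsilon> by (simp add: \<delta>_def)
  obtain q r where q: "sqle (wt \<alpha>1 \<alpha>2) (\<lambda>i. x i - pc (q * p) i) \<delta>" and r: "sqle (wt \<alpha>1 \<alpha>2) (\<lambda>i. y i - pc (r * p) i) \<delta>"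
    using inv_closureD assms \<delta> by meson
  have "sqle (wt \<alpha>1 \<alpha>2) (\<lambda>i. c * (x i - pc (q * p) i) + d * (y i - pc (r * p) i)) (2 * ((cmod c)\<^sup>2 * \<delta>) + 2 * ((cmod d)\<^sup>2 * \<delta>))"
    by (intro sqle_add wt_nonneg sqle_scale q r)
  moreover have "2 * ((cmod c)\<^sup>2 * \<delta>) + 2 * ((cmod d)\<^sup>2 * \<delta>) \<le> (2 * ((cmod c)\<^sup>2 + (cmod d)\<^sup>2) + 1) * \<delta>"
    using \<delta> by (simp only: ring_distribs mult.assoc)
  moreover have "(2 * ((cmod c)\<^sup>2 + (cmod d)\<^sup>2) + 1) * \<delta> = \<epsilon>" using pos by (simp add: \<delta>_def)
  ultimately have "sqle (wt \<alpha>1 \<alpha>2) (\<lambda>i. c * (x i - pc (q * p) i) + d * (y i - pc (r * p) i)) \<epsilon>"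
    using sqle_mono by simp
  moreover have "c * (x i - pc (q * p) i) + d * (y i - pc (r * p) i) = c * x i + d * y i - pc ((smult [:c:] q + smult [:d:] r) * p) i" for i
    by (simp add: ring_distribs pc_add pc_smult algebra_simps del: smult_add_right)
  ultimately show "\<exists>q. sqle (wt \<alpha>1 \<alpha>2) (\<lambda>i. c * x i + d * y i - pc (q * p) i) \<epsilon>" by auto
qed

lemma inv_closure_mul:
  assumes "x \<in> inv_closure \<alpha>1 \<alpha>2 p"
  shows "mul s x \<in> inv_closure \<alpha>1 \<alpha>2 p"
proof (rule inv_closureI)
  fix \<epsilon> :: real assume \<epsilon>: "\<epsilon> > 0"
  obtain K where K: "K \<ge> 0" "\<And>x C. sqle (wt \<alpha>1 \<alpha>2) x C \<Longrightarrow> sqle (wt \<alpha>1 \<alpha>2) (mul s x) (K * C)"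
    using sqle_mul by blast
  obtain q where q: "sqle (wt \<alpha>1 \<alpha>2) (\<lambda>i. x i - pc (q * p) i) (\<epsilon> / (K + 1))"
    using inv_closureD[OF assms, of "\<epsilon> / (K + 1)"] \<epsilon> K by auto
  have "K * (\<epsilon> / (K + 1)) \<le> \<epsilon>" using K \<epsilon> by (simp add: field_simps)
  then have "sqle (wt \<alpha>1 \<alpha>2) (mul s (\<lambda>i. x i - pc (q * p) i)) \<epsilon>" using K(2)[OF q] sqle_mono by blast
  then have "sqle (wt \<alpha>1 \<alpha>2) (\<lambda>i. mul s x i - pc (s * q * p) i) \<epsilon>"
    by (simp add: mul_diff[abs_def] mul_pc mult.assoc)
  then show "\<exists>q. sqle (wt \<alpha>1 \<alpha>2) (\<lambda>i. mul s x i - pc (q * p) i) \<epsilon>" by blast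
qed

lemma inv_closure_mul_l2:
  assumes "pc s \<in> inv_closure \<alpha>1 \<alpha>2 p" and g: "sqle (wt \<alpha>1 \<alpha>2) g C"
  shows "mul s g \<in> inv_closure \<alpha>1 \<alpha>2 p"
proof (rule inv_closure_limit)
  fix \<epsilon> :: real assume \<epsilon>: "\<epsilon> > 0"
  obtain K where K: "K \<ge> 0" "\<And>x C. sqle (wt \<alpha>1 \<alpha>2) x C \<Longrightarrow> sqle (wt \<alpha>1 \<alpha>2) (mul s x) (K * C)"
    using sqle_mul by blast
  obtain F where F: "finite F" "sqle (wt \<alpha>1 \<alpha>2) (\<lambda>i. if i \<in> F then 0 else g i) (\<epsilon> / (K + 1))"
    using sqle_tail[OF wt_nonneg g, of "\<epsilon> / (K + 1)"] \<epsilon> K by auto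
  have "K * (\<epsilon> / (K + 1)) \<le> \<epsilon>" using K \<epsilon> by (simp add: field_simps)
  then have "sqle (wt \<alpha>1 \<alpha>2) (mul s (\<lambda>i. if i \<in> F then 0 else g i)) \<epsilon>" using K(2)[OF F(2)] sqle_mono by blast
  moreover have "(\<lambda>i. if i \<in> F then 0 else g i) = (\<lambda>i. g i - pc (mkp g F) i)"
    using F by (auto simp: pc_mkp)
  ultimately have "sqle (wt \<alpha>1 \<alpha>2) (\<lambda>i. mul s g i - pc (mkp g F * s) i) \<epsilon>"
    by (simp add: mul_diff[abs_def] mul_pc mult.commute)
  moreover have "pc (mkp g F * s) \<in> inv_closure \<alpha>1 \<alpha>2 p"
    using inv_closure_mul[OF assms(1), of "mkp g F"] by (simp add: mul_pc)
  ultimately show "\<exists>y\<in>inv_closure \<alpha>1 \<alpha>2 p. sqle (wt \<alpha>1 \<alpha>2) (\<lambda>i. mul s g i - y i) \<epsilon>" by blast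
qed

text \<open>Norm convergence is replaced by a uniform bound and convergence of each coefficient;
  closedness and convexity of the subspace do the rest.\<close>

lemma inv_closure_weak_limit:
  assumes "\<And>n::nat. y n \<in> inv_closure \<alpha>1 \<alpha>2 p" "\<And>n. sqle (wt \<alpha>1 \<alpha>2) (y n) C"
    "\<And>i. (\<lambda>n. y n i) \<longlonglongrightarrow> x i"
  shows "x \<in> inv_closure \<alpha>1 \<alpha>2 p"
proof (rule inv_closure_limit)
  fix \<epsilon> :: real assume \<epsilon>: "\<epsilon> > 0"
  have "\<exists>u\<in>inv_closure \<alpha>1 \<alpha>2 p. sqle (wt \<alpha>1 \<alpha>2) (\<lambda>i. u i - x i) \<epsilon>"
    by (rule banach_saks[OF wt_nonneg _ assms \<epsilon>]) (rule inv_closure_lincomb)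
  then show "\<exists>u\<in>inv_closure \<alpha>1 \<alpha>2 p. sqle (wt \<alpha>1 \<alpha>2) (\<lambda>i. x i - u i) \<epsilon>"
    by (simp add: sqle_def norm_minus_commute)
qed

section \<open>From coefficient arrays to the Dirichlet space\<close>

lemma dirichlet_term_ps:
  assumes "ps f x"
  shows "dirichlet_term \<alpha>1 \<alpha>2 f = (\<lambda>i. wt \<alpha>1 \<alpha>2 i * (cmod (x i))\<^sup>2)"
  using taylor_eq[OF assms[unfolded ps_iff_has_expansion]]
  by (auto simp: dirichlet_term_def wt_def)

lemma dirichlet_space_iff: "f \<in> dirichlet_space \<alpha>1 \<alpha>2 \<longleftrightarrow> (\<exists>x C. ps f x \<and> sqle (wt \<alpha>1 \<alpha>2) x C)"
proof
  assume "f \<in> dirichlet_space \<alpha>1 \<alpha>2"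
  then obtain a where a: "has_expansion f a" and s: "dirichlet_term \<alpha>1 \<alpha>2 f summable_on UNIV"
    by (auto simp: dirichlet_space_def)
  have p: "ps f (\<lambda>(k, l). a k l)" using a by (simp add: has_expansion_iff_ps)
  show "\<exists>x C. ps f x \<and> sqle (wt \<alpha>1 \<alpha>2) x C"
    using p summable_imp_sqle[OF wt_nonneg s[unfolded dirichlet_term_ps[OF p]]] by blast
next
  assume "\<exists>x C. ps f x \<and> sqle (wt \<alpha>1 \<alpha>2) x C"
  then obtain x C where p: "ps f x" and c: "sqle (wt \<alpha>1 \<alpha>2) x C" by blast
  show "f \<in> dirichlet_space \<alpha>1 \<alpha>2"
    unfolding dirichlet_space_def mem_Collect_eq dirichlet_term_ps[OF p]
    using p sqle_imp_summable(1)[OF wt_nonneg c] by (auto simp: ps_iff_has_expansion)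
qed

lemma dirichlet_norm_le:
  assumes "ps f x" "sqle (wt \<alpha>1 \<alpha>2) x C"
  shows "dirichlet_norm \<alpha>1 \<alpha>2 f \<le> sqrt C"
  unfolding dirichlet_norm_def dirichlet_term_ps[OF assms(1)]
  using sqle_imp_summable(2)[OF wt_nonneg assms(2)] by simp

lemma sqle_dirichlet_norm:
  assumes "ps f x" "sqle (wt \<alpha>1 \<alpha>2) x C"
  shows "sqle (wt \<alpha>1 \<alpha>2) x ((dirichlet_norm \<alpha>1 \<alpha>2 f)\<^sup>2)"
proof -
  have "sqle (wt \<alpha>1 \<alpha>2) x (infsum (\<lambda>i. wt \<alpha>1 \<alpha>2 i * (cmod (x i))\<^sup>2) UNIV)"
    by (intro summable_imp_sqle wt_nonneg sqle_imp_summable(1)[OF wt_nonneg assms(2)])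
  moreover have "infsum (\<lambda>i. wt \<alpha>1 \<alpha>2 i * (cmod (x i))\<^sup>2) UNIV = (dirichlet_norm \<alpha>1 \<alpha>2 f)\<^sup>2"
    unfolding dirichlet_norm_def dirichlet_term_ps[OF assms(1)]
    by (subst real_sqrt_pow2) (auto intro!: infsum_nonneg mult_nonneg_nonneg simp: wt_nonneg)
  ultimately show ?thesis by simp
qed

interpretation fun_module: module "\<lambda>(c::complex) (f::complex \<times> complex \<Rightarrow> complex) z. c * f z"
  by unfold_locales (auto simp: fun_eq_iff algebra_simps)

lemma span_monomial_multiples:
  "module.span (\<lambda>c f z. c * f z) {(\<lambda>(z1, z2). z1 ^ k * z2 ^ l * eval2 p (z1, z2)) | k l. True}
     = {eval2 (q * p) | q. True}" (is "fun_module.span ?S = ?T")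
proof
  show "fun_module.span ?S \<subseteq> ?T"
  proof
    fix f assume "f \<in> fun_module.span ?S"
    then show "f \<in> ?T"
    proof (induction rule: fun_module.span_induct_alt)
      case base
      show ?case by (rule CollectI, rule exI[of _ 0]) (auto simp: eval2_def)
    next
      case (step c g h)
      obtain k l where g: "g = (\<lambda>(z1, z2). z1 ^ k * z2 ^ l * eval2 p (z1, z2))" using step by blast
      obtain q where q: "h = eval2 (q * p)" using step by blast
      have "(\<lambda>z. c * g z) + h = eval2 ((monom (monom c k) l + q) * p)"
        by (auto simp: fun_eq_iff g q eval2_mult eval2_add eval2_monom algebra_simps)
      then show ?case by blast
    qed
  qed
  show "?T \<subseteq> fun_module.span ?S"
  proof clarify
    fix q
    let ?F = "{i. pc q i \<noteq> 0}"
    have "eval2 (q * p) = (\<Sum>i\<in>?F. (\<lambda>z. pc q i * (case z of (z1, z2) \<Rightarrow> z1 ^ fst i * z2 ^ snd i * eval2 p (z1, z2))))"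
    proof
      fix z :: "complex \<times> complex"
      obtain z1 z2 where z: "z = (z1, z2)" by force
      have "(\<Sum>i\<in>A. (\<lambda>z. pc q i * (case z of (z1, z2) \<Rightarrow> z1 ^ fst i * z2 ^ snd i * eval2 p (z1, z2)))) z
        = (\<Sum>i\<in>A. pc q i * (z1 ^ fst i * z2 ^ snd i * eval2 p (z1, z2)))" for A
        by (induction A rule: infinite_finite_induct) (auto simp: z)
      moreover have "eval2 (q * p) z = (\<Sum>i\<in>?F. pc q i * (z1 ^ fst i * z2 ^ snd i * eval2 p (z1, z2)))"
        unfolding z eval2_mult eval2_expand[OF finite_pc order_refl, of q]
        by (simp add: sum_distrib_left sum_distrib_right case_prod_unfold mult_ac)
      ultimately show "eval2 (q * p) z = (\<Sum>i\<in>?F. (\<lambda>z. pc q i * (case z of (z1, z2) \<Rightarrow> z1 ^ fst i * z2 ^ snd i * eval2 p (z1, z2)))) z"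
        by simp
    qed
    also have "\<dots> \<in> fun_module.span ?S"
      by (intro fun_module.span_sum fun_module.span_scale fun_module.span_base) blast
    finally show "eval2 (q * p) \<in> fun_module.span ?S" .
  qed
qed

lemma cyclic_imp_inv_closure:
  assumes "cyclic \<alpha>1 \<alpha>2 (eval2 p)"
  shows "pc s \<in> inv_closure \<alpha>1 \<alpha>2 p"
proof (rule inv_closureI)
  fix \<epsilon> :: real assume \<epsilon>: "\<epsilon> > 0"
  have sp: "\<exists>C. sqle (wt \<alpha>1 \<alpha>2) (pc s) C" for s by (rule sqle_finite_support[OF finite_pc])
  have "eval2 s \<in> dirichlet_space \<alpha>1 \<alpha>2"
    unfolding dirichlet_space_iff using ps_on_eval2 sp by blast
  then have "eval2 s \<in> closed_linear_span \<alpha>1 \<alpha>2 {(\<lambda>(z1, z2). z1 ^ k * z2 ^ l * eval2 p (z1, z2)) | k l. True}"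
    using assms by (simp add: cyclic_def)
  then obtain h where h: "h \<in> {eval2 (q * p) | q. True}" "dirichlet_norm \<alpha>1 \<alpha>2 (\<lambda>z. eval2 s z - h z) < sqrt \<epsilon>"
    unfolding closed_linear_span_def span_monomial_multiples using \<epsilon> real_sqrt_gt_zero by blast
  then obtain q where q: "h = eval2 (q * p)" by blast
  have 1: "ps (\<lambda>z. eval2 s z - h z) (pc (s - q * p))"
    unfolding q by (subst eval2_diff[symmetric]) (rule ps_on_eval2)
  obtain C where C: "sqle (wt \<alpha>1 \<alpha>2) (pc (s - q * p)) C" using sp by blast
  have "sqle (wt \<alpha>1 \<alpha>2) (pc (s - q * p)) ((dirichlet_norm \<alpha>1 \<alpha>2 (\<lambda>z. eval2 s z - h z))\<^sup>2)"
    by (rule sqle_dirichlet_norm[OF 1 C])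
  moreover have "(dirichlet_norm \<alpha>1 \<alpha>2 (\<lambda>z. eval2 s z - h z))\<^sup>2 \<le> \<epsilon>"
  proof -
    have "0 \<le> dirichlet_norm \<alpha>1 \<alpha>2 (\<lambda>z. eval2 s z - h z)"
      unfolding dirichlet_norm_def by (auto intro!: infsum_nonneg simp: dirichlet_term_def)
    then have "(dirichlet_norm \<alpha>1 \<alpha>2 (\<lambda>z. eval2 s z - h z))\<^sup>2 \<le> (sqrt \<epsilon>)\<^sup>2"
      using h by (intro power_mono) auto
    then show ?thesis using \<epsilon> by simp
  qed
  ultimately have "sqle (wt \<alpha>1 \<alpha>2) (pc (s - q * p)) \<epsilon>" by (rule sqle_mono)
  then show "\<exists>q. sqle (wt \<alpha>1 \<alpha>2) (\<lambda>i. pc s i - pc (q * p) i) \<epsilon>" by (auto simp: pc_diff[abs_def])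
qed

text \<open>Every array of finite norm is \<open>mul 1 x\<close>, hence in the subspace once
  \<open>pc 1\<close> is. The tolerance \<open>(\<epsilon>/2)^2\<close> reflects that
  \<open>sqle\<close> bounds the squared norm and that the closure asks for a strict
  inequality.\<close>

lemma inv_closure_imp_cyclic:
  assumes "pc 1 \<in> inv_closure \<alpha>1 \<alpha>2 p"
  shows "cyclic \<alpha>1 \<alpha>2 (eval2 p)"
  unfolding cyclic_def
proof
  show "eval2 p \<in> dirichlet_space \<alpha>1 \<alpha>2"
    unfolding dirichlet_space_iff using ps_on_eval2 sqle_finite_support[OF finite_pc] by blast
  show "closed_linear_span \<alpha>1 \<alpha>2 {(\<lambda>(z1, z2). z1 ^ k * z2 ^ l * eval2 p (z1, z2)) | k l. True} = dirichlet_space \<alpha>1 \<alpha>2"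
    unfolding closed_linear_span_def span_monomial_multiples
  proof (intro equalityI subsetI CollectI conjI allI impI)
    fix f and \<epsilon> :: real assume f: "f \<in> dirichlet_space \<alpha>1 \<alpha>2" and \<epsilon>: "\<epsilon> > 0"
    obtain x C where x: "ps f x" "sqle (wt \<alpha>1 \<alpha>2) x C" using f by (auto simp: dirichlet_space_iff)
    have "x \<in> inv_closure \<alpha>1 \<alpha>2 p" using inv_closure_mul_l2[OF assms x(2)] by (simp add: mul_1)
    then obtain q where q: "sqle (wt \<alpha>1 \<alpha>2) (\<lambda>i. x i - pc (q * p) i) ((\<epsilon>/2)\<^sup>2)"
      using inv_closureD[of x \<alpha>1 \<alpha>2 p "(\<epsilon>/2)\<^sup>2"] \<epsilon> by auto
    have "dirichlet_norm \<alpha>1 \<alpha>2 (\<lambda>z. f z - eval2 (q * p) z) \<le> sqrt ((\<epsilon>/2)\<^sup>2)"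
      by (rule dirichlet_norm_le[OF _ q]) (intro ps_on_diff x ps_on_eval2)
    also have "\<dots> < \<epsilon>" using \<epsilon> by simp
    finally show "\<exists>h\<in>{eval2 (q * p) | q. True}. dirichlet_norm \<alpha>1 \<alpha>2 (\<lambda>z. f z - h z) < \<epsilon>" by blast
  qed auto
qed

lemma cyclic_iff: "cyclic \<alpha>1 \<alpha>2 (eval2 p) \<longleftrightarrow> pc 1 \<in> inv_closure \<alpha>1 \<alpha>2 p"
  using cyclic_imp_inv_closure inv_closure_imp_cyclic by blast

section \<open>Annihilating functionals\<close>

text \<open>Under the bilinear pairing, without conjugation, reciprocal weights describe the dual
  space. \<open>ann\<close> says that the functional kills every monomial multiple of
  \<open>p\<close>; as it does not kill the monomial with index \<open>i0\<close>, that monomial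
  keeps a positive distance from the multiples of \<open>p\<close>.\<close>

lemma not_cyclic_by_functional:
  fixes b :: "nat \<times> nat \<Rightarrow> complex"
  assumes b: "sqle (\<lambda>i. 1 / wt \<alpha>1 \<alpha>2 i) b B" and nz: "b i0 \<noteq> 0"
    and ann: "\<And>k l. (\<Sum>(i, j)\<in>{ij. pc p ij \<noteq> 0}. pc p (i, j) * b (k + i, l + j)) = 0"
  shows "\<not> cyclic \<alpha>1 \<alpha>2 (eval2 p)"
proof
  assume cyc: "cyclic \<alpha>1 \<alpha>2 (eval2 p)"
  obtain k0 l0 where i0: "i0 = (k0, l0)" by force
  define L where "L s = (\<Sum>i\<in>{i. pc s i \<noteq> 0}. pc s i * b i)" for s
  have L: "L s = (\<Sum>i\<in>F. pc s i * b i)" if "finite F" "{i. pc s i \<noteq> 0} \<subseteq> F" for s F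
    unfolding L_def using that by (intro sum.mono_neutral_left) auto
  have L_add: "L (s + t) = L s + L t" for s t
  proof -
    obtain F where F: "finite F" "{i. pc s i \<noteq> 0} \<subseteq> F" "{i. pc t i \<noteq> 0} \<subseteq> F" "{i. pc (s + t) i \<noteq> 0} \<subseteq> F"
      using finite_pc[of s] finite_pc[of t] finite_pc[of "s + t"]
      by (meson finite_UnI sup_ge1 sup_ge2 order_trans)
    show ?thesis
      using L[OF F(1,2)] L[OF F(1,3)] L[OF F(1,4)]
      by (simp add: pc_add ring_distribs sum.distrib)
  qed
  have L_sum: "L (sum f A) = (\<Sum>a\<in>A. L (f a))" if "finite A" for f and A :: "(nat \<times> nat) set"
    using that by (induction A rule: finite_induct) (auto simp: L_add, auto simp: L_def pc_0)
  have L_monom: "L (monom (monom c k) l) = c * b (k, l)" for c k l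
    using L[of "{(k, l)}" "monom (monom c k) l"] by (simp add: pc_monom subset_iff)
  have L_p: "L (monom (monom c k) l * p) = 0" for c k l
  proof -
    have "monom (monom c k) l * p = monom (monom c k) l * mkp (pc p) {ij. pc p ij \<noteq> 0}"
      using poly_eq_mkp[OF finite_pc order_refl] by metis
    also have "\<dots> = (\<Sum>ij\<in>{ij. pc p ij \<noteq> 0}. monom (monom (c * pc p ij) (k + fst ij)) (l + snd ij))"
      by (simp add: mkp_def sum_distrib_left case_prod_unfold mult_monom)
    also have "L \<dots> = (\<Sum>ij\<in>{ij. pc p ij \<noteq> 0}. c * pc p ij * b (k + fst ij, l + snd ij))"
      by (simp add: L_sum[OF finite_pc] L_monom)
    also have "\<dots> = c * (\<Sum>(i, j)\<in>{ij. pc p ij \<noteq> 0}. pc p (i, j) * b (k + i, l + j))"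
      by (simp add: sum_distrib_left case_prod_unfold mult_ac)
    finally show ?thesis using ann by simp
  qed
  have L_qp: "L (q * p) = 0" for q
  proof -
    have "q * p = (\<Sum>ij\<in>{ij. pc q ij \<noteq> 0}. monom (monom (pc q ij) (fst ij)) (snd ij) * p)"
      using poly_eq_mkp[OF finite_pc order_refl, of q] by (metis (no_types, lifting) mkp_def sum_distrib_right case_prod_unfold prod.collapse sum.cong)
    then show ?thesis using L_sum[OF finite_pc] L_p by (metis (no_types, lifting) sum.neutral)
  qed
  define s where "s = monom (monom (1::complex) k0) l0"
  have bound: "(cmod (b i0))\<^sup>2 \<le> \<epsilon> * B" if \<epsilon>: "\<epsilon> > 0" for \<epsilon>
  proof -
    obtain q where q: "sqle (wt \<alpha>1 \<alpha>2) (\<lambda>i. pc s i - pc (q * p) i) \<epsilon>"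
      using inv_closureD[OF cyclic_imp_inv_closure[OF cyc] \<epsilon>] by blast
    define t where "t = s - q * p"
    let ?F = "{i. pc t i \<noteq> 0}"
    have "s = t + q * p" by (simp add: t_def)
    then have "L t = L s" using L_add L_qp by simp
    then have "b i0 = L t" by (simp add: s_def L_monom i0)
    then have "cmod (b i0) \<le> (\<Sum>i\<in>?F. cmod (pc t i) * cmod (b i))"
      unfolding L_def by (metis (no_types, lifting) norm_mult norm_sum sum.cong)
    \<comment> \<open>The weight is split evenly between the two factors before
      Cauchy-Schwarz.\<close>
    also have "\<dots> = (\<Sum>i\<in>?F. (sqrt (wt \<alpha>1 \<alpha>2 i) * cmod (pc t i)) * (cmod (b i) / sqrt (wt \<alpha>1 \<alpha>2 i)))"
      using wt_pos by (intro sum.cong) (auto simp: less_imp_neq[OF wt_pos, symmetric])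
    finally have "(cmod (b i0))\<^sup>2 \<le> (\<Sum>i\<in>?F. (sqrt (wt \<alpha>1 \<alpha>2 i) * cmod (pc t i)) * (cmod (b i) / sqrt (wt \<alpha>1 \<alpha>2 i)))\<^sup>2"
      by (intro power_mono) auto
    also have "\<dots> \<le> (\<Sum>i\<in>?F. (sqrt (wt \<alpha>1 \<alpha>2 i) * cmod (pc t i))\<^sup>2) * (\<Sum>i\<in>?F. (cmod (b i) / sqrt (wt \<alpha>1 \<alpha>2 i))\<^sup>2)"
      by (rule Cauchy_Schwarz_ineq_sum)
    also have "\<dots> = (\<Sum>i\<in>?F. wt \<alpha>1 \<alpha>2 i * (cmod (pc t i))\<^sup>2) * (\<Sum>i\<in>?F. 1 / wt \<alpha>1 \<alpha>2 i * (cmod (b i))\<^sup>2)"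
      by (simp add: power_mult_distrib power_divide wt_nonneg)
    also have "\<dots> \<le> \<epsilon> * B"
      using sqleD[OF q finite_pc[of t]] sqleD[OF b finite_pc[of t]] \<epsilon>
      by (intro mult_mono sum_nonneg) (auto simp: t_def pc_diff wt_nonneg)
    finally show ?thesis .
  qed
  have B: "B \<ge> 0" using b sqle_nonneg by blast
  \<comment> \<open>Any \<open>\<epsilon>\<close> with \<open>\<epsilon> * B\<close> below the
    squared modulus of \<open>b i0\<close> contradicts \<open>bound\<close>; the added 1 covers
    \<open>B = 0\<close>.\<close>
  define \<epsilon> where "\<epsilon> = (cmod (b i0))\<^sup>2 / (2 * (B + 1))"
  have \<epsilon>: "\<epsilon> > 0" using nz B by (simp add: \<epsilon>_def)
  have "\<epsilon> * B < \<epsilon> * (2 * (B + 1))" using \<epsilon> B by (intro mult_strict_left_mono) auto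
  also have "\<dots> = (cmod (b i0))\<^sup>2" using B by (simp add: \<epsilon>_def)
  finally show False using bound[OF \<epsilon>] by simp
qed

section \<open>Power series of holomorphic functions on polydiscs\<close>

text \<open>Separate holomorphy together with joint continuity of \<open>f\<close> and of its
  derivative in \<open>z2\<close>, which is what differentiation under a Cauchy integral in
  \<open>z1\<close> asks for.\<close>

definition bihol :: "(complex \<times> complex \<Rightarrow> complex) \<Rightarrow> real \<Rightarrow> real \<Rightarrow> bool" where
  "bihol f R1 R2 \<longleftrightarrow>
     continuous_on (ball 0 R1 \<times> ball 0 R2) f \<and>
     (\<forall>z2\<in>ball 0 R2. (\<lambda>z1. f (z1, z2)) holomorphic_on ball 0 R1) \<and>
     (\<exists>f2. continuous_on (ball 0 R1 \<times> ball 0 R2) f2 \<and>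
       (\<forall>z1\<in>ball 0 R1. \<forall>z2\<in>ball 0 R2. ((\<lambda>w. f (z1, w)) has_field_derivative f2 (z1, z2)) (at z2)))"

text \<open>The coefficient is a Cauchy integral over a circle in \<open>z1\<close>, hence a
  parameter integral depending holomorphically on \<open>z2\<close>.\<close>

lemma bihol_coeff_holomorphic:
  assumes f: "bihol f R1 R2" and R: "R1 > 0"
  shows "(\<lambda>z2. (deriv ^^ k) (\<lambda>z1. f (z1, z2)) 0 / fact k) holomorphic_on ball 0 R2"
proof -
  obtain f2 where f2: "continuous_on (ball 0 R1 \<times> ball 0 R2) f2"
      "\<And>z1 z2. z1 \<in> ball 0 R1 \<Longrightarrow> z2 \<in> ball 0 R2 \<Longrightarrow> ((\<lambda>w. f (z1, w)) has_field_derivative f2 (z1, z2)) (at z2)"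
    and cf: "continuous_on (ball 0 R1 \<times> ball 0 R2) f"
    and hol: "\<And>z2. z2 \<in> ball 0 R2 \<Longrightarrow> (\<lambda>z1. f (z1, z2)) holomorphic_on ball 0 R1"
    using f unfolding bihol_def by blast
  define r where "r = R1 / 2"
  have r: "0 < r" "r < R1" using R by (auto simp: r_def)
  define \<gamma> where "\<gamma> = circlepath 0 r"
  define \<gamma>' where "\<gamma>' = (\<lambda>t. 2 * of_real pi * \<i> * of_real r * exp (2 * of_real pi * \<i> * of_real t))"
  have g: "\<gamma> t = of_real r * exp (2 * of_real pi * \<i> * of_real t)" for t by (simp add: \<gamma>_def circlepath)
  have gn: "cmod (\<gamma> t) = r" for t using r unfolding g by (simp add: norm_mult)
  have g0: "\<gamma> t \<noteq> 0" for t using gn[of t] r by auto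
  have cg: "continuous_on A \<gamma>" "continuous_on A \<gamma>'" for A
    unfolding g[abs_def] \<gamma>'_def by (intro continuous_intros)+
  have hi: "((\<lambda>t. f (\<gamma> t, z2) / \<gamma> t ^ Suc k * \<gamma>' t) has_integral
      2 * of_real pi * \<i> * ((deriv ^^ k) (\<lambda>z1. f (z1, z2)) 0 / fact k)) {0..1}" if z2: "z2 \<in> ball 0 R2" for z2
  proof -
    have "((\<lambda>u. f (u, z2) / (u - 0) ^ Suc k) has_contour_integral
        ((2 * pi * \<i>) / (fact k) * (deriv ^^ k) (\<lambda>z1. f (z1, z2)) 0)) (circlepath 0 r)"
    proof (rule Cauchy_has_contour_integral_higher_derivative_circlepath)
      show "continuous_on (cball 0 r) (\<lambda>z1. f (z1, z2))"
        by (rule continuous_on_subset[OF holomorphic_on_imp_continuous_on[OF hol[OF z2]]]) (use r in auto)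
      show "(\<lambda>z1. f (z1, z2)) holomorphic_on ball 0 r"
        by (rule holomorphic_on_subset[OF hol[OF z2]]) (use r in auto)
    qed (use r in auto)
    then have "((\<lambda>t. f (\<gamma> t, z2) / \<gamma> t ^ Suc k * vector_derivative \<gamma> (at t within {0..1})) has_integral
      2 * of_real pi * \<i> * ((deriv ^^ k) (\<lambda>z1. f (z1, z2)) 0 / fact k)) {0..1}"
      unfolding has_contour_integral_def \<gamma>_def by simp
    then show ?thesis
      by (rule has_integral_eq[rotated]) (simp add: \<gamma>_def \<gamma>'_def vector_derivative_circlepath01 mult_ac)
  qed
  have "(\<lambda>z2. integral (cbox 0 1) (\<lambda>t. f (\<gamma> t, z2) / \<gamma> t ^ Suc k * \<gamma>' t)) holomorphic_on ball 0 R2"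
  proof (rule leibniz_rule_holomorphic[where fx = "\<lambda>z2 t. f2 (\<gamma> t, z2) / \<gamma> t ^ Suc k * \<gamma>' t"])
    fix z2 :: complex and t :: real assume z2: "z2 \<in> ball 0 R2"
    have "\<gamma> t \<in> ball 0 R1" using gn r by simp
    from f2(2)[OF this z2]
    have "((\<lambda>w. f (\<gamma> t, w) / \<gamma> t ^ Suc k * \<gamma>' t) has_field_derivative f2 (\<gamma> t, z2) / \<gamma> t ^ Suc k * \<gamma>' t) (at z2)"
      by (intro DERIV_cmult_right DERIV_cdivide)
    then show "((\<lambda>w. f (\<gamma> t, w) / \<gamma> t ^ Suc k * \<gamma>' t) has_field_derivative f2 (\<gamma> t, z2) / \<gamma> t ^ Suc k * \<gamma>' t) (at z2 within ball 0 R2)"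
      by (rule has_field_derivative_at_within)
  next
    show "(\<lambda>t. f (\<gamma> t, z2) / \<gamma> t ^ Suc k * \<gamma>' t) integrable_on cbox 0 1" if "z2 \<in> ball 0 R2" for z2
      using hi[OF that] by (auto simp: integrable_on_def)
  next
    have "continuous_on (ball 0 R2 \<times> cbox (0::real) 1) (\<lambda>x. f2 (\<gamma> (snd x), fst x) / \<gamma> (snd x) ^ Suc k * \<gamma>' (snd x))"
    proof (intro continuous_on_mult continuous_on_divide continuous_on_power)
      show "continuous_on (ball 0 R2 \<times> cbox (0::real) 1) (\<lambda>x. f2 (\<gamma> (snd x), fst x))"
        by (rule continuous_on_compose2[OF f2(1)])
          (auto intro!: continuous_on_Pair continuous_on_compose2[OF cg(1)] continuous_intros simp: gn r)
      show "continuous_on (ball 0 R2 \<times> cbox (0::real) 1) (\<lambda>x. \<gamma> (snd x))"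
        by (rule continuous_on_compose2[OF cg(1)[of UNIV]]) (auto intro!: continuous_intros)
      show "continuous_on (ball 0 R2 \<times> cbox (0::real) 1) (\<lambda>x. \<gamma>' (snd x))"
        by (rule continuous_on_compose2[OF cg(2)[of UNIV]]) (auto intro!: continuous_intros)
    qed (use g0 in auto)
    then show "continuous_on (ball 0 R2 \<times> cbox (0::real) 1) (\<lambda>(z2, t). f2 (\<gamma> t, z2) / \<gamma> t ^ Suc k * \<gamma>' t)"
      by (simp add: case_prod_unfold)
  qed simp
  then have "(\<lambda>z2. integral (cbox 0 1) (\<lambda>t. f (\<gamma> t, z2) / \<gamma> t ^ Suc k * \<gamma>' t) / (2 * of_real pi * \<i>)) holomorphic_on ball 0 R2"
    by (intro holomorphic_intros) auto
  then show ?thesis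
    by (rule holomorphic_transform) (use integral_unique[OF hi] in \<open>simp add: cbox_interval\<close>)
qed

lemma summable_on_product:
  fixes f :: "'a \<Rightarrow> real" and g :: "'b \<Rightarrow> real"
  assumes "f summable_on UNIV" "g summable_on UNIV" "\<And>x. f x \<ge> 0" "\<And>y. g y \<ge> 0"
  shows "(\<lambda>(x, y). f x * g y) summable_on UNIV"
proof -
  have "(\<lambda>(x, y). f x * g y) summable_on (UNIV \<times> UNIV)"
  proof (rule summable_on_SigmaI)
    show "((\<lambda>y. case (x, y) of (x, y) \<Rightarrow> f x * g y) has_sum f x * infsum g UNIV) UNIV" for x
      using has_sum_cmult_right[OF has_sum_infsum[OF assms(2)], of "f x"] by simp
    show "(\<lambda>x. f x * infsum g UNIV) summable_on UNIV" by (rule summable_on_cmult_left[OF assms(1)])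
  qed (use assms in auto)
  then show ?thesis by simp
qed

lemma summable_on_geometric: "0 \<le> q \<Longrightarrow> q < 1 \<Longrightarrow> (\<lambda>k. q ^ k :: real) summable_on (UNIV :: nat set)"
  by (intro summable_nonneg_imp_summable_on) auto

text \<open>Expand in \<open>z1\<close>, then expand each coefficient in \<open>z2\<close>. Cauchy
  estimates on a slightly smaller polydisc give absolute summability, which merges the iterated
  series into a double one.\<close>

lemma bihol_ps:
  assumes f: "bihol f R1 R2" and R: "R1 > 0" "R2 > 0"
  obtains x where "ps_on R1 R2 f x"
    "\<And>M k l. (\<And>z1 z2. cmod z1 < R1 \<Longrightarrow> cmod z2 < R2 \<Longrightarrow> cmod (f (z1, z2)) \<le> M)
        \<Longrightarrow> cmod (x (k, l)) * R1 ^ k * R2 ^ l \<le> M"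
proof -
  have cf: "continuous_on (ball 0 R1 \<times> ball 0 R2) f"
    and hol: "\<And>z2. z2 \<in> ball 0 R2 \<Longrightarrow> (\<lambda>z1. f (z1, z2)) holomorphic_on ball 0 R1"
    using f unfolding bihol_def by blast+
  define c where "c k z2 = (deriv ^^ k) (\<lambda>z1. f (z1, z2)) 0 / fact k" for k z2
  have c: "c k holomorphic_on ball 0 R2" for k
    using bihol_coeff_holomorphic[OF f R(1), of k] by (simp add: c_def[abs_def])
  define x where "x = (\<lambda>(k, l). (deriv ^^ l) (c k) 0 / fact l)"
  have cb: "cmod (c k z2) \<le> M / r1 ^ k"
    if r: "0 < r1" "r1 < R1" "r2 < R2" "cmod z2 \<le> r2"
      and M: "\<And>z1 z2. cmod z1 \<le> r1 \<Longrightarrow> cmod z2 \<le> r2 \<Longrightarrow> cmod (f (z1, z2)) \<le> M" for r1 r2 M k z2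
  proof -
    have z2: "z2 \<in> ball 0 R2" using r by simp
    have "cmod ((deriv ^^ k) (\<lambda>z1. f (z1, z2)) 0) \<le> fact k * M / r1 ^ k"
    proof (rule Cauchy_inequality)
      show "(\<lambda>z1. f (z1, z2)) holomorphic_on ball 0 r1"
        by (rule holomorphic_on_subset[OF hol[OF z2]]) (use r in auto)
      show "continuous_on (cball 0 r1) (\<lambda>z1. f (z1, z2))"
        by (rule continuous_on_subset[OF holomorphic_on_imp_continuous_on[OF hol[OF z2]]]) (use r in auto)
    qed (use r M in auto)
    then show ?thesis by (simp add: c_def norm_divide field_simps)
  qed
  have xb: "cmod (x (k, l)) \<le> M / r1 ^ k / r2 ^ l"
    if r: "0 < r1" "r1 < R1" "0 < r2" "r2 < R2"
      and M: "\<And>z1 z2. cmod z1 \<le> r1 \<Longrightarrow> cmod z2 \<le> r2 \<Longrightarrow> cmod (f (z1, z2)) \<le> M" for r1 r2 M k l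
  proof -
    have "cmod ((deriv ^^ l) (c k) 0) \<le> fact l * (M / r1 ^ k) / r2 ^ l"
    proof (rule Cauchy_inequality)
      show "c k holomorphic_on ball 0 r2"
        by (rule holomorphic_on_subset[OF c]) (use r in auto)
      show "continuous_on (cball 0 r2) (c k)"
        by (rule continuous_on_subset[OF holomorphic_on_imp_continuous_on[OF c]]) (use r in auto)
      show "cmod (c k z2) \<le> M / r1 ^ k" if "cmod (0 - z2) = r2" for z2
        using cb[OF r(1,2,4) _ M] that by simp
    qed (use r in auto)
    then show ?thesis by (simp add: x_def norm_divide field_simps)
  qed
  have "ps_on R1 R2 f x"
    unfolding ps_on_def
  proof (intro allI impI)
    fix z1 z2 :: complex assume z: "cmod z1 < R1" "cmod z2 < R2"
    define r1 where "r1 = (cmod z1 + R1) / 2"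
    define r2 where "r2 = (cmod z2 + R2) / 2"
    have r: "cmod z1 < r1" "0 < r1" "r1 < R1" "cmod z2 < r2" "0 < r2" "r2 < R2"
      using z R by (auto simp: r1_def r2_def add_nonneg_pos)
    have "compact (f ` (cball 0 r1 \<times> cball 0 r2))"
      by (intro compact_continuous_image compact_Times continuous_on_subset[OF cf]) (use r in auto)
    then obtain M where M: "\<And>z1 z2. cmod z1 \<le> r1 \<Longrightarrow> cmod z2 \<le> r2 \<Longrightarrow> cmod (f (z1, z2)) \<le> M"
      using bounded_iff[of "f ` (cball 0 r1 \<times> cball 0 r2)"] compact_imp_bounded by fastforce
    have M0: "M \<ge> 0" using M[of 0 0] r by (metis norm_ge_zero norm_zero order_less_imp_le order_trans)
    define q1 where "q1 = cmod z1 / r1"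
    define q2 where "q2 = cmod z2 / r2"
    have q: "0 \<le> q1" "q1 < 1" "0 \<le> q2" "q2 < 1" using r by (auto simp: q1_def q2_def)
    have tb: "cmod (x (k, l) * z1 ^ k * z2 ^ l) \<le> M * (q1 ^ k * q2 ^ l)" for k l
    proof -
      have "cmod (x (k, l) * z1 ^ k * z2 ^ l) = cmod (x (k, l)) * (cmod z1 ^ k * cmod z2 ^ l)"
        by (simp add: norm_mult norm_power)
      also have "\<dots> \<le> (M / r1 ^ k / r2 ^ l) * (cmod z1 ^ k * cmod z2 ^ l)"
        by (intro mult_right_mono xb r M) auto
      also have "\<dots> = M * (q1 ^ k * q2 ^ l)" by (simp add: q1_def q2_def power_divide)
      finally show ?thesis .
    qed
    have "(\<lambda>(k, l). q1 ^ k * q2 ^ l) summable_on (UNIV :: (nat \<times> nat) set)"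
      by (intro summable_on_product summable_on_geometric) (use q in auto)
    then have "(\<lambda>kl. M * (case kl of (k, l) \<Rightarrow> q1 ^ k * q2 ^ l)) summable_on (UNIV :: (nat \<times> nat) set)"
      by (rule summable_on_cmult_right)
    then have "(\<lambda>kl. norm (case kl of (k, l) \<Rightarrow> x (k, l) * z1 ^ k * z2 ^ l)) summable_on UNIV"
      by (rule summable_on_comparison_test) (use tb in auto)
    then have sm: "(\<lambda>kl. case kl of (k, l) \<Rightarrow> x (k, l) * z1 ^ k * z2 ^ l) summable_on UNIV \<times> UNIV"
      using abs_summable_summable by auto
    have "((\<lambda>kl. case kl of (k, l) \<Rightarrow> x (k, l) * z1 ^ k * z2 ^ l) has_sum f (z1, z2)) (UNIV \<times> UNIV)"
    proof (rule has_sum_SigmaI[OF _ _ sm])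
      fix k
      have "((\<lambda>l. x (k, l) * z2 ^ l) has_sum c k z2) UNIV"
      proof (rule norm_summable_imp_has_sum)
        show "(\<lambda>l. x (k, l) * z2 ^ l) sums c k z2"
          using holomorphic_power_series[OF c, of z2] z by (simp add: x_def)
        show "summable (\<lambda>l. cmod (x (k, l) * z2 ^ l))"
        proof (rule summable_comparison_test')
          show "summable (\<lambda>l. M / r1 ^ k * q2 ^ l)" using q by (intro summable_mult summable_geometric) auto
          show "norm (cmod (x (k, l) * z2 ^ l)) \<le> M / r1 ^ k * q2 ^ l" for l
          proof -
            have "cmod (x (k, l) * z2 ^ l) \<le> (M / r1 ^ k / r2 ^ l) * cmod z2 ^ l"
              unfolding norm_mult norm_power by (intro mult_right_mono xb r M) auto
            then show ?thesis by (simp add: q2_def power_divide)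
          qed
        qed
      qed
      from has_sum_cmult_right[OF this, of "z1 ^ k"]
      show "((\<lambda>y. case (k, y) of (k, l) \<Rightarrow> x (k, l) * z1 ^ k * z2 ^ l) has_sum c k z2 * z1 ^ k) UNIV"
        by (simp add: mult_ac)
    next
      show "((\<lambda>k. c k z2 * z1 ^ k) has_sum f (z1, z2)) UNIV"
      proof (rule norm_summable_imp_has_sum)
        show "(\<lambda>k. c k z2 * z1 ^ k) sums f (z1, z2)"
          using holomorphic_power_series[OF hol[of z2], of z1] z by (simp add: c_def)
        show "summable (\<lambda>k. cmod (c k z2 * z1 ^ k))"
        proof (rule summable_comparison_test')
          show "summable (\<lambda>k. M * q1 ^ k)" using q by (intro summable_mult summable_geometric) auto
          show "norm (cmod (c k z2 * z1 ^ k)) \<le> M * q1 ^ k" for k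
          proof -
            have "cmod (c k z2 * z1 ^ k) \<le> (M / r1 ^ k) * cmod z1 ^ k"
              unfolding norm_mult norm_power by (intro mult_right_mono cb[of r1 r2] r M) (use r in auto)
            then show ?thesis by (simp add: q1_def power_divide)
          qed
        qed
      qed
    qed
    then show "((\<lambda>(k, l). x (k, l) * z1 ^ k * z2 ^ l) has_sum f (z1, z2)) UNIV" by simp
  qed
  \<comment> \<open>\<open>f\<close> need not extend to the closed polydisc, so the estimate with
    the full radii is a limit of those with radii \<open>t * R1\<close> and
    \<open>t * R2\<close>.\<close>
  moreover have "cmod (x (k, l)) * R1 ^ k * R2 ^ l \<le> M"
    if M: "\<And>z1 z2. cmod z1 < R1 \<Longrightarrow> cmod z2 < R2 \<Longrightarrow> cmod (f (z1, z2)) \<le> M" for M k l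
  proof (rule tendsto_upperbound[of "\<lambda>t. cmod (x (k, l)) * (t * R1) ^ k * (t * R2) ^ l" _ "at_left 1"])
    have "((\<lambda>t. cmod (x (k, l)) * (t * R1) ^ k * (t * R2) ^ l) \<longlongrightarrow> cmod (x (k, l)) * (1 * R1) ^ k * (1 * R2) ^ l) (at_left 1)"
      by (intro tendsto_intros)
    then show "((\<lambda>t. cmod (x (k, l)) * (t * R1) ^ k * (t * R2) ^ l) \<longlongrightarrow> cmod (x (k, l)) * R1 ^ k * R2 ^ l) (at_left 1)" by simp
    have "cmod (x (k, l)) * (t * R1) ^ k * (t * R2) ^ l \<le> M" if t: "0 < t" "t < 1" for t
    proof -
      have tR: "0 < t * R1" "t * R1 < R1" "0 < t * R2" "t * R2 < R2" using t R by auto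
      have "cmod (x (k, l)) \<le> M / (t * R1) ^ k / (t * R2) ^ l"
        by (rule xb[OF tR]) (use M tR in \<open>meson order_le_less_trans\<close>)
      then show ?thesis using tR t R by (simp add: field_simps)
    qed
    then show "\<forall>\<^sub>F t in at_left 1. cmod (x (k, l)) * (t * R1) ^ k * (t * R2) ^ l \<le> M"
      by (intro eventually_mono[OF eventually_at_left_real[of 0 1]]) auto
  qed simp
  ultimately show ?thesis using that by blast
qed

text \<open>Rescaling by the least of the radii and 1 moves both expansions to the unit
  bidisk.\<close>

lemma ps_on_unique:
  assumes x: "ps_on R1 R2 f x" and y: "ps_on S1 S2 f y" and pos: "R1 > 0" "R2 > 0" "S1 > 0" "S2 > 0"
  shows "x = y"
proof -
  define t where "t = Min {1, R1, R2, S1, S2}"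
  have t: "0 < t" "t \<le> R1" "t \<le> R2" "t \<le> S1" "t \<le> S2" using pos by (auto simp: t_def)
  define g where "g = (\<lambda>(z1, z2). f (of_real t * z1, of_real t * z2))"
  have *: "ps g (\<lambda>(k, l). u (k, l) * of_real t ^ (k + l))" if u: "ps_on r1 r2 f u" and r: "t \<le> r1" "t \<le> r2" for u r1 r2
    unfolding ps_on_def
  proof (intro allI impI)
    fix z1 z2 :: complex assume z: "cmod z1 < 1" "cmod z2 < 1"
    have "cmod (of_real t * z1) < r1" "cmod (of_real t * z2) < r2"
    proof -
      have "t * cmod z1 < t" "t * cmod z2 < t" using z t by simp_all
      moreover have "cmod (of_real t * z) = t * cmod z" for z :: complex using t by (simp add: norm_mult)
      ultimately show "cmod (of_real t * z1) < r1" "cmod (of_real t * z2) < r2" by (metis order_less_le_trans r(1), metis order_less_le_trans r(2))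
    qed
    from ps_onD[OF u this]
    show "((\<lambda>(k, l). (case (k, l) of (k, l) \<Rightarrow> u (k, l) * of_real t ^ (k + l)) * z1 ^ k * z2 ^ l) has_sum g (z1, z2)) UNIV"
      by (simp add: g_def power_mult_distrib power_add mult_ac)
  qed
  have "(\<lambda>(k, l). x (k, l) * of_real t ^ (k + l)) = (\<lambda>(k, l). y (k, l) * complex_of_real t ^ (k + l))"
    by (rule ps_unique[OF *[OF x] *[OF y]]) (use t in auto)
  then have "x (k, l) * of_real t ^ (k + l) = y (k, l) * complex_of_real t ^ (k + l)" for k l
    by (simp add: fun_eq_iff)
  then show ?thesis using t by (auto simp: fun_eq_iff)
qed

text \<open>Since the expansion at the origin is unique, Cauchy estimates may be taken on any
  polydisc where the function is holomorphic and bounded, even one that does not lie in the unit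
  bidisk.\<close>

lemma ps_coeff_bound:
  assumes "ps f x" "bihol f R1 R2" "R1 > 0" "R2 > 0"
    and "\<And>z1 z2. cmod z1 < R1 \<Longrightarrow> cmod z2 < R2 \<Longrightarrow> cmod (f (z1, z2)) \<le> M"
  shows "cmod (x (k, l)) * R1 ^ k * R2 ^ l \<le> M"
proof -
  obtain y where y: "ps_on R1 R2 f y" "\<And>M k l. (\<And>z1 z2. cmod z1 < R1 \<Longrightarrow> cmod z2 < R2 \<Longrightarrow> cmod (f (z1, z2)) \<le> M)
        \<Longrightarrow> cmod (y (k, l)) * R1 ^ k * R2 ^ l \<le> M" using bihol_ps assms by metis
  have "x = y" using ps_on_unique[OF assms(1) y(1)] assms by simp
  then show ?thesis using y(2) assms(5) by blast
qed

lemma eval2_pCons: "eval2 (pCons c q) (z1, z2) = poly c z1 + z2 * eval2 q (z1, z2)"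
  by (simp add: eval2_def)

lemma eval2_DERIV_2: "((\<lambda>w. eval2 p (z1, w)) has_field_derivative eval2 (pderiv p) (z1, z2)) (at z2)"
proof (induction p)
  case (pCons c q)
  have "((\<lambda>w. poly c z1 + w * eval2 q (z1, w)) has_field_derivative 0 + (1 * eval2 q (z1, z2) + eval2 (pderiv q) (z1, z2) * z2)) (at z2)"
    by (intro DERIV_add DERIV_mult DERIV_const DERIV_ident pCons.IH)
  then show ?case by (simp add: eval2_pCons pderiv_pCons eval2_add mult_ac)
qed (simp add: eval2_0)

lemma poly_map_pderiv: "pderiv (poly p [:c:]) = poly (map_poly pderiv p) [:c:]" for c :: complex
  by (induction p) (simp_all add: map_poly_pCons pderiv_add pderiv_mult pderiv_smult)

lemma eval2_DERIV_1: "((\<lambda>w. eval2 p (w, z2)) has_field_derivative eval2 (map_poly pderiv p) (z1, z2)) (at z1)"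
  by (simp add: eval2_def poly_map_pderiv[symmetric] poly_DERIV)

lemma continuous_on_eval2: "continuous_on A (eval2 p)"
proof -
  have "continuous_on A (\<lambda>z. \<Sum>(k, l)\<in>{i. pc p i \<noteq> 0}. pc p (k, l) * fst z ^ k * snd z ^ l)"
    unfolding case_prod_unfold by (intro continuous_intros)
  moreover have "eval2 p z = (\<Sum>(k, l)\<in>{i. pc p i \<noteq> 0}. pc p (k, l) * fst z ^ k * snd z ^ l)" for z
    using eval2_expand[OF finite_pc order_refl, of p "fst z" "snd z"] by simp
  ultimately show ?thesis by simp
qed

lemma bihol_rational:
  assumes nz: "\<And>z1 z2. cmod z1 < R1 \<Longrightarrow> cmod z2 < R2 \<Longrightarrow> eval2 P (z1, z2) \<noteq> 0"
  shows "bihol (\<lambda>z. eval2 q z / eval2 P z) R1 R2"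
  unfolding bihol_def
proof (intro conjI ballI exI)
  have nz': "\<And>z. z \<in> ball 0 R1 \<times> ball 0 R2 \<Longrightarrow> eval2 P z \<noteq> 0" using nz by auto
  show "continuous_on (ball 0 R1 \<times> ball 0 R2) (\<lambda>z. eval2 q z / eval2 P z)"
    using nz' by (intro continuous_on_divide continuous_on_eval2) auto
  fix z2 :: complex assume z2: "z2 \<in> ball 0 R2"
  show "(\<lambda>z1. eval2 q (z1, z2) / eval2 P (z1, z2)) holomorphic_on ball 0 R1"
    using nz z2 by (intro holomorphic_on_divide)
      (auto simp: holomorphic_on_def field_differentiable_def intro: has_field_derivative_at_within[OF eval2_DERIV_1])
next
  show "continuous_on (ball 0 R1 \<times> ball 0 R2) (\<lambda>z. (eval2 (pderiv q) z * eval2 P z - eval2 q z * eval2 (pderiv P) z) / (eval2 P z * eval2 P z))"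
    using nz by (intro continuous_intros continuous_on_eval2) auto
next
  fix z1 z2 :: complex assume z: "z1 \<in> ball 0 R1" "z2 \<in> ball 0 R2"
  then show "((\<lambda>w. eval2 q (z1, w) / eval2 P (z1, w)) has_field_derivative
      (eval2 (pderiv q) (z1, z2) * eval2 P (z1, z2) - eval2 q (z1, z2) * eval2 (pderiv P) (z1, z2)) / (eval2 P (z1, z2) * eval2 P (z1, z2))) (at z2)"
    using nz by (intro DERIV_divide eval2_DERIV_2) auto
qed

text \<open>Compactness turns nonvanishing on a closed polydisc into a lower bound on a larger open
  one. The gain \<open>\<delta>\<close> in the radii is the origin of all exponential decay of
  coefficients.\<close>

lemma polydisc_lower_bound:
  fixes f :: "complex \<times> complex \<Rightarrow> complex"
  assumes cont: "continuous_on UNIV f" and ab: "0 \<le> a" "0 \<le> b"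
    and nz: "\<And>z1 z2. cmod z1 \<le> a \<Longrightarrow> cmod z2 \<le> b \<Longrightarrow> f (z1, z2) \<noteq> 0"
  obtains \<delta> c where "\<delta> > 0" "c > 0"
    "\<And>z1 z2. cmod z1 < a + \<delta> \<Longrightarrow> cmod z2 < b + \<delta> \<Longrightarrow> c \<le> cmod (f (z1, z2))"
proof -
  let ?K = "cball (0::complex) a \<times> cball (0::complex) b"
  have K: "compact ?K" "?K \<noteq> {}" using ab by (auto simp: compact_Times)
  have "continuous_on ?K (\<lambda>z. cmod (f z))"
    by (intro continuous_on_norm continuous_on_subset[OF cont]) auto
  from continuous_attains_inf[OF K this] obtain z0
    where z0: "z0 \<in> ?K" "\<And>z. z \<in> ?K \<Longrightarrow> cmod (f z0) \<le> cmod (f z)" by blast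
  define c where "c = cmod (f z0) / 2"
  have c: "c > 0" using z0(1) nz by (auto simp: c_def)
  define U where "U = {z. c < cmod (f z)}"
  have U: "open U" unfolding U_def
    by (intro open_Collect_less continuous_on_const continuous_on_norm cont)
  have KU: "?K \<subseteq> U"
  proof
    fix z assume "z \<in> ?K"
    from z0(2)[OF this] c show "z \<in> U" unfolding U_def c_def mem_Collect_eq by linarith
  qed
  obtain e where e: "e > 0" "{z. infdist z ?K \<le> e} \<subseteq> U"
    using compact_in_open_separated[OF K(2,1) U KU] by blast
  \<comment> \<open>Radial projection onto the disc of radius \<open>s\<close> moves a point only by
    the excess of its modulus over \<open>s\<close>.\<close>
  have proj: "\<exists>w'. cmod w' \<le> s \<and> dist w w' \<le> e / 2" if "cmod w < s + e / 2" "0 \<le> s" for w :: complex and s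
  proof (cases "cmod w \<le> s")
    case True then show ?thesis using e by (intro exI[of _ w]) auto
  next
    case False
    define w' where "w' = of_real (s / cmod w) * w"
    have pos: "cmod w > 0" using False that by linarith
    have "cmod w' = s" using pos that by (simp add: w'_def norm_mult norm_divide)
    moreover have "w - w' = of_real (1 - s / cmod w) * w" by (simp add: w'_def algebra_simps)
    then have "dist w w' = \<bar>1 - s / cmod w\<bar> * cmod w" by (simp add: dist_norm norm_mult del: of_real_diff)
    moreover have "\<bar>1 - s / cmod w\<bar> * cmod w = cmod w - s"
    proof -
      have "s / cmod w < 1" using False pos by (simp add: divide_less_eq)
      then have "\<bar>1 - s / cmod w\<bar> = 1 - s / cmod w" by simp
      then show ?thesis using pos by (simp add: left_diff_distrib)
    qed
    ultimately show ?thesis using that by (intro exI[of _ w']) auto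
  qed
  show ?thesis
  proof (rule that[of "e/2" c])
    fix z1 z2 :: complex assume z: "cmod z1 < a + e/2" "cmod z2 < b + e/2"
    obtain w1 where w1: "cmod w1 \<le> a" "dist z1 w1 \<le> e/2" using proj[OF z(1) ab(1)] by blast
    obtain w2 where w2: "cmod w2 \<le> b" "dist z2 w2 \<le> e/2" using proj[OF z(2) ab(2)] by blast
    have "infdist (z1, z2) ?K \<le> dist (z1, z2) (w1, w2)" using w1 w2 by (intro infdist_le) auto
    also have "\<dots> \<le> dist z1 w1 + dist z2 w2"
      unfolding dist_Pair_Pair using sqrt_sum_squares_le_sum[of "dist z1 w1" "dist z2 w2"] by simp
    also have "\<dots> \<le> e" using w1 w2 by simp
    finally have "(z1, z2) \<in> U" using e by blast
    then show "c \<le> cmod (f (z1, z2))" by (simp add: U_def)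
  qed (use e c in auto)
qed

lemma eval2_bounded:
  obtains M where "M > 0" "\<And>z1 z2. cmod z1 \<le> a \<Longrightarrow> cmod z2 \<le> b \<Longrightarrow> cmod (eval2 p (z1, z2)) \<le> M"
proof -
  have "compact (eval2 p ` (cball 0 a \<times> cball 0 b))"
    by (intro compact_continuous_image compact_Times continuous_on_eval2) auto
  then obtain M where M: "\<And>y. y \<in> eval2 p ` (cball 0 a \<times> cball 0 b) \<Longrightarrow> cmod y \<le> M"
    using bounded_iff[of "eval2 p ` (cball 0 a \<times> cball 0 b)"] compact_imp_bounded by auto
  have "cmod (eval2 p (z1, z2)) \<le> max M 1" if "cmod z1 \<le> a" "cmod z2 \<le> b" for z1 z2
  proof -
    have "eval2 p (z1, z2) \<in> eval2 p ` (cball 0 a \<times> cball 0 b)" using that by (intro imageI) auto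
    then show ?thesis using M le_max_iff_disj by blast
  qed
  then show ?thesis using that[of "max M 1"] by simp
qed

text \<open>The passage to one variable: at fixed \<open>z2\<close> the double series becomes a
  power series in \<open>z1\<close> whose coefficients are power series in
  \<open>z2\<close>.\<close>

lemma ps_slice:
  assumes "ps f x" "cmod z2 < 1"
  shows "((\<lambda>l. x (k, l) * z2 ^ l) has_sum (\<Sum>\<^sub>\<infinity>l. x (k, l) * z2 ^ l)) UNIV"
    "cmod z1 < 1 \<Longrightarrow> ((\<lambda>k. (\<Sum>\<^sub>\<infinity>l. x (k, l) * z2 ^ l) * z1 ^ k) has_sum f (z1, z2)) UNIV"
proof -
  have hs: "((\<lambda>(k, l). x (k, l) * w ^ k * z2 ^ l) has_sum f (w, z2)) (UNIV \<times> UNIV)" if "cmod w < 1" for w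
    using ps_onD[OF assms(1) that assms(2)] by simp
  have sm: "(\<lambda>l. x (k, l) * w ^ k * z2 ^ l) summable_on UNIV" if "cmod w < 1" for w k
    using summable_on_SigmaD1[OF has_sum_imp_summable[OF hs[OF that]], of k] by simp
  \<comment> \<open>Summability in \<open>l\<close> is read off at the nonzero point
    \<open>z1 = 1/2\<close>, where the factor \<open>z1 ^ k\<close> can be divided out.\<close>
  have inner: "(\<lambda>l. x (k, l) * z2 ^ l) summable_on UNIV" for k
    using summable_on_cmult_right[OF sm[of "1/2" k], of "2 ^ k"] by (simp add: norm_divide field_simps)
  show i: "((\<lambda>l. x (k, l) * z2 ^ l) has_sum (\<Sum>\<^sub>\<infinity>l. x (k, l) * z2 ^ l)) UNIV" for k
    using inner by (rule has_sum_infsum)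
  show "((\<lambda>k. (\<Sum>\<^sub>\<infinity>l. x (k, l) * z2 ^ l) * z1 ^ k) has_sum f (z1, z2)) UNIV" if z1: "cmod z1 < 1"
  proof (rule has_sum_SigmaD[OF hs[OF z1]])
    show "((\<lambda>l. case (k, l) of (k, l) \<Rightarrow> x (k, l) * z1 ^ k * z2 ^ l) has_sum (\<Sum>\<^sub>\<infinity>l. x (k, l) * z2 ^ l) * z1 ^ k) UNIV" for k
      using has_sum_cmult_left[OF i[of k], of "z1 ^ k"] by (simp add: mult_ac)
  qed
qed

section \<open>A Bessel inequality\<close>

text \<open>Orthogonality of the \<open>N\<close>-th roots of unity. Because the degree is below
  \<open>N\<close>, an average over \<open>N\<close> points replaces the integral over the circle of
  radius \<open>t\<close>.\<close>

lemma discrete_parseval: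
  fixes d :: "nat \<Rightarrow> complex" and z :: "nat \<Rightarrow> complex"
  assumes N: "N > 0" and z: "\<And>j. z j = of_real t * cis (2 * pi * real j / real N)"
  shows "(\<Sum>j<N. (cmod (\<Sum>l<N. d l * z j ^ l))\<^sup>2) = real N * (\<Sum>l<N. (cmod (d l))\<^sup>2 * t ^ (2 * l))"
proof -
  define w where "w l = cis (2 * pi * real l / real N)" for l :: nat
  have wN: "w l ^ N = 1" for l
  proof -
    have "w l ^ N = cis (real N * (2 * pi * real l / real N))" unfolding w_def by (rule Complex.DeMoivre)
    also have "real N * (2 * pi * real l / real N) = 2 * pi * real l" using N by simp
    finally show ?thesis by (simp add: cis_multiple_2pi)
  qed
  have inj: "w l = w m \<Longrightarrow> l < N \<Longrightarrow> m < N \<Longrightarrow> l = m" for l m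
    using Complex.bij_betw_roots_unity[OF N] by (auto simp: bij_betw_def inj_on_def w_def)
  have cw: "cnj (w l) = inverse (w l)" for l by (simp add: w_def cis_cnj cis_inverse flip: cis_divide)
  have zw: "z j ^ l = of_real (t ^ l) * w l ^ j" for j l
    by (simp add: z w_def power_mult_distrib Complex.DeMoivre mult_ac)
  have orth: "(\<Sum>j<N. w l ^ j * cnj (w m ^ j)) = (if l = m then of_nat N else 0)" if "l < N" "m < N" for l m
  proof -
    have w0: "w m \<noteq> 0" for m by (simp add: w_def)
    have e: "w l ^ j * cnj (w m ^ j) = (w l / w m) ^ j" for j
      by (simp add: cw divide_inverse power_inverse power_mult_distrib)
    show ?thesis
    proof (cases "l = m")
      case True then show ?thesis unfolding e using w0 by simp
    next
      case False
      then have "w l / w m \<noteq> 1" using inj[of l m] that w0 by auto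
      then have "(\<Sum>j<N. (w l / w m) ^ j) = (1 - (w l / w m) ^ N) / (1 - w l / w m)" by (simp only: sum_gp_strict if_False)
      also have "\<dots> = 0" by (simp add: power_divide wN)
      finally show ?thesis unfolding e using False by simp
    qed
  qed
  have "complex_of_real (\<Sum>j<N. (cmod (\<Sum>l<N. d l * z j ^ l))\<^sup>2)
      = (\<Sum>j<N. (\<Sum>l<N. d l * z j ^ l) * cnj (\<Sum>m<N. d m * z j ^ m))"
    unfolding of_real_sum by (intro sum.cong refl complex_norm_square)
  also have "\<dots> = (\<Sum>j<N. \<Sum>l<N. \<Sum>m<N. (d l * cnj (d m) * of_real (t ^ l * t ^ m)) * (w l ^ j * cnj (w m ^ j)))"
    by (simp add: sum_product zw mult_ac)
  also have "\<dots> = (\<Sum>l<N. \<Sum>m<N. \<Sum>j<N. (d l * cnj (d m) * of_real (t ^ l * t ^ m)) * (w l ^ j * cnj (w m ^ j)))"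
    by (subst sum.swap) (intro sum.cong refl sum.swap)
  also have "\<dots> = (\<Sum>l<N. \<Sum>m<N. (d l * cnj (d m) * of_real (t ^ l * t ^ m)) * (if l = m then of_nat N else 0))"
    by (intro sum.cong refl) (simp only: sum_distrib_left[symmetric] orth lessThan_iff)
  also have "\<dots> = (\<Sum>l<N. (d l * cnj (d l) * of_real (t ^ l * t ^ l)) * of_nat N)"
    by (intro sum.cong refl) (simp add: if_distrib[of "\<lambda>x. _ * x"] cong: if_cong)
  also have "\<dots> = (\<Sum>l<N. of_real (real N * ((cmod (d l))\<^sup>2 * t ^ (2 * l))))"
    by (intro sum.cong refl) (simp add: complex_norm_square[symmetric] power_mult power2_eq_square power_mult_distrib mult_ac flip: of_real_power)
  also have "\<dots> = complex_of_real (real N * (\<Sum>l<N. (cmod (d l))\<^sup>2 * t ^ (2 * l)))"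
    by (simp add: sum_distrib_left)
  finally show ?thesis unfolding of_real_eq_iff .
qed

text \<open>Average the hypothesis over \<open>N\<close> equally spaced points of a circle of radius
  \<open>t < 1\<close>, with Taylor polynomials of degree below \<open>N\<close> in place of the
  \<open>c k\<close>. The remainders \<open>T k N\<close> vanish as \<open>N\<close> grows; then
  \<open>\<eta>\<close> goes to 0 and \<open>t\<close> to 1.\<close>

lemma bessel_slices:
  fixes x :: "nat \<Rightarrow> nat \<Rightarrow> complex" and u :: "nat \<Rightarrow> real"
  assumes F: "finite F" and u: "\<And>k. u k \<ge> 0"
    and hs: "\<And>k z. k \<in> F \<Longrightarrow> cmod z < 1 \<Longrightarrow> ((\<lambda>l. x k l * z ^ l) has_sum c k z) UNIV"
    and C: "\<And>z. cmod z < 1 \<Longrightarrow> (\<Sum>k\<in>F. u k * (cmod (c k z))\<^sup>2) \<le> C"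
  shows "(\<Sum>k\<in>F. u k * (\<Sum>l<L. (cmod (x k l))\<^sup>2)) \<le> C"
proof -
  have main: "(\<Sum>k\<in>F. u k * (\<Sum>l<L. (cmod (x k l))\<^sup>2 * t ^ (2 * l))) \<le> C" if t: "0 < t" "t < 1" for t
  proof -
    have asum: "summable (\<lambda>l. cmod (x k l) * t ^ l)" if "k \<in> F" for k
    proof -
      have "(\<lambda>l. x k l * of_real t ^ l) summable_on UNIV" using hs[OF that, of "of_real t"] t by (auto simp: has_sum_imp_summable)
      then have "(\<lambda>l. cmod (x k l * of_real t ^ l)) summable_on UNIV"
        by (simp add: summable_on_iff_abs_summable_on_complex)
      then show ?thesis using t by (intro summable_on_imp_summable) (simp add: norm_mult norm_power)
    qed
    define T where "T k N = (\<Sum>l. cmod (x k (l + N)) * t ^ (l + N))" for k N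
    have T: "(\<lambda>N. T k N) \<longlonglongrightarrow> 0" if "k \<in> F" for k
      unfolding T_def using suminf_exist_split2[OF asum[OF that]] .
    have Tz: "cmod ((\<Sum>l<N. x k l * z ^ l) - c k z) \<le> T k N" if k: "k \<in> F" and z: "cmod z = t" for k z N
    proof -
      have s: "(\<lambda>l. x k l * z ^ l) sums c k z" by (rule has_sum_imp_sums[OF hs[OF k]]) (use t z in simp)
      then have "(\<lambda>l. x k (l + N) * z ^ (l + N)) sums (c k z - (\<Sum>l<N. x k l * z ^ l))"
        by (rule sums_split_initial_segment)
      moreover have "summable (\<lambda>l. cmod (x k (l + N) * z ^ (l + N)))"
        using summable_ignore_initial_segment[OF asum[OF k], of N] by (simp add: norm_mult norm_power z)
      ultimately have "cmod (c k z - (\<Sum>l<N. x k l * z ^ l)) \<le> (\<Sum>l. cmod (x k (l + N) * z ^ (l + N)))"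
        using summable_norm sums_unique by metis
      then show ?thesis by (simp add: T_def norm_mult norm_power z norm_minus_commute)
    qed
    have step: "(\<Sum>k\<in>F. u k * (\<Sum>l<L. (cmod (x k l))\<^sup>2 * t ^ (2 * l))) \<le> (1 + \<eta>) * C + (1 + 1/\<eta>) * (\<Sum>k\<in>F. u k * (T k N)\<^sup>2)"
      if \<eta>: "\<eta> > 0" and N: "N \<ge> L" "N > 0" for \<eta> N
    proof -
      define z where "z j = of_real t * cis (2 * pi * real j / real N)" for j :: nat
      have zt: "cmod (z j) = t" for j using t by (simp add: z_def norm_mult)
      define S where "S k j = (\<Sum>l<N. x k l * z j ^ l)" for k j
      have "(\<Sum>k\<in>F. u k * (\<Sum>l<L. (cmod (x k l))\<^sup>2 * t ^ (2 * l))) \<le> (\<Sum>k\<in>F. u k * (\<Sum>l<N. (cmod (x k l))\<^sup>2 * t ^ (2 * l)))"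
        using N t u by (intro sum_mono mult_left_mono sum_mono2) auto
      also have "\<dots> = (\<Sum>k\<in>F. u k * ((\<Sum>j<N. (cmod (S k j))\<^sup>2) / real N))"
        using discrete_parseval[OF N(2) z_def] N by (simp add: S_def)
      also have "\<dots> = (\<Sum>j<N. \<Sum>k\<in>F. u k * (cmod (S k j))\<^sup>2) / real N"
        by (subst sum.swap) (simp add: sum_distrib_left sum_divide_distrib)
      also have "\<dots> \<le> (\<Sum>j<N. (1 + \<eta>) * C + (1 + 1/\<eta>) * (\<Sum>k\<in>F. u k * (T k N)\<^sup>2)) / real N"
      proof (intro divide_right_mono sum_mono)
        fix j
        have "(\<Sum>k\<in>F. u k * (cmod (S k j))\<^sup>2) \<le> (\<Sum>k\<in>F. u k * ((1 + 1/\<eta>) * (T k N)\<^sup>2 + (1 + \<eta>) * (cmod (c k (z j)))\<^sup>2))"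
        proof (intro sum_mono mult_left_mono u)
          fix k assume k: "k \<in> F"
          have "(cmod (S k j))\<^sup>2 = (cmod ((S k j - c k (z j)) + c k (z j)))\<^sup>2" by simp
          also have "\<dots> \<le> (1 + 1/\<eta>) * (cmod (S k j - c k (z j)))\<^sup>2 + (1 + \<eta>) * (cmod (c k (z j)))\<^sup>2"
            by (rule norm_add_sq_le[OF \<eta>])
          also have "\<dots> \<le> (1 + 1/\<eta>) * (T k N)\<^sup>2 + (1 + \<eta>) * (cmod (c k (z j)))\<^sup>2"
            using Tz[OF k zt, of j N] \<eta> by (intro add_right_mono mult_left_mono power_mono) (auto simp: S_def)
          finally show "(cmod (S k j))\<^sup>2 \<le> (1 + 1/\<eta>) * (T k N)\<^sup>2 + (1 + \<eta>) * (cmod (c k (z j)))\<^sup>2" .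
        qed
        also have "\<dots> = (1 + \<eta>) * (\<Sum>k\<in>F. u k * (cmod (c k (z j)))\<^sup>2) + (1 + 1/\<eta>) * (\<Sum>k\<in>F. u k * (T k N)\<^sup>2)"
          by (simp add: sum_distrib_left sum.distrib[symmetric] algebra_simps)
        also have "\<dots> \<le> (1 + \<eta>) * C + (1 + 1/\<eta>) * (\<Sum>k\<in>F. u k * (T k N)\<^sup>2)"
          using C[of "z j"] zt t \<eta> by (intro add_right_mono mult_left_mono) auto
        finally show "(\<Sum>k\<in>F. u k * (cmod (S k j))\<^sup>2) \<le> (1 + \<eta>) * C + (1 + 1/\<eta>) * (\<Sum>k\<in>F. u k * (T k N)\<^sup>2)" .
      qed simp
      also have "\<dots> = (1 + \<eta>) * C + (1 + 1/\<eta>) * (\<Sum>k\<in>F. u k * (T k N)\<^sup>2)" using N by simp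
      finally show ?thesis .
    qed
    have "(\<Sum>k\<in>F. u k * (\<Sum>l<L. (cmod (x k l))\<^sup>2 * t ^ (2 * l))) \<le> (1 + \<eta>) * C" if \<eta>: "\<eta> > 0" for \<eta>
    proof -
      have "(\<lambda>N. (1 + \<eta>) * C + (1 + 1/\<eta>) * (\<Sum>k\<in>F. u k * (T k N)\<^sup>2)) \<longlonglongrightarrow> (1 + \<eta>) * C + (1 + 1/\<eta>) * (\<Sum>k\<in>F. u k * 0\<^sup>2)"
        by (intro tendsto_intros T)
      then have "(\<lambda>N. (1 + \<eta>) * C + (1 + 1/\<eta>) * (\<Sum>k\<in>F. u k * (T k N)\<^sup>2)) \<longlonglongrightarrow> (1 + \<eta>) * C" by simp
      then show ?thesis
        by (rule LIMSEQ_le_const) (use step[OF \<eta>] in \<open>auto intro!: exI[of _ "Suc L"]\<close>)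
    qed
    moreover have "((\<lambda>\<eta>. (1 + \<eta>) * C) \<longlongrightarrow> (1 + 0) * C) (at_right 0)" by (intro tendsto_intros)
    ultimately show ?thesis
      by (intro tendsto_lowerbound[of "\<lambda>\<eta>. (1 + \<eta>) * C" C "at_right 0"] eventually_mono[OF eventually_at_right_less]) auto
  qed
  have "((\<lambda>t. \<Sum>k\<in>F. u k * (\<Sum>l<L. (cmod (x k l))\<^sup>2 * t ^ (2 * l))) \<longlongrightarrow> (\<Sum>k\<in>F. u k * (\<Sum>l<L. (cmod (x k l))\<^sup>2 * 1 ^ (2 * l)))) (at_left (1::real))"
    by (intro tendsto_intros)
  then show ?thesis
    by (intro tendsto_upperbound[where F = "at_left (1::real)"]) 
      (auto intro!: eventually_mono[OF eventually_at_left_real[of 0 1]] main)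
qed

text \<open>The weight is constant in \<open>l\<close>: in the second index the norm is that of the
  Hardy space, which a supremum over \<open>z2\<close> controls.\<close>

lemma sqle_by_slices:
  fixes x :: "nat \<times> nat \<Rightarrow> complex" and u :: "nat \<Rightarrow> real"
  assumes u: "\<And>k. u k \<ge> 0"
    and hs: "\<And>k z. cmod z < 1 \<Longrightarrow> ((\<lambda>l. x (k, l) * z ^ l) has_sum c k z) UNIV"
    and C: "\<And>K z. cmod z < 1 \<Longrightarrow> (\<Sum>k<K. u k * (cmod (c k z))\<^sup>2) \<le> C"
  shows "sqle (\<lambda>(k, l). u k) x C"
  unfolding sqle_def
proof (intro allI impI)
  fix F :: "(nat \<times> nat) set" assume F: "finite F"
  obtain K where K: "fst ` F \<subseteq> {..<K}" using finite_nat_set_iff_bounded[of "fst ` F"] F by auto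
  obtain L where L: "snd ` F \<subseteq> {..<L}" using finite_nat_set_iff_bounded[of "snd ` F"] F by auto
  have FKL: "F \<subseteq> {..<K} \<times> {..<L}" using K L by force
  have "(\<Sum>i\<in>F. (case i of (k, l) \<Rightarrow> u k) * (cmod (x i))\<^sup>2) \<le> (\<Sum>i\<in>{..<K} \<times> {..<L}. (case i of (k, l) \<Rightarrow> u k) * (cmod (x i))\<^sup>2)"
    using FKL u by (intro sum_mono2) auto
  also have "\<dots> = (\<Sum>k<K. \<Sum>l<L. u k * (cmod (x (k, l)))\<^sup>2)" by (simp add: sum.cartesian_product case_prod_unfold)
  also have "\<dots> = (\<Sum>k<K. u k * (\<Sum>l<L. (cmod (x (k, l)))\<^sup>2))" by (simp add: sum_distrib_left)
  also have "\<dots> \<le> C" by (rule bessel_slices[OF _ u hs C]) auto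
  finally show "(\<Sum>i\<in>F. (case i of (k, l) \<Rightarrow> u k) * (cmod (x i))\<^sup>2) \<le> C" .
qed

section \<open>Polynomials in one variable without zeros in the disc\<close>

lemma sums_powser_unique:
  fixes a b :: "nat \<Rightarrow> complex"
  assumes "\<And>z. cmod z < 1 \<Longrightarrow> (\<lambda>k. a k * z ^ k) sums f z"
    and "\<And>z. cmod z < 1 \<Longrightarrow> ((\<lambda>k. b k * z ^ k) has_sum f z) UNIV"
  shows "a = b"
proof (rule has_sum_powser_unique)
  fix z :: complex assume "z \<in> ball 0 1"
  then have z: "cmod z < 1" by simp
  then show "((\<lambda>k. b k * z ^ k) has_sum f z) UNIV" by (rule assms(2))
  obtain t where t: "cmod z < t" "t < 1" using z dense by blast
  have t0: "0 < t" using t by (meson norm_ge_zero order_le_less_trans)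
  have "summable (\<lambda>k. a k * of_real t ^ k)" using assms(1)[of "of_real t"] t t0 by (auto simp: sums_iff)
  then have "summable (\<lambda>k. norm (a k * z ^ k))" by (rule powser_insidea) (use t t0 in simp)
  then show "((\<lambda>k. a k * z ^ k) has_sum f z) UNIV" by (rule norm_summable_imp_has_sum[OF _ assms(1)[OF z]])
qed

text \<open>\<open>A\<close> bounds the norm in the Wiener algebra of absolutely convergent series.
  The pair of bounds survives products, unlike the Dirichlet norm, and still dominates that
  norm.\<close>

definition wiener :: "real \<Rightarrow> real \<Rightarrow> (nat \<Rightarrow> complex) \<Rightarrow> bool" where
  "wiener A B c \<longleftrightarrow> (\<forall>N. (\<Sum>k<N. cmod (c k)) \<le> A) \<and> (\<forall>k. real k * cmod (c k) \<le> B)"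

lemma wiener_mono: "wiener A B c \<Longrightarrow> A \<le> A' \<Longrightarrow> B \<le> B' \<Longrightarrow> wiener A' B' c"
  unfolding wiener_def by (meson order_trans)

lemma wiener_nonneg: assumes "wiener A B c" shows "0 \<le> A" "0 \<le> B"
proof -
  have "(\<Sum>k<0. cmod (c k)) \<le> A" "real 0 * cmod (c 0) \<le> B" using assms unfolding wiener_def by blast+
  then show "0 \<le> A" "0 \<le> B" by simp_all
qed

lemma wiener_summable: assumes "wiener A B c" shows "summable (\<lambda>k. cmod (c k))"
  using assms by (intro summableI_nonneg_bounded[where x = A]) (auto simp: wiener_def)

text \<open>The weight \<open>k = i + (k - i)\<close> is additive on the terms of a Cauchy product.\<close>

lemma wiener_cauchy_product:
  assumes c: "wiener A B c" and d: "wiener A' B' d"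
  shows "wiener (A * A') (B * A' + A * B') (\<lambda>k. \<Sum>i\<le>k. c i * d (k - i))"
  unfolding wiener_def
proof (intro conjI allI)
  have nn: "0 \<le> A" "0 \<le> B" "0 \<le> A'" "0 \<le> B'" using wiener_nonneg c d by auto
  fix N :: nat
  have "(\<Sum>k<N. cmod (\<Sum>i\<le>k. c i * d (k - i))) \<le> (\<Sum>k<N. \<Sum>i\<le>k. cmod (c i) * cmod (d (k - i)))"
    by (intro sum_mono order_trans[OF norm_sum]) (simp add: norm_mult)
  also have "\<dots> = (\<Sum>(i, j)\<in>{(i, j). i + j < N}. cmod (c i) * cmod (d j))"
    by (rule sum.triangle_reindex[symmetric])
  also have "\<dots> \<le> (\<Sum>(i, j)\<in>{..<N} \<times> {..<N}. cmod (c i) * cmod (d j))"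
    by (intro sum_mono2) auto
  also have "\<dots> = (\<Sum>i<N. cmod (c i)) * (\<Sum>j<N. cmod (d j))"
    by (simp add: sum_product sum.cartesian_product)
  also have "\<dots> \<le> A * A'" using c d nn by (intro mult_mono sum_nonneg) (auto simp: wiener_def)
  finally show "(\<Sum>k<N. cmod (\<Sum>i\<le>k. c i * d (k - i))) \<le> A * A'" .
next
  have nn: "0 \<le> A" "0 \<le> B" "0 \<le> A'" "0 \<le> B'" using wiener_nonneg c d by auto
  fix k :: nat
  have "real k * cmod (\<Sum>i\<le>k. c i * d (k - i)) \<le> real k * (\<Sum>i\<le>k. cmod (c i) * cmod (d (k - i)))"
    by (intro mult_left_mono order_trans[OF norm_sum]) (simp_all add: norm_mult)
  also have "\<dots> = (\<Sum>i\<le>k. (real i * cmod (c i)) * cmod (d (k - i)) + cmod (c i) * (real (k - i) * cmod (d (k - i))))"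
    unfolding sum_distrib_left by (intro sum.cong refl) (simp add: of_nat_diff algebra_simps)
  also have "\<dots> \<le> (\<Sum>i\<le>k. B * cmod (d (k - i)) + cmod (c i) * B')"
  proof -
    have "real j * cmod (c j) \<le> B" "real j * cmod (d j) \<le> B'" for j using c d by (auto simp: wiener_def)
    then show ?thesis by (intro sum_mono add_mono mult_left_mono mult_right_mono) (auto simp del: of_nat_diff)
  qed
  also have "\<dots> = B * (\<Sum>i<Suc k. cmod (d (Suc k - Suc i))) + (\<Sum>i<Suc k. cmod (c i)) * B'"
    by (simp add: sum.distrib sum_distrib_left sum_distrib_right lessThan_Suc_atMost)
  also have "(\<Sum>i<Suc k. cmod (d (Suc k - Suc i))) = (\<Sum>i<Suc k. cmod (d i))"
    by (rule sum.nat_diff_reindex)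
  also have "B * (\<Sum>i<Suc k. cmod (d i)) + (\<Sum>i<Suc k. cmod (c i)) * B' \<le> B * A' + A * B'"
    using c d nn by (intro add_mono mult_left_mono mult_right_mono) (auto simp: wiener_def simp del: sum.lessThan_Suc)
  finally show "real k * cmod (\<Sum>i\<le>k. c i * d (k - i)) \<le> B * A' + A * B'" .
qed

text \<open>One factor \<open>cmod (c k)\<close> is absorbed together with \<open>real k + 1\<close>
  into \<open>A + B\<close>; the other is summed.\<close>

lemma wiener_sum_sq:
  assumes c: "wiener A B c"
  shows "(\<Sum>k<K. (real k + 1) * (cmod (c k))\<^sup>2) \<le> (A + B) * A"
proof -
  have "cmod (c k) \<le> A" for k
  proof -
    have "cmod (c k) \<le> (\<Sum>k<Suc k. cmod (c k))" by (rule member_le_sum) auto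
    then show ?thesis using c unfolding wiener_def by (meson order_trans)
  qed
  then have "(real k + 1) * cmod (c k) \<le> A + B" for k
    using c unfolding wiener_def by (simp add: distrib_right add.commute add_mono)
  then have "(\<Sum>k<K. (real k + 1) * (cmod (c k))\<^sup>2) \<le> (\<Sum>k<K. (A + B) * cmod (c k))"
    unfolding power2_eq_square mult.assoc[symmetric] by (intro sum_mono mult_right_mono) auto
  also have "\<dots> \<le> (A + B) * A"
    unfolding sum_distrib_left[symmetric] using c wiener_nonneg[OF c]
    by (intro mult_left_mono) (auto simp: wiener_def)
  finally show ?thesis .
qed

text \<open>With \<open>b = 1 / a\<close> the quotient is
  \<open>1 + (r - 1) b z / (1 - r b z)\<close>. The factor \<open>1 - r\<close> cancels the
  geometric sum of the powers of \<open>r\<close>, so the bounds depend neither on \<open>r\<close>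
  nor on \<open>a\<close>.\<close>

lemma linear_quotient_wiener:
  fixes a :: complex
  assumes a: "1 \<le> cmod a" and r: "0 < r" "r < 1"
  obtains c where "wiener 2 1 c" "\<And>z. cmod z < 1 \<Longrightarrow> (\<lambda>k. c k * z ^ k) sums ((z - a) / (of_real r * z - a))"
proof -
  define b where "b = 1 / a"
  have b: "cmod b \<le> 1" using a by (simp add: b_def norm_divide divide_le_eq)
  have a0: "a \<noteq> 0" using a by auto
  define c where "c k = (case k of 0 \<Rightarrow> 1 | Suc j \<Rightarrow> of_real (r - 1) * b * (of_real r * b) ^ j)" for k
  have cn: "cmod (c (Suc j)) \<le> (1 - r) * r ^ j" for j
  proof -
    have "cmod (c (Suc j)) = (1 - r) * r ^ j * cmod b ^ Suc j"
      using r by (simp add: c_def norm_mult norm_power power_mult_distrib del: of_real_diff)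
    also have "\<dots> \<le> (1 - r) * r ^ j" using r b by (intro mult_left_le power_le_one) auto
    finally show ?thesis .
  qed
  have geo: "(1 - r) * (\<Sum>j<N. r ^ j) \<le> 1" for N
    using r by (simp add: sum_gp_strict)
  have "wiener 2 1 c"
    unfolding wiener_def
  proof (intro conjI allI)
    fix N
    have "(\<Sum>k<N. cmod (c k)) \<le> (\<Sum>k<Suc N. cmod (c k))" by simp
    also have "\<dots> = 1 + (\<Sum>j<N. cmod (c (Suc j)))" by (subst sum.lessThan_Suc_shift) (simp add: c_def)
    also have "\<dots> \<le> 1 + (\<Sum>j<N. (1 - r) * r ^ j)" by (intro add_left_mono sum_mono cn)
    also have "\<dots> \<le> 2" using geo[of N] by (simp add: sum_distrib_left)
    finally show "(\<Sum>k<N. cmod (c k)) \<le> 2" .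
    fix k
    show "real k * cmod (c k) \<le> 1"
    proof (cases k)
      case (Suc j)
      have "real k * cmod (c k) \<le> real k * ((1 - r) * r ^ j)" unfolding Suc by (intro mult_left_mono cn) auto
      \<comment> \<open>Here \<open>k = j + 1\<close>, and powers of \<open>r\<close> decrease: the
        \<open>k\<close> copies of \<open>r ^ j\<close> are dominated term by term by the geometric
        sum.\<close>
      also have "\<dots> = (1 - r) * (\<Sum>i<k. r ^ j)" by simp
      also have "\<dots> \<le> (1 - r) * (\<Sum>i<k. r ^ i)" using r Suc by (intro mult_left_mono sum_mono power_decreasing) auto
      also have "\<dots> \<le> 1" by (rule geo)
      finally show ?thesis .
    qed simp
  qed
  moreover have "(\<lambda>k. c k * z ^ k) sums ((z - a) / (of_real r * z - a))" if z: "cmod z < 1" for z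
  proof -
    have "cmod (of_real r * b * z) = r * cmod b * cmod z" using r by (simp add: norm_mult)
    also have "\<dots> \<le> 1 * 1 * cmod z" using r b by (intro mult_right_mono mult_mono) auto
    finally have l1: "cmod (of_real r * b * z) < 1" using z by simp
    have n1: "1 - of_real r * b * z \<noteq> 0" using l1 by auto
    have "(\<lambda>j. of_real (r - 1) * b * z * (of_real r * b * z) ^ j) sums (of_real (r - 1) * b * z * (1 / (1 - of_real r * b * z)))"
      by (intro sums_mult geometric_sums l1)
    then have "(\<lambda>j. c (Suc j) * z ^ Suc j) sums (of_real (r - 1) * b * z * (1 / (1 - of_real r * b * z)))"
      by (simp add: c_def power_mult_distrib mult_ac)
    then have "(\<lambda>k. c k * z ^ k) sums (of_real (r - 1) * b * z * (1 / (1 - of_real r * b * z)) + c 0 * z ^ 0)"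
      by (subst (asm) sums_Suc_iff) simp
    moreover have "of_real (r - 1) * b * z * (1 / (1 - of_real r * b * z)) + c 0 * z ^ 0 = (z - a) / (of_real r * z - a)"
    proof -
      have "of_real r * z - a = - a * (1 - of_real r * b * z)" using a0 by (simp add: b_def field_simps)
      then have n2: "of_real r * z - a \<noteq> 0" using n1 a0 by simp
      have "of_real (r - 1) * b * z * (1 / (1 - of_real r * b * z)) + c 0 * z ^ 0
          = (1 - b * z) / (1 - of_real r * b * z)"
        using n1 by (simp add: c_def divide_simps) (simp add: algebra_simps)
      also have "\<dots> = (- a * (1 - b * z)) / (- a * (1 - of_real r * b * z))" using a0 by simp
      also have "- a * (1 - b * z) = z - a" using a0 by (simp add: b_def field_simps)
      also have "- a * (1 - of_real r * b * z) = of_real r * z - a" using a0 by (simp add: b_def field_simps)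
      finally show ?thesis .
    qed
    ultimately show ?thesis by simp
  qed
  ultimately show ?thesis using that by blast
qed

lemma poly_linear_factor:
  fixes P :: "complex poly"
  assumes "degree P = Suc n" and nz: "\<And>z. cmod z < 1 \<Longrightarrow> poly P z \<noteq> 0"
  obtains a Q where "P = [:- a, 1:] * Q" "degree Q = n" "1 \<le> cmod a" "\<And>z. cmod z < 1 \<Longrightarrow> poly Q z \<noteq> 0"
proof -
  have "\<not> constant (poly P)" using assms(1) by (simp add: constant_degree)
  then obtain a where a: "poly P a = 0" using fundamental_theorem_of_algebra by blast
  then obtain Q where Q: "P = [:- a, 1:] * Q" by (metis dvdE poly_eq_0_iff_dvd)
  have "Q \<noteq> 0" using Q assms(1) by auto
  then have "degree P = Suc (degree Q)" unfolding Q by (subst degree_mult_eq) auto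
  then show ?thesis using that[of a Q] Q assms a nz by (metis linorder_not_le mult_eq_0_iff nat.inject poly_mult)
qed

text \<open>Roots are split off one at a time, each contributing the pair (2, 1); the product rule
  for the two bounds yields constants that depend on the degree only.\<close>

lemma polynomial_quotient_wiener:
  fixes P :: "complex poly"
  assumes r: "0 < r" "r < 1"
  shows "degree P = n \<Longrightarrow> (\<And>z. cmod z < 1 \<Longrightarrow> poly P z \<noteq> 0) \<Longrightarrow>
    \<exists>c. wiener (2 ^ n) (real n * 2 ^ n) c \<and> (\<forall>z. cmod z < 1 \<longrightarrow> (\<lambda>k. c k * z ^ k) sums (poly P z / poly P (of_real r * z)))"
proof (induction n arbitrary: P)
  case 0
  then obtain a where P: "P = [:a:]" using degree_eq_zeroE by blast
  have a: "a \<noteq> 0" using 0(2)[of 0] by (simp add: P)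
  have 1: "(\<Sum>k<N. cmod (if k = 0 then 1 else 0)) \<le> 1" for N :: nat by (cases N) (simp_all add: sum.lessThan_Suc_shift del: sum.lessThan_Suc)
  have 2: "(\<lambda>k. (if k = 0 then 1 else 0) * z ^ k) sums 1" for z :: complex
    using sums_single[of 0 "\<lambda>k. z ^ k"] by (simp add: if_distrib[of "\<lambda>x. x * _"] cong: if_cong)
  show ?case using a 1 2 by (intro exI[of _ "\<lambda>k. if k = 0 then 1 else 0"]) (simp add: P wiener_def)
next
  case (Suc n)
  obtain a Q where aQ: "P = [:- a, 1:] * Q" "degree Q = n" "1 \<le> cmod a" "\<And>z. cmod z < 1 \<Longrightarrow> poly Q z \<noteq> 0"
    using poly_linear_factor[OF Suc.prems] by blast
  obtain d where d: "wiener (2 ^ n) (real n * 2 ^ n) d" "\<And>z. cmod z < 1 \<Longrightarrow> (\<lambda>k. d k * z ^ k) sums (poly Q z / poly Q (of_real r * z))"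
    using Suc.IH[OF aQ(2,4)] by blast
  obtain c where c: "wiener 2 1 c" "\<And>z. cmod z < 1 \<Longrightarrow> (\<lambda>k. c k * z ^ k) sums ((z - a) / (of_real r * z - a))"
    using linear_quotient_wiener[OF aQ(3) r] by blast
  have "wiener (2 ^ Suc n) (real (Suc n) * 2 ^ Suc n) (\<lambda>k. \<Sum>i\<le>k. c i * d (k - i))"
    by (rule wiener_mono[OF wiener_cauchy_product[OF c(1) d(1)]]) (simp_all add: algebra_simps)
  moreover have "(\<lambda>k. (\<Sum>i\<le>k. c i * d (k - i)) * z ^ k) sums (poly P z / poly P (of_real r * z))" if z: "cmod z < 1" for z
  proof -
    have ns: "summable (\<lambda>k. norm (e k * z ^ k))" if "wiener A B e" for A B e
    proof (rule summable_comparison_test'[OF wiener_summable[OF that]])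
      show "norm (norm (e k * z ^ k)) \<le> cmod (e k)" for k
        using z by (simp add: norm_mult norm_power mult_left_le power_le_one)
    qed
    have "(\<lambda>k. \<Sum>i\<le>k. (c i * z ^ i) * (d (k - i) * z ^ (k - i))) sums ((\<Sum>k. c k * z ^ k) * (\<Sum>k. d k * z ^ k))"
      by (rule Cauchy_product_sums[OF ns[OF c(1)] ns[OF d(1)]])
    moreover have "(\<Sum>i\<le>k. (c i * z ^ i) * (d (k - i) * z ^ (k - i))) = (\<Sum>i\<le>k. c i * d (k - i)) * z ^ k" for k
      unfolding sum_distrib_right
    proof (intro sum.cong refl)
      fix i assume "i \<in> {..k}"
      then have "z ^ k = z ^ i * z ^ (k - i)" by (simp flip: power_add)
      then show "(c i * z ^ i) * (d (k - i) * z ^ (k - i)) = c i * d (k - i) * z ^ k" by simp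
    qed
    moreover have "(\<Sum>k. c k * z ^ k) * (\<Sum>k. d k * z ^ k) = poly P z / poly P (of_real r * z)"
    proof -
      have "poly P w = (w - a) * poly Q w" for w by (simp add: aQ(1) algebra_simps)
      then show ?thesis unfolding sums_unique[OF c(2)[OF z], symmetric] sums_unique[OF d(2)[OF z], symmetric] by simp
    qed
    ultimately show ?thesis by simp
  qed
  ultimately show ?case by blast
qed

text \<open>The logarithmic derivative is the sum of \<open>1 / (z - a)\<close> over the roots, and
  each summand has coefficients \<open>- (1 / a) ^ Suc k\<close> of modulus at most 1.\<close>

lemma polynomial_logderiv_coeffs:
  fixes P :: "complex poly"
  shows "degree P = n \<Longrightarrow> (\<And>z. cmod z < 1 \<Longrightarrow> poly P z \<noteq> 0) \<Longrightarrow>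
    \<exists>c. (\<forall>k. cmod (c k) \<le> real n) \<and> (\<forall>z. cmod z < 1 \<longrightarrow> (\<lambda>k. c k * z ^ k) sums (poly (pderiv P) z / poly P z))"
proof (induction n arbitrary: P)
  case 0
  then obtain a where P: "P = [:a:]" using degree_eq_zeroE by blast
  show ?case by (intro exI[of _ "\<lambda>k. 0"]) (simp add: P pderiv_pCons)
next
  case (Suc n)
  obtain a Q where aQ: "P = [:- a, 1:] * Q" "degree Q = n" "1 \<le> cmod a" "\<And>z. cmod z < 1 \<Longrightarrow> poly Q z \<noteq> 0"
    using poly_linear_factor[OF Suc.prems] by blast
  obtain d where d: "\<And>k. cmod (d k) \<le> real n" "\<And>z. cmod z < 1 \<Longrightarrow> (\<lambda>k. d k * z ^ k) sums (poly (pderiv Q) z / poly Q z)"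
    using Suc.IH[OF aQ(2,4)] by blast
  have a0: "a \<noteq> 0" using aQ by auto
  define c where "c k = - ((1 / a) ^ Suc k)" for k
  have c1: "cmod (c k) \<le> 1" for k
    using aQ(3) unfolding c_def norm_minus_cancel norm_power by (intro power_le_one) (auto simp: norm_divide divide_le_eq)
  show ?case
  proof (intro exI[of _ "\<lambda>k. c k + d k"] conjI allI impI)
    fix k show "cmod (c k + d k) \<le> real (Suc n)" using norm_triangle_le[OF add_mono[OF c1[of k] d(1)[of k]]] by simp
  next
    fix z :: complex assume z: "cmod z < 1"
    have l1: "cmod (z / a) < 1" using z aQ(3) a0 by (simp add: norm_divide divide_less_eq)
    have za: "z - a \<noteq> 0" using z aQ(3) by auto
    have "(\<lambda>k. - (1 / a) * (z / a) ^ k) sums (- (1 / a) * (1 / (1 - z / a)))"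
      by (intro sums_mult geometric_sums l1)
    moreover have "- (1 / a) * (1 / (1 - z / a)) = 1 / (z - a)" using a0 za by (simp add: divide_simps)
    ultimately have "(\<lambda>k. c k * z ^ k) sums (1 / (z - a))" by (simp add: c_def power_divide mult_ac)
    from sums_add[OF this d(2)[OF z]]
    have "(\<lambda>k. (c k + d k) * z ^ k) sums (1 / (z - a) + poly (pderiv Q) z / poly Q z)" by (simp add: distrib_right)
    moreover have "1 / (z - a) + poly (pderiv Q) z / poly Q z = poly (pderiv P) z / poly P z"
    proof -
      have P: "poly P z = (z - a) * poly Q z" "poly (pderiv P) z = poly Q z + (z - a) * poly (pderiv Q) z"
        unfolding aQ(1) pderiv_mult by (simp_all add: pderiv_pCons algebra_simps)
      show ?thesis unfolding P using za aQ(4)[OF z] by (subst add_frac_eq) (simp_all add: mult.commute)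
    qed
    ultimately show "(\<lambda>k. (c k + d k) * z ^ k) sums (poly (pderiv P) z / poly P z)" by simp
  qed
qed

section \<open>Weights\<close>

lemma summable_powr_geometric:
  fixes q \<beta> :: real
  assumes q: "0 < q" "q < 1"
  shows "summable (\<lambda>k. (real k + 1) powr \<beta> * q ^ k)"
proof -
  \<comment> \<open>The ratio of consecutive powers is eventually below \<open>1 / s\<close>, so the
    ratio of consecutive terms is below \<open>q / s = s\<close>.\<close>
  define s where "s = sqrt q"
  have s: "0 < s" "s < 1" "s * s = q" using q by (auto simp: s_def)
  have "(\<lambda>k. (1 + 1 / real (Suc k)) powr \<bar>\<beta>\<bar>) \<longlonglongrightarrow> (1 + 0) powr \<bar>\<beta>\<bar>"
    by (intro tendsto_intros lim_inverse_n'[THEN LIMSEQ_Suc]) auto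
  then have "\<forall>\<^sub>F k in sequentially. (1 + 1 / real (Suc k)) powr \<bar>\<beta>\<bar> < 1 / s"
    by (rule order_tendstoD) (use s in simp)
  then obtain N where N: "\<And>k. k \<ge> N \<Longrightarrow> (1 + 1 / real (Suc k)) powr \<bar>\<beta>\<bar> < 1 / s"
    by (auto simp: eventually_sequentially)
  show ?thesis
  proof (rule summable_ratio_test[of s N])
    fix k assume k: "N \<le> k"
    have "(1 + 1 / real (Suc k)) * (real k + 1) = real (Suc k) + 1" by (simp add: field_simps)
    then have "(real (Suc k) + 1) powr \<beta> = ((1 + 1 / real (Suc k)) * (real k + 1)) powr \<beta>" by (simp only:)
    also have "\<dots> = (1 + 1 / real (Suc k)) powr \<beta> * (real k + 1) powr \<beta>"
      by (rule powr_mult)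
    also have "\<dots> \<le> (1 / s) * (real k + 1) powr \<beta>"
    proof (rule mult_right_mono)
      have "(1 + 1 / real (Suc k)) powr \<beta> \<le> (1 + 1 / real (Suc k)) powr \<bar>\<beta>\<bar>" by (intro powr_mono) auto
      then show "(1 + 1 / real (Suc k)) powr \<beta> \<le> 1 / s" using N[OF k] by linarith
    qed simp
    finally have "(real (Suc k) + 1) powr \<beta> * q ^ Suc k \<le> (1 / s) * (real k + 1) powr \<beta> * q ^ Suc k"
      using q by (intro mult_right_mono) auto
    also have "\<dots> = s * ((real k + 1) powr \<beta> * q ^ k)" using s by (simp add: field_simps flip: s(3))
    finally show "norm ((real (Suc k) + 1) powr \<beta> * q ^ Suc k) \<le> s * norm ((real k + 1) powr \<beta> * q ^ k)"
      using q by simp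
  qed (use s in simp)
qed

lemma sqle_geometric:
  assumes q: "0 < q" "q < 1"
  obtains D where "\<And>x C. (\<And>k l. cmod (x (k, l)) \<le> C * q ^ k * q ^ l) \<Longrightarrow> sqle (wt \<beta>1 \<beta>2) x (C\<^sup>2 * D)"
proof -
  define g where "g = (\<lambda>(k, l). ((real k + 1) powr \<beta>1 * (q\<^sup>2) ^ k) * ((real l + 1) powr \<beta>2 * (q\<^sup>2) ^ l))"
  have q2: "0 < q\<^sup>2" "q\<^sup>2 < 1" using q mult_strict_mono[of q 1 q 1] by (auto simp: power2_eq_square)
  have s: "g summable_on UNIV" unfolding g_def
    by (intro summable_on_product summable_nonneg_imp_summable_on summable_powr_geometric q2) (use q in auto)
  show ?thesis
  proof (rule that[of "infsum g UNIV"])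
    fix x C assume x: "\<And>k l. cmod (x (k, l)) \<le> C * q ^ k * q ^ l"
    have t: "wt \<beta>1 \<beta>2 i * (cmod (x i))\<^sup>2 \<le> C\<^sup>2 * g i" for i
    proof (cases i)
      case (Pair k l)
      have "(cmod (x (k, l)))\<^sup>2 \<le> (C * q ^ k * q ^ l)\<^sup>2" by (intro power_mono x) auto
      then have "wt \<beta>1 \<beta>2 i * (cmod (x i))\<^sup>2 \<le> wt \<beta>1 \<beta>2 (k, l) * (C * q ^ k * q ^ l)\<^sup>2"
        unfolding Pair by (intro mult_left_mono wt_nonneg)
      also have "\<dots> = C\<^sup>2 * g i"
        by (simp add: Pair g_def wt_def power_mult_distrib mult_ac flip: power_mult)
      finally show ?thesis .
    qed
    show "sqle (wt \<beta>1 \<beta>2) x (C\<^sup>2 * infsum g UNIV)"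
      by (rule sqle_comparison[OF t s]) (use q in \<open>auto simp: g_def\<close>)
  qed
qed

lemma exp_decay_l2:
  assumes R: "R > 1" and x: "\<And>k l. cmod (x (k, l)) * R ^ k * R ^ l \<le> M"
  shows "\<exists>C. sqle (wt \<alpha>1 \<alpha>2) x C"
proof -
  have "0 < 1 / R" "1 / R < 1" using R by auto
  from sqle_geometric[OF this] obtain D where
    D: "\<And>x C. (\<And>k l. cmod (x (k, l)) \<le> C * (1 / R) ^ k * (1 / R) ^ l) \<Longrightarrow> sqle (wt \<alpha>1 \<alpha>2) x (C\<^sup>2 * D)"
    by blast
  have "cmod (x (k, l)) \<le> M * (1 / R) ^ k * (1 / R) ^ l" for k l
    using x[of k l] R by (simp add: power_divide field_simps)
  from D[OF this] show ?thesis by blast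
qed

lemma powr_ratio_le:
  fixes k l M :: nat
  assumes "l + 1 \<le> M * (k + 1)" "k + 1 \<le> M * (l + 1)"
  shows "(real l + 1) powr \<beta> \<le> real M powr \<bar>\<beta>\<bar> * (real k + 1) powr \<beta>"
proof -
  have M: "M \<ge> 1" using assms by (cases M) auto
  have 1: "real l + 1 \<le> real M * (real k + 1)" "real k + 1 \<le> real M * (real l + 1)"
    using assms by (metis of_nat_1 of_nat_add of_nat_mono of_nat_mult)+
  show ?thesis
  proof (cases "\<beta> \<ge> 0")
    case True
    have "(real l + 1) powr \<beta> \<le> (real M * (real k + 1)) powr \<beta>" using True 1 by (intro powr_mono2) auto
    then show ?thesis using True by (simp add: powr_mult)
  next
    case False
    have "(real l + 1) powr \<beta> \<le> ((real k + 1) / real M) powr \<beta>"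
      using False 1 M by (intro powr_mono2') (auto simp: field_simps)
    also have "\<dots> = (real k + 1) powr \<beta> / real M powr \<beta>" by (simp add: powr_divide)
    also have "\<dots> = real M powr \<bar>\<beta>\<bar> * (real k + 1) powr \<beta>" using False by (simp add: powr_minus field_simps)
    finally show ?thesis .
  qed
qed

text \<open>Off the cone where \<open>k\<close> and \<open>l\<close> are comparable the two hypotheses force exponential decay;
  on the cone the weight \<open>(k + 1) powr \<beta>1 * (l + 1) powr \<beta>2\<close> is comparable to \<open>(k + 1) powr (\<beta>1 + \<beta>2)\<close>.\<close>

lemma sqle_cone:
  assumes s: "0 < s" and R: "1 < R"
  obtains K D where "K \<ge> 0"
    "\<And>x C E. (\<And>k l. cmod (x (k, l)) * s ^ k * R ^ l \<le> C) \<Longrightarrow> (\<And>k l. cmod (x (k, l)) * R ^ k * s ^ l \<le> C) \<Longrightarrow>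
      sqle (\<lambda>(k, l). (real k + 1) powr (\<beta>1 + \<beta>2)) x E \<Longrightarrow> sqle (wt \<beta>1 \<beta>2) x (K * E + C\<^sup>2 * D)"
proof -
  \<comment> \<open>\<open>R ^ l\<close> is \<open>Q ^ l\<close> twice: if
    \<open>M * k \<le> l\<close>, one copy pays for a small \<open>s ^ k\<close>, and the other is
    \<open>r ^ l * r ^ l\<close>, which leaves decay in both indices.\<close>
  define Q where "Q = sqrt R"
  have Q: "Q > 1" "Q * Q = R" using R by (auto simp: Q_def)
  define r where "r = sqrt Q"
  have r: "r > 1" "r * r = Q" using Q by (auto simp: r_def)
  obtain M0 where M0: "1 / s < Q ^ M0" using real_arch_pow[OF Q(1)] by blast
  define M where "M = Suc M0"
  have "Q ^ M0 \<le> Q ^ M" using Q by (intro power_increasing) (auto simp: M_def)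
  then have "1 / s < Q ^ M" using M0 by linarith
  then have M: "1 \<le> s * Q ^ M" "M \<ge> 1" using s by (auto simp: field_simps M_def)
  have far: "r ^ k * r ^ l \<le> s ^ k * R ^ l" if kl: "M * k \<le> l" for k l
  proof -
    have kl': "k \<le> l" using kl M(2) by (metis dual_order.trans mult.commute mult_le_mono1 nat_mult_1)
    have "r ^ k * r ^ l \<le> r ^ l * r ^ l" using r kl' by (intro mult_right_mono power_increasing) auto
    also have "\<dots> = Q ^ l" by (simp add: r(2)[symmetric] power_mult_distrib)
    also have "\<dots> \<le> (s * Q ^ M) ^ k * Q ^ l"
      using mult_right_mono[OF one_le_power[OF M(1), of k], of "Q ^ l"] Q(1) by simp
    also have "\<dots> = s ^ k * (Q ^ (M * k) * Q ^ l)" by (simp add: power_mult_distrib power_mult)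
    also have "\<dots> \<le> s ^ k * (Q ^ l * Q ^ l)" using kl Q s by (intro mult_left_mono mult_right_mono power_increasing) auto
    also have "\<dots> = s ^ k * R ^ l" by (simp add: Q(2)[symmetric] power_mult_distrib)
    finally show ?thesis .
  qed
  have "0 < 1 / r" "1 / r < 1" using r by auto
  from sqle_geometric[OF this] obtain D where
    D: "\<And>x C. (\<And>k l. cmod (x (k, l)) \<le> C * (1 / r) ^ k * (1 / r) ^ l) \<Longrightarrow> sqle (wt \<beta>1 \<beta>2) x (C\<^sup>2 * D)"
    by blast
  show ?thesis
  proof (rule that[of "real M powr \<bar>\<beta>2\<bar>" D])
    fix x C E
    assume x1: "\<And>k l. cmod (x (k, l)) * s ^ k * R ^ l \<le> C"
      and x2: "\<And>k l. cmod (x (k, l)) * R ^ k * s ^ l \<le> C"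
      and E: "sqle (\<lambda>(k, l). (real k + 1) powr (\<beta>1 + \<beta>2)) x E"
    have "cmod (x (0, 0)) \<le> C" using x1[of 0 0] by simp
    then have C: "C \<ge> 0" using norm_ge_zero order_trans by blast
    \<comment> \<open>The part of \<open>x\<close> off the cone, where one of the two hypotheses
      gives exponential decay.\<close>
    define y where "y = (\<lambda>(k, l). if M * k \<le> l \<or> M * l \<le> k then x (k, l) else 0)"
    have "cmod (y (k, l)) * (r ^ k * r ^ l) \<le> C" for k l
    proof -
      consider "M * k \<le> l" | "M * l \<le> k" | "\<not> M * k \<le> l" "\<not> M * l \<le> k" by blast
      then show ?thesis
      proof cases
        case 1
        have "cmod (y (k, l)) * (r ^ k * r ^ l) \<le> cmod (x (k, l)) * (s ^ k * R ^ l)"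
          using 1 far[OF 1] by (auto simp: y_def intro: mult_left_mono)
        then show ?thesis using x1[of k l] by (simp add: mult_ac)
      next
        case 2
        have "cmod (y (k, l)) * (r ^ k * r ^ l) \<le> cmod (x (k, l)) * (s ^ l * R ^ k)"
          using 2 far[OF 2] by (auto simp: y_def mult.commute intro: mult_left_mono)
        then show ?thesis using x2[of k l] by (simp add: mult_ac)
      qed (use C in \<open>auto simp: y_def\<close>)
    qed
    then have "cmod (y (k, l)) \<le> C * (1 / r) ^ k * (1 / r) ^ l" for k l
      using r by (simp add: power_divide field_simps)
    from D[OF this] have y: "sqle (wt \<beta>1 \<beta>2) y (C\<^sup>2 * D)" .
    have pt: "wt \<beta>1 \<beta>2 i * (cmod (x i))\<^sup>2 \<le> real M powr \<bar>\<beta>2\<bar> * ((case i of (k, l) \<Rightarrow> (real k + 1) powr (\<beta>1 + \<beta>2)) * (cmod (x i))\<^sup>2) + wt \<beta>1 \<beta>2 i * (cmod (y i))\<^sup>2" for i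
    proof (cases i)
      case (Pair k l)
      show ?thesis
      proof (cases "M * k \<le> l \<or> M * l \<le> k")
        case True
        then show ?thesis by (auto simp: Pair y_def)
      next
        case False
        have "l + 1 \<le> M * (k + 1)" "k + 1 \<le> M * (l + 1)" using False M(2) by (auto simp: algebra_simps)
        from powr_ratio_le[OF this, of \<beta>2]
        have "(real k + 1) powr \<beta>1 * (real l + 1) powr \<beta>2 \<le> (real k + 1) powr \<beta>1 * (real M powr \<bar>\<beta>2\<bar> * (real k + 1) powr \<beta>2)"
          by (intro mult_left_mono) auto
        also have "\<dots> = real M powr \<bar>\<beta>2\<bar> * (real k + 1) powr (\<beta>1 + \<beta>2)" by (simp add: powr_add mult_ac)
        finally have "wt \<beta>1 \<beta>2 (k, l) * (cmod (x i))\<^sup>2 \<le> (real M powr \<bar>\<beta>2\<bar> * (real k + 1) powr (\<beta>1 + \<beta>2)) * (cmod (x i))\<^sup>2"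
          unfolding wt_def prod.case by (intro mult_right_mono) auto
        then show ?thesis using False by (simp add: Pair y_def mult_ac)
      qed
    qed
    show "sqle (wt \<beta>1 \<beta>2) x (real M powr \<bar>\<beta>2\<bar> * E + C\<^sup>2 * D)"
      unfolding sqle_def
    proof (intro allI impI)
      fix F :: "(nat \<times> nat) set" assume F: "finite F"
      have "(\<Sum>i\<in>F. wt \<beta>1 \<beta>2 i * (cmod (x i))\<^sup>2) \<le> real M powr \<bar>\<beta>2\<bar> * (\<Sum>i\<in>F. (case i of (k, l) \<Rightarrow> (real k + 1) powr (\<beta>1 + \<beta>2)) * (cmod (x i))\<^sup>2) + (\<Sum>i\<in>F. wt \<beta>1 \<beta>2 i * (cmod (y i))\<^sup>2)"
        unfolding sum_distrib_left sum.distrib[symmetric] by (intro sum_mono pt)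
      also have "\<dots> \<le> real M powr \<bar>\<beta>2\<bar> * E + C\<^sup>2 * D"
        by (intro add_mono mult_left_mono sqleD[OF E F] sqleD[OF y F]) auto
      finally show "(\<Sum>i\<in>F. wt \<beta>1 \<beta>2 i * (cmod (x i))\<^sup>2) \<le> real M powr \<bar>\<beta>2\<bar> * E + C\<^sup>2 * D" .
    qed
  qed simp
qed

lemma sqle_weight_mono:
  assumes "sqle w x C" "\<And>i. v i \<le> w i"
  shows "sqle v x C"
  unfolding sqle_def
proof (intro allI impI)
  fix F :: "'a set" assume F: "finite F"
  have "(\<Sum>i\<in>F. v i * (cmod (x i))\<^sup>2) \<le> (\<Sum>i\<in>F. w i * (cmod (x i))\<^sup>2)"
    by (intro sum_mono mult_right_mono assms) auto
  then show "(\<Sum>i\<in>F. v i * (cmod (x i))\<^sup>2) \<le> C" using sqleD[OF assms(1) F] by linarith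
qed

section \<open>Division by a dilate\<close>

lemma LIMSEQ_one_minus_inverse: "(\<lambda>n. 1 - 1 / (real n + 2)) \<longlonglongrightarrow> 1"
proof -
  have "(\<lambda>n. 1 - 1 / real (n + 2)) \<longlonglongrightarrow> 1 - 0"
    by (intro tendsto_intros LIMSEQ_ignore_initial_segment lim_inverse_n')
  then show ?thesis by (simp add: add.commute)
qed

text \<open>Dilation in \<open>z1\<close> alone keeps \<open>z2\<close> a mere parameter, so slices
  of the quotient fall under \<open>polynomial_quotient_wiener\<close>.\<close>

definition dil :: "real \<Rightarrow> complex poly poly \<Rightarrow> complex poly poly" where
  "dil r P = mkp (\<lambda>(k, l). of_real r ^ k * pc P (k, l)) {i. pc P i \<noteq> 0}"

lemma eval2_dil: "eval2 (dil r P) (z1, z2) = eval2 P (of_real r * z1, z2)"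
  by (simp add: dil_def eval2_mkp eval2_expand[OF finite_pc order_refl, of P] power_mult_distrib mult_ac)

text \<open>Makes the slice constants uniform in \<open>z2\<close>, although the degree of a slice
  may drop.\<close>

lemma poly_const_degree_bound: "\<exists>n. \<forall>c. degree (poly P [:c:]) \<le> n" for P :: "complex poly poly"
proof -
  define n where "n = (\<Sum>l\<le>degree P. degree (coeff P l))"
  have "degree (poly P [:c:]) \<le> n" for c
    unfolding poly_altdef
  proof (rule degree_sum_le)
    fix l assume l: "l \<in> {..degree P}"
    have "degree (coeff P l * [:c:] ^ l) \<le> degree (coeff P l) + degree ([:c:] ^ l)" by (rule degree_mult_le)
    also have "degree ([:c:] ^ l) = 0" using degree_power_le[of "[:c:]" l] by simp
    also have "degree (coeff P l) + 0 \<le> n" using member_le_sum[of l "{..degree P}" "\<lambda>l. degree (coeff P l)"] l unfolding n_def by simp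
    finally show "degree (coeff P l * [:c:] ^ l) \<le> n" .
  qed simp
  then show ?thesis by blast
qed

lemma eval2_poly_const: "eval2 P (z1, z2) = poly (poly P [:z2:]) z1"
  by (simp add: eval2_def)

text \<open>For each \<open>z2\<close> the slice coefficients agree with those of a one-variable
  quotient; the Wiener bounds are uniform in \<open>z2\<close> and \<open>r\<close>, and
  \<open>sqle_by_slices\<close> assembles them.\<close>

lemma dilate_quotient_bound:
  assumes nz: "\<And>z1 z2. cmod z1 < 1 \<Longrightarrow> cmod z2 < 1 \<Longrightarrow> eval2 P (z1, z2) \<noteq> 0"
  obtains C where "\<And>r y. 0 < r \<Longrightarrow> r < 1 \<Longrightarrow> ps (\<lambda>z. eval2 P z / eval2 (dil r P) z) y \<Longrightarrow>
      sqle (\<lambda>(k, l). real k + 1) y C"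
proof -
  obtain n where n: "\<And>c. degree (poly P [:c:]) \<le> n" using poly_const_degree_bound by blast
  define A :: real where "A = 2 ^ n"
  define B :: real where "B = real n * 2 ^ n"
  show ?thesis
  proof (rule that[of "(A + B) * A"])
    fix r y assume r: "0 < r" "r < 1" and y: "ps (\<lambda>z. eval2 P z / eval2 (dil r P) z) y"
    define c where "c k z2 = (\<Sum>\<^sub>\<infinity>l. y (k, l) * z2 ^ l)" for k z2
    show "sqle (\<lambda>(k, l). real k + 1) y ((A + B) * A)"
    proof (rule sqle_by_slices)
      show "((\<lambda>l. y (k, l) * z ^ l) has_sum c k z) UNIV" if "cmod z < 1" for k z
        unfolding c_def by (rule ps_slice(1)[OF y that])
      fix K and z2 :: complex assume z2: "cmod z2 < 1"
      have nz': "poly (poly P [:z2:]) z \<noteq> 0" if "cmod z < 1" for z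
        using nz[OF that z2] by (simp add: eval2_poly_const)
      obtain d where d: "wiener (2 ^ degree (poly P [:z2:])) (real (degree (poly P [:z2:])) * 2 ^ degree (poly P [:z2:])) d"
        "\<And>z. cmod z < 1 \<Longrightarrow> (\<lambda>k. d k * z ^ k) sums (poly (poly P [:z2:]) z / poly (poly P [:z2:]) (of_real r * z))"
        using polynomial_quotient_wiener[OF r refl nz'] by blast
      have "d = (\<lambda>k. c k z2)"
      proof (rule sums_powser_unique[OF d(2)])
        fix z :: complex assume z: "cmod z < 1"
        show "((\<lambda>k. c k z2 * z ^ k) has_sum poly (poly P [:z2:]) z / poly (poly P [:z2:]) (of_real r * z)) UNIV"
          using ps_slice(2)[OF y z2 z] by (simp add: c_def eval2_dil) (simp add: eval2_poly_const)
      qed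
      moreover have "wiener A B d"
        using n[of z2] by (intro wiener_mono[OF d(1)]) (auto simp: A_def B_def intro!: mult_mono power_increasing)
      ultimately show "(\<Sum>k<K. (real k + 1) * (cmod (c k z2))\<^sup>2) \<le> (A + B) * A"
        using wiener_sum_sq[of A B d K] by simp
    qed simp
  qed
qed

text \<open>The reciprocal extends to a larger polydisc, so its coefficients decay exponentially and
  beat every weight.\<close>

lemma reciprocal_l2:
  assumes nz: "\<And>z1 z2. cmod z1 \<le> 1 \<Longrightarrow> cmod z2 \<le> 1 \<Longrightarrow> eval2 P (z1, z2) \<noteq> 0"
  shows "\<exists>g G. ps (\<lambda>z. 1 / eval2 P z) g \<and> sqle (wt \<alpha>1 \<alpha>2) g G"
proof -
  from polydisc_lower_bound[OF continuous_on_eval2 zero_le_one zero_le_one nz] obtain \<delta> c where dc: "\<delta> > 0" "c > 0"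
    "\<And>z1 z2. cmod z1 < 1 + \<delta> \<Longrightarrow> cmod z2 < 1 + \<delta> \<Longrightarrow> c \<le> cmod (eval2 P (z1, z2))" by auto
  have pos: "0 < 1 + \<delta>" using dc by simp
  have "bihol (\<lambda>z. eval2 1 z / eval2 P z) (1 + \<delta>) (1 + \<delta>)"
    using dc by (intro bihol_rational) fastforce
  then show ?thesis
  proof (rule bihol_ps[OF _ pos pos])
    fix g assume g: "ps_on (1 + \<delta>) (1 + \<delta>) (\<lambda>z. eval2 1 z / eval2 P z) g"
      and b: "\<And>M k l. (\<And>z1 z2. cmod z1 < 1 + \<delta> \<Longrightarrow> cmod z2 < 1 + \<delta> \<Longrightarrow> cmod (eval2 1 (z1, z2) / eval2 P (z1, z2)) \<le> M)
        \<Longrightarrow> cmod (g (k, l)) * (1 + \<delta>) ^ k * (1 + \<delta>) ^ l \<le> M"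
    have "cmod (g (k, l)) * (1 + \<delta>) ^ k * (1 + \<delta>) ^ l \<le> 1 / c" for k l
    proof (rule b)
      fix z1 z2 :: complex assume "cmod z1 < 1 + \<delta>" "cmod z2 < 1 + \<delta>"
      from dc(3)[OF this] dc(2) show "cmod (eval2 1 (z1, z2) / eval2 P (z1, z2)) \<le> 1 / c"
        by (simp add: eval2_1 norm_divide frac_le)
    qed
    then have "\<exists>G. sqle (wt \<alpha>1 \<alpha>2) g G" using exp_decay_l2[of "1 + \<delta>" g "1 / c"] dc by auto
    moreover have "ps (\<lambda>z. 1 / eval2 P z) g"
      using ps_on_mono[OF g, of 1 1] dc by (simp add: eval2_1)
    ultimately show ?thesis by blast
  qed
qed

text \<open>Each quotient is \<open>P\<close> times the reciprocal of a dilate, an element of the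
  space because \<open>nz\<close> includes \<open>cmod z2 = 1\<close> and dilation takes care of
  \<open>z1\<close>. The quotients thus lie in the subspace, are bounded by \<open>C\<close>, and
  tend to 1 coefficientwise.\<close>

lemma dilation_approximation:
  assumes nz: "\<And>z1 z2. cmod z1 < 1 \<Longrightarrow> cmod z2 \<le> 1 \<Longrightarrow> eval2 P (z1, z2) \<noteq> 0"
    and C: "\<And>r y. 0 < r \<Longrightarrow> r < 1 \<Longrightarrow> ps (\<lambda>z. eval2 P z / eval2 (dil r P) z) y \<Longrightarrow> sqle (wt \<alpha>1 \<alpha>2) y C"
    and P: "pc P \<in> inv_closure \<alpha>1 \<alpha>2 p"
  shows "pc 1 \<in> inv_closure \<alpha>1 \<alpha>2 p"
proof -
  have ex: "\<exists>y. y \<in> inv_closure \<alpha>1 \<alpha>2 p \<and> ps (\<lambda>z. eval2 P z / eval2 (dil r P) z) y" if r: "0 < r" "r < 1" for r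
  proof -
    have "eval2 (dil r P) (z1, z2) \<noteq> 0" if "cmod z1 \<le> 1" "cmod z2 \<le> 1" for z1 z2
    proof -
      have "cmod (of_real r * z1) \<le> r * 1" unfolding norm_mult using r that by (intro mult_mono) auto
      then show ?thesis unfolding eval2_dil using r that by (intro nz) auto
    qed
    then obtain g G where g: "ps (\<lambda>z. 1 / eval2 (dil r P) z) g" and G: "sqle (wt \<alpha>1 \<alpha>2) g G"
      using reciprocal_l2[of "dil r P"] by blast
    have "mul P g \<in> inv_closure \<alpha>1 \<alpha>2 p" by (rule inv_closure_mul_l2[OF P G])
    moreover have "ps (\<lambda>z. eval2 P z / eval2 (dil r P) z) (mul P g)"
      using ps_on_mul[OF g, of P] by simp
    ultimately show ?thesis by blast
  qed
  define r where "r n = 1 - 1 / (real n + 2)" for n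
  have r: "0 < r n" "r n < 1" for n by (auto simp: r_def field_simps)
  have rlim: "r \<longlonglongrightarrow> 1" unfolding r_def[abs_def] by (rule LIMSEQ_one_minus_inverse)
  obtain y where y: "\<And>n. y n \<in> inv_closure \<alpha>1 \<alpha>2 p" "\<And>n. ps (\<lambda>z. eval2 P z / eval2 (dil (r n) P) z) (y n)"
    using ex[OF r] by metis
  have lim: "(\<lambda>n. y n i) \<longlonglongrightarrow> pc 1 i" for i
  proof -
    obtain k l where i: "i = (k, l)" by force
    \<comment> \<open>For a single coefficient, Cauchy estimates on the bidisk of radius 1/2
      suffice, and there \<open>P\<close> and its dilates share a lower bound.\<close>
    have "eval2 P (z1, z2) \<noteq> 0" if "cmod z1 \<le> 1/2" "cmod z2 \<le> 1/2" for z1 z2 using that by (intro nz) auto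
    from polydisc_lower_bound[OF continuous_on_eval2 _ _ this, of "1/2" "1/2"] obtain \<delta> c where dc: "\<delta> > 0" "c > 0"
      "\<And>z1 z2. cmod z1 < 1/2 + \<delta> \<Longrightarrow> cmod z2 < 1/2 + \<delta> \<Longrightarrow> c \<le> cmod (eval2 P (z1, z2))"
      by auto
    \<comment> \<open>Bounds the difference of \<open>P\<close> and its dilate on the whole unit
      bidisk.\<close>
    define e where "e n = (\<Sum>(k, l)\<in>{i. pc P i \<noteq> 0}. cmod (pc P (k, l)) * (1 - r n ^ k))" for n
    have elim: "(\<lambda>n. e n) \<longlonglongrightarrow> (\<Sum>(k, l)\<in>{i. pc P i \<noteq> 0}. cmod (pc P (k, l)) * (1 - 1 ^ k))"
      unfolding e_def case_prod_unfold by (intro tendsto_intros rlim)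
    have e: "cmod (eval2 P (z1, z2) - eval2 (dil (r n) P) (z1, z2)) \<le> e n" if z: "cmod z1 < 1" "cmod z2 < 1" for z1 z2 n
    proof -
      have "eval2 P (z1, z2) - eval2 (dil (r n) P) (z1, z2)
          = (\<Sum>(k, l)\<in>{i. pc P i \<noteq> 0}. pc P (k, l) * of_real (1 - r n ^ k) * (z1 ^ k * z2 ^ l))"
        unfolding eval2_dil eval2_expand[OF finite_pc order_refl, of P] sum_subtractf[symmetric]
        by (intro sum.cong) (auto simp: power_mult_distrib algebra_simps)
      also have "cmod \<dots> \<le> (\<Sum>(k, l)\<in>{i. pc P i \<noteq> 0}. cmod (pc P (k, l) * of_real (1 - r n ^ k) * (z1 ^ k * z2 ^ l)))"
        unfolding case_prod_unfold by (rule norm_sum)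
      also have "\<dots> \<le> e n"
        unfolding e_def case_prod_unfold
      proof (intro sum_mono)
        fix i :: "nat \<times> nat"
        have rk: "0 \<le> 1 - r n ^ fst i" using r[of n] by (simp add: power_le_one less_imp_le)
        have zz: "cmod (z1 ^ fst i * z2 ^ snd i) \<le> 1"
          unfolding norm_mult norm_power using z by (intro mult_le_one power_le_one) auto
        have "cmod (pc P (fst i, snd i) * of_real (1 - r n ^ fst i) * (z1 ^ fst i * z2 ^ snd i))
            = cmod (pc P (fst i, snd i)) * (1 - r n ^ fst i) * cmod (z1 ^ fst i * z2 ^ snd i)"
          using rk by (simp only: norm_mult norm_of_real abs_of_nonneg)
        also have "\<dots> \<le> cmod (pc P (fst i, snd i)) * (1 - r n ^ fst i)"
          using rk zz by (intro mult_left_le) auto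
        finally show "cmod (pc P (fst i, snd i) * of_real (1 - r n ^ fst i) * (z1 ^ fst i * z2 ^ snd i)) \<le> cmod (pc P (fst i, snd i)) * (1 - r n ^ fst i)" .
      qed
      finally show ?thesis .
    qed
    have bound: "cmod (y n i - pc 1 i) \<le> e n / c / (1/2) ^ k / (1/2) ^ l" for n
    proof -
      have lb: "c \<le> cmod (eval2 (dil (r n) P) (z1, z2))" if "cmod z1 < 1/2" "cmod z2 < 1/2" for z1 z2
      proof -
        have "cmod (of_real (r n) * z1) \<le> 1 * cmod z1" unfolding norm_mult using r[of n] by (intro mult_right_mono) auto
        then show ?thesis unfolding eval2_dil using that dc(1) by (intro dc(3)) auto
      qed
      have "cmod ((\<lambda>i. y n i - pc 1 i) (k, l)) * (1/2) ^ k * (1/2) ^ l \<le> e n / c"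
      proof (rule ps_coeff_bound[where f = "\<lambda>z. eval2 (P - dil (r n) P) z / eval2 (dil (r n) P) z"])
        have "ps (\<lambda>z. eval2 P z / eval2 (dil (r n) P) z - eval2 1 z) (\<lambda>i. y n i - pc 1 i)"
          by (intro ps_on_diff y ps_on_eval2)
        moreover have "eval2 P (z1, z2) / eval2 (dil (r n) P) (z1, z2) - eval2 1 (z1, z2) = eval2 (P - dil (r n) P) (z1, z2) / eval2 (dil (r n) P) (z1, z2)"
          if "cmod z1 < 1" "cmod z2 < 1" for z1 z2
        proof -
          have "cmod (of_real (r n) * z1) \<le> 1 * cmod z1" unfolding norm_mult using r[of n] by (intro mult_right_mono) auto
          then have "eval2 (dil (r n) P) (z1, z2) \<noteq> 0" unfolding eval2_dil using that by (intro nz) auto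
          then show ?thesis by (simp add: eval2_1 eval2_diff diff_divide_distrib)
        qed
        ultimately show "ps (\<lambda>z. eval2 (P - dil (r n) P) z / eval2 (dil (r n) P) z) (\<lambda>i. y n i - pc 1 i)"
          by (subst ps_on_cong[of 1 1 _ "\<lambda>z. eval2 P z / eval2 (dil (r n) P) z - eval2 1 z"]) simp_all
        show "bihol (\<lambda>z. eval2 (P - dil (r n) P) z / eval2 (dil (r n) P) z) (1/2) (1/2)"
          using lb dc(2) by (intro bihol_rational) fastforce
        fix z1 z2 :: complex assume z: "cmod z1 < 1/2" "cmod z2 < 1/2"
        show "cmod (eval2 (P - dil (r n) P) (z1, z2) / eval2 (dil (r n) P) (z1, z2)) \<le> e n / c"
          unfolding norm_divide eval2_diff
        proof (rule frac_le)
          show "cmod (eval2 P (z1, z2) - eval2 (dil (r n) P) (z1, z2)) \<le> e n" using z by (intro e) auto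
          then show "0 \<le> e n" by (meson norm_ge_zero order_trans)
        qed (use dc(2) lb[OF z] in auto)
      qed auto
      then show ?thesis by (simp add: i field_simps)
    qed
    have "(\<lambda>n. e n / c / (1/2) ^ k / (1/2) ^ l) \<longlonglongrightarrow> (\<Sum>(k, l)\<in>{i. pc P i \<noteq> 0}. cmod (pc P (k, l)) * (1 - 1 ^ k)) / c / (1/2) ^ k / (1/2) ^ l"
      by (intro tendsto_intros elim) (use dc in auto)
    then have "(\<lambda>n. e n / c / (1/2) ^ k / (1/2) ^ l) \<longlonglongrightarrow> 0" by (simp add: case_prod_unfold)
    then have "(\<lambda>n. y n i - pc 1 i) \<longlonglongrightarrow> 0"
      by (rule Lim_null_comparison[rotated]) (use bound in auto)
    then show ?thesis by (simp add: LIM_zero_iff)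
  qed
  show ?thesis by (rule inv_closure_weak_limit[OF y(1) C[OF r y(2)] lim])
qed

section \<open>Algebra of bivariate polynomials\<close>

lemma irreducible_imp_prime_poly2: "irreducible p \<Longrightarrow> prime_elem (p :: complex poly poly)"
  by (rule irreducible_imp_prime_elem)

text \<open>A nonzero element of minimal degree in the ideal generated by \<open>p\<close> and \<open>q\<close> divides both
  generators up to factors that do not involve the outer variable.\<close>

lemma bezout_irreducible:
  fixes p q :: "complex poly poly"
  assumes irr: "irreducible p" and deg: "degree p > 0" and ndvd: "\<not> p dvd q"
  obtains A B r where "r \<noteq> 0" "A * p + B * q = [:r:]"
proof -
  define I where "I = {A * p + B * q | A B. True}"
  have pI: "p \<in> I" unfolding I_def by (rule CollectI, rule exI[of _ 1], rule exI[of _ 0]) simp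
  have qI: "q \<in> I" unfolding I_def by (rule CollectI, rule exI[of _ 0], rule exI[of _ 1]) simp
  have Imul: "a * x \<in> I" if "x \<in> I" for a x
  proof -
    from that obtain A B where "x = A * p + B * q" by (auto simp: I_def)
    then have "a * x = (a * A) * p + (a * B) * q" by (simp add: algebra_simps)
    then show ?thesis unfolding I_def by blast
  qed
  have Idiff: "x - y \<in> I" if "x \<in> I" "y \<in> I" for x y
  proof -
    from that obtain A B A' B' where "x = A * p + B * q" "y = A' * p + B' * q" by (auto simp: I_def)
    then have "x - y = (A - A') * p + (B - B') * q" by (simp add: algebra_simps)
    then show ?thesis unfolding I_def by blast
  qed
  have p0: "p \<noteq> 0" using deg by auto
  define d where "d = arg_min degree (\<lambda>x. x \<in> I \<and> x \<noteq> 0)"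
  have d: "d \<in> I" "d \<noteq> 0" "\<And>x. x \<in> I \<Longrightarrow> x \<noteq> 0 \<Longrightarrow> degree d \<le> degree x"
    using arg_min_nat_lemma[of "\<lambda>x. x \<in> I \<and> x \<noteq> 0" p degree] pI p0 unfolding d_def by auto
  have div: "\<exists>a s. a \<noteq> 0 \<and> [:a:] * x = d * s" if x: "x \<in> I" for x
  proof -
    \<comment> \<open>Coefficients are polynomials in \<open>z1\<close> and not field elements, so
      division with remainder costs a nonzero factor \<open>a\<close>.\<close>
    obtain a s where as: "a \<noteq> 0" "smult a x = d * s + pseudo_mod x d" "pseudo_mod x d = 0 \<or> degree (pseudo_mod x d) < degree d"
      using pseudo_mod[OF d(2), of x] by blast
    have "pseudo_mod x d = [:a:] * x - s * d" using as(2) by (simp add: algebra_simps)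
    then have "pseudo_mod x d \<in> I" using Idiff[OF Imul[OF x, of "[:a:]"] Imul[OF d(1), of s]] by simp
    then have "pseudo_mod x d = 0" using as(3) d(3) not_less by blast
    then show ?thesis using as by auto
  qed
  have "degree d = 0"
  proof (rule ccontr)
    assume dd: "degree d \<noteq> 0"
    have pr: "prime_elem p" using irr by (rule irreducible_imp_prime_poly2)
    have nc: "\<not> p dvd [:a:]" if "a \<noteq> 0" for a
    proof
      assume "p dvd [:a:]"
      then have "degree p \<le> degree [:a:]" using that by (intro dvd_imp_degree_le) auto
      then show False using deg by simp
    qed
    obtain a s where as: "a \<noteq> 0" "[:a:] * p = d * s" using div[OF pI] by blast
    have "p dvd d * s" using as(2) by (metis dvd_triv_right)
    then have "p dvd d \<or> p dvd s" using pr by (simp add: prime_elem_dvd_mult_iff)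
    then have pd: "p dvd d"
    proof
      \<comment> \<open>Cancelling \<open>p\<close> would make \<open>d\<close> a factor of a
        constant in \<open>z2\<close>, against its positive degree.\<close>
      assume "p dvd s"
      then obtain t where t: "s = p * t" by blast
      then have "p * [:a:] = p * (d * t)" using as(2) by (simp add: algebra_simps)
      then have e: "[:a:] = d * t" using p0 by (simp only: mult_cancel_left) simp
      have "t \<noteq> 0" using e as(1) by auto
      then have "degree [:a:] = degree d + degree t" unfolding e using d(2) by (rule degree_mult_eq[rotated])
      then show ?thesis using dd by simp
    qed
    obtain b t where bt: "b \<noteq> 0" "[:b:] * q = d * t" using div[OF qI] by blast
    have "p dvd [:b:] * q" unfolding bt(2) using pd by (rule dvd_mult2)
    then show False using nc[OF bt(1)] ndvd unfolding prime_elem_dvd_mult_iff[OF pr] by blast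
  qed
  then obtain r where r: "d = [:r:]" using degree_eq_zeroE by blast
  then show ?thesis using that[of r] d unfolding I_def by auto
qed

lemma eval2_as_poly_z2: "eval2 p (z1, z2) = poly (map_poly (\<lambda>c. poly c z1) p) z2"
  by (induction p) (simp_all add: eval2_0 eval2_pCons map_poly_pCons)

section \<open>Slices of irreducible polynomials\<close>

text \<open>Otherwise \<open>z2 - c\<close> divides \<open>p\<close>, and irreducibility makes
  \<open>p\<close> a scalar multiple of it, free of \<open>z1\<close>.\<close>

lemma irreducible_slice_z2_nonzero:
  assumes irr: "irreducible p" and d1: "depends_on_z1 p"
  shows "poly p [:c:] \<noteq> 0"
proof
  assume "poly p [:c:] = 0"
  then have "[:- [:c:], 1:] dvd p" by (simp only: poly_eq_0_iff_dvd)
  then obtain q where q: "p = [:- [:c:], 1:] * q" by blast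
  have "\<not> is_unit [:- [:c:], 1:]" using is_unit_poly_iff[of "[:- [:c:], 1:]"] by auto
  then have "is_unit q" using irr q irreducibleD by blast
  then obtain a where a: "q = [:a:]" "is_unit a" by (auto simp: is_unit_poly_iff)
  then obtain b where b: "a = [:b:]" by (auto simp: is_unit_poly_iff)
  have "coeff (coeff p l) k = 0" if "k > 0" for k l
    using that unfolding q a b by (auto simp: coeff_pCons split: nat.splits)
  then show False using d1 by (auto simp: depends_on_z1_def)
qed

lemma irreducible_slice_z1_nonzero:
  assumes irr: "irreducible p" and d2: "depends_on_z2 p"
  shows "map_poly (\<lambda>a. poly a c) p \<noteq> 0"
proof
  assume "map_poly (\<lambda>a. poly a c) p = 0"
  then have "poly (coeff p l) c = 0" for l by (metis coeff_0 coeff_map_poly poly_0)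
  then have "[:- c, 1:] dvd coeff p l" for l by (simp add: poly_eq_0_iff_dvd)
  then have "[:[:- c, 1:]:] dvd p" by (simp add: const_poly_dvd_iff)
  then obtain q where q: "p = [:[:- c, 1:]:] * q" by blast
  have "\<not> is_unit [:[:- c, 1:]:]" by (auto simp: is_unit_poly_iff)
  then have "is_unit q" using irr q irreducibleD by blast
  then obtain a where a: "q = [:a:]" by (auto simp: is_unit_poly_iff)
  have "coeff (coeff p l) k = 0" if "l > 0" for k l
    using that unfolding q a by (auto simp: coeff_pCons split: nat.splits)
  then show False using d2 by (auto simp: depends_on_z2_def)
qed

lemma finite_slice_z1:
  assumes "irreducible p" "depends_on_z1 p"
  shows "finite {z1. eval2 p (z1, z2) = 0}"
  using poly_roots_finite[OF irreducible_slice_z2_nonzero[OF assms, of z2]] by (simp add: eval2_poly_const)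

lemma finite_slice_z2:
  assumes "irreducible p" "depends_on_z2 p"
  shows "finite {z2. eval2 p (z1, z2) = 0}"
  using poly_roots_finite[OF irreducible_slice_z1_nonzero[OF assms, of z1]] by (simp add: eval2_as_poly_z2)

section \<open>Exchange of the two variables\<close>

definition swp :: "complex poly poly \<Rightarrow> complex poly poly" where
  "swp p = mkp (\<lambda>(k, l). pc p (l, k)) (prod.swap ` {i. pc p i \<noteq> 0})"

lemma pc_swp: "pc (swp p) (k, l) = pc p (l, k)"
  using finite_pc[of p] by (auto simp: swp_def pc_mkp image_iff)

lemma swp_swp: "swp (swp p) = p"
  unfolding pc_inject[symmetric] by (auto simp: fun_eq_iff pc_swp)

lemma eval2_swp: "eval2 (swp p) (z1, z2) = eval2 p (z2, z1)"
proof -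
  have "eval2 (swp p) (z1, z2) = (\<Sum>(k, l)\<in>prod.swap ` {i. pc p i \<noteq> 0}. pc p (l, k) * z1 ^ k * z2 ^ l)"
    unfolding swp_def eval2_mkp by simp
  also have "\<dots> = (\<Sum>(k, l)\<in>{i. pc p i \<noteq> 0}. pc p (k, l) * z2 ^ k * z1 ^ l)"
    by (subst sum.reindex) (auto simp: case_prod_unfold mult_ac)
  also have "\<dots> = eval2 p (z2, z1)" by (simp add: eval2_expand[OF finite_pc order_refl, of p])
  finally show ?thesis .
qed

lemma eval2_inject:
  assumes "\<And>z. eval2 p z = eval2 q z"
  shows "p = q"
proof -
  have "eval2 p = eval2 q" using assms by auto
  then have "ps (eval2 p) (pc p)" "ps (eval2 p) (pc q)" using ps_on_eval2[of 1 1 p] ps_on_eval2[of 1 1 q] by simp_all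
  then show ?thesis using ps_unique pc_inject by blast
qed

lemma swp_mult: "swp (p * q) = swp p * swp q"
proof (rule eval2_inject)
  fix z :: "complex \<times> complex"
  show "eval2 (swp (p * q)) z = eval2 (swp p * swp q) z" by (cases z) (simp add: eval2_mult eval2_swp)
qed

lemma swp_1: "swp 1 = 1"
proof (rule eval2_inject)
  show "eval2 (swp 1) z = eval2 1 z" for z by (cases z) (simp add: eval2_swp eval2_1)
qed

lemma swp_0: "swp 0 = 0"
proof (rule eval2_inject)
  show "eval2 (swp 0) z = eval2 0 z" for z by (cases z) (simp add: eval2_swp eval2_0)
qed

lemma is_unit_swp: "is_unit p \<Longrightarrow> is_unit (swp p)"
proof -
  assume "is_unit p"
  then obtain q where "1 = p * q" by (rule dvdE)
  then have "swp p * swp q = 1" by (simp flip: swp_mult add: swp_1)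
  then show "is_unit (swp p)" by (metis dvd_triv_left)
qed

lemma irreducible_swp: assumes "irreducible p" shows "irreducible (swp p)"
proof (rule irreducibleI)
  show "swp p \<noteq> 0"
  proof
    assume "swp p = 0"
    then have "swp (swp p) = swp 0" by (rule arg_cong)
    then show False using assms by (simp add: swp_swp swp_0)
  qed
  show "\<not> is_unit (swp p)" using assms is_unit_swp[of "swp p"] by (auto simp: swp_swp irreducible_def)
  fix a b assume "swp p = a * b"
  then have "swp (swp p) = swp (a * b)" by (rule arg_cong)
  then have "p = swp a * swp b" by (simp only: swp_swp swp_mult)
  then have "is_unit (swp a) \<or> is_unit (swp b)" using assms irreducibleD by blast
  then show "is_unit a \<or> is_unit b" using is_unit_swp[of "swp a"] is_unit_swp[of "swp b"] by (simp only: swp_swp) blast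
qed

lemma depends_on_z2_degree:
  assumes "depends_on_z2 p"
  shows "degree p > 0"
proof -
  obtain k l where l: "l > 0" "coeff (coeff p l) k \<noteq> 0" using assms by (auto simp: depends_on_z2_def)
  then have "l \<le> degree p" by (metis coeff_0 le_degree)
  then show ?thesis using l by simp
qed

lemma depends_swp: "depends_on_z1 (swp p) = depends_on_z2 p" "depends_on_z2 (swp p) = depends_on_z1 p"
  unfolding depends_on_z1_def depends_on_z2_def pc_apply[symmetric] pc_swp by blast+

lemma sqle_swp: "sqle (wt \<alpha>1 \<alpha>2) (\<lambda>i. x (prod.swap i)) C" if "sqle (wt \<alpha>2 \<alpha>1) x C"
  unfolding sqle_def
proof (intro allI impI)
  fix F :: "(nat \<times> nat) set" assume F: "finite F"
  have "(\<Sum>i\<in>F. wt \<alpha>1 \<alpha>2 i * (cmod (x (prod.swap i)))\<^sup>2) = (\<Sum>i\<in>prod.swap ` F. wt \<alpha>2 \<alpha>1 i * (cmod (x i))\<^sup>2)"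
    by (subst sum.reindex) (auto simp: wt_def case_prod_unfold mult_ac)
  also have "\<dots> \<le> C" by (rule sqleD[OF that]) (use F in simp)
  finally show "(\<Sum>i\<in>F. wt \<alpha>1 \<alpha>2 i * (cmod (x (prod.swap i)))\<^sup>2) \<le> C" .
qed

lemma inv_closure_swp:
  assumes "pc 1 \<in> inv_closure \<alpha>2 \<alpha>1 (swp p)"
  shows "pc 1 \<in> inv_closure \<alpha>1 \<alpha>2 p"
proof (rule inv_closureI)
  fix \<epsilon> :: real assume "\<epsilon> > 0"
  then obtain q where q: "sqle (wt \<alpha>2 \<alpha>1) (\<lambda>i. pc 1 i - pc (q * swp p) i) \<epsilon>"
    using inv_closureD[OF assms] by blast
  have "(\<lambda>i. pc 1 (prod.swap i) - pc (q * swp p) (prod.swap i)) = (\<lambda>i. pc 1 i - pc (swp q * p) i)"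
  proof
    fix i :: "nat \<times> nat"
    obtain k l where i: "i = (k, l)" by force
    have "swp q * p = swp (q * swp p)" by (simp add: swp_mult swp_swp)
    then have "pc (swp q * p) i = pc (q * swp p) (prod.swap i)" by (simp add: i pc_swp)
    then show "pc 1 (prod.swap i) - pc (q * swp p) (prod.swap i) = pc 1 i - pc (swp q * p) i"
      by (auto simp: pc_1 i)
  qed
  with sqle_swp[OF q] show "\<exists>q. sqle (wt \<alpha>1 \<alpha>2) (\<lambda>i. pc 1 i - pc (q * p) i) \<epsilon>" by auto
qed

section \<open>Zeros on the boundary of the bidisk\<close>

text \<open>Hurwitz's theorem for the slices at \<open>r n * \<zeta>\<close>, which tend to the
  slice at \<open>\<zeta>\<close> locally uniformly. A constant limit, which Hurwitz excludes, is
  nonzero because its zero set is finite.\<close>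

lemma boundary_slice_nonvanishing:
  fixes h :: "complex \<Rightarrow> complex \<Rightarrow> complex"
  assumes cont: "continuous_on UNIV (\<lambda>(z, w). h z w)" and hol: "\<And>w. (\<lambda>z. h z w) holomorphic_on ball 0 1"
    and nz: "\<And>z w. cmod z < 1 \<Longrightarrow> cmod w < 1 \<Longrightarrow> h z w \<noteq> 0"
    and \<zeta>: "cmod \<zeta> \<le> 1" and fin: "finite {z. h z \<zeta> = 0}" and z: "cmod z < 1"
  shows "h z \<zeta> \<noteq> 0"
proof (cases "(\<lambda>z. h z \<zeta>) constant_on ball 0 1")
  case True
  have inf: "infinite (ball (0::complex) 1)" using uncountable_ball[of 1 "0::complex"] countable_finite by auto
  obtain u where u: "u \<in> ball 0 1" "h u \<zeta> \<noteq> 0"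
    using finite_subset[OF _ fin, of "ball 0 1"] inf by blast
  then show ?thesis using True z by (auto simp: constant_on_def)
next
  case False
  define r where "r n = complex_of_real (1 - 1 / (real n + 2))" for n
  have r: "cmod (r n) < 1" for n unfolding r_def norm_of_real by (simp add: abs_less_iff field_simps)
  have rlim: "r \<longlonglongrightarrow> 1"
    unfolding r_def[abs_def] using tendsto_of_real[OF LIMSEQ_one_minus_inverse, where ?'a = complex] by simp
  have rz: "cmod (r n * \<zeta>) < 1" for n
  proof -
    have "cmod (r n * \<zeta>) \<le> cmod (r n) * 1" unfolding norm_mult using \<zeta> by (intro mult_left_mono) auto
    then show ?thesis using r[of n] by simp
  qed
  show ?thesis
  proof (rule Hurwitz_no_zeros[of "ball 0 1" "\<lambda>n z. h z (r n * \<zeta>)" "\<lambda>z. h z \<zeta>"])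
    fix K :: "complex set" assume K: "compact K" "K \<subseteq> ball 0 1"
    have "uniformly_continuous_on (K \<times> cball 0 1) (\<lambda>(z, w). h z w)"
      by (intro compact_uniformly_continuous continuous_on_subset[OF cont] compact_Times K) auto
    then have uc: "\<exists>d>0. \<forall>x\<in>K \<times> cball 0 1. \<forall>x'\<in>K \<times> cball 0 1. dist x' x < d \<longrightarrow> dist ((\<lambda>(z, w). h z w) x') ((\<lambda>(z, w). h z w) x) < e" if "e > 0" for e
      using that unfolding uniformly_continuous_on_def by blast
    show "uniform_limit K (\<lambda>n z. h z (r n * \<zeta>)) (\<lambda>z. h z \<zeta>) sequentially"
    proof (rule uniform_limitI)
      fix e :: real assume "e > 0"
      from uc[OF this] obtain d where d: "d > 0"
        "\<And>x x'. x \<in> K \<times> cball 0 1 \<Longrightarrow> x' \<in> K \<times> cball 0 1 \<Longrightarrow> dist x' x < d \<Longrightarrow> dist ((\<lambda>(z, w). h z w) x') ((\<lambda>(z, w). h z w) x) < e" by blast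
      have "(\<lambda>n. r n * \<zeta>) \<longlonglongrightarrow> 1 * \<zeta>" by (intro tendsto_intros rlim)
      then have "\<forall>\<^sub>F n in sequentially. dist (r n * \<zeta>) \<zeta> < d" using d(1) by (auto dest: tendstoD)
      then show "\<forall>\<^sub>F n in sequentially. \<forall>z\<in>K. dist (h z (r n * \<zeta>)) (h z \<zeta>) < e"
      proof (rule eventually_mono, intro ballI)
        fix n z assume n: "dist (r n * \<zeta>) \<zeta> < d" and z: "z \<in> K"
        have "dist ((\<lambda>(z, w). h z w) (z, r n * \<zeta>)) ((\<lambda>(z, w). h z w) (z, \<zeta>)) < e"
          by (rule d(2)) (use z n rz[of n] \<zeta> in \<open>auto simp: dist_Pair_Pair less_imp_le\<close>)
        then show "dist (h z (r n * \<zeta>)) (h z \<zeta>) < e" by simp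
      qed
    qed
  qed (use hol nz rz False z in auto)
qed

lemma holomorphic_eval2_1: "(\<lambda>z. eval2 p (z, w)) holomorphic_on A"
  by (auto simp: holomorphic_on_def field_differentiable_def intro: has_field_derivative_at_within[OF eval2_DERIV_1])

lemma holomorphic_eval2_2: "(\<lambda>w. eval2 p (z, w)) holomorphic_on A"
  by (auto simp: holomorphic_on_def field_differentiable_def intro: has_field_derivative_at_within[OF eval2_DERIV_2])

text \<open>Boundary zeros can thus only lie on the torus. The dependence on both variables enters
  through the finiteness of zeros in each slice.\<close>

lemma nonvanishing_boundary:
  assumes irr: "irreducible p" "depends_on_z1 p" "depends_on_z2 p"
    and nz: "\<And>z1 z2. cmod z1 < 1 \<Longrightarrow> cmod z2 < 1 \<Longrightarrow> eval2 p (z1, z2) \<noteq> 0"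
  shows "cmod z1 < 1 \<Longrightarrow> cmod z2 \<le> 1 \<Longrightarrow> eval2 p (z1, z2) \<noteq> 0"
    "cmod z1 \<le> 1 \<Longrightarrow> cmod z2 < 1 \<Longrightarrow> eval2 p (z1, z2) \<noteq> 0"
proof -
  show "eval2 p (z1, z2) \<noteq> 0" if "cmod z1 < 1" "cmod z2 \<le> 1"
  proof (rule boundary_slice_nonvanishing[where h = "\<lambda>z w. eval2 p (z, w)"])
    show "continuous_on UNIV (\<lambda>(z, w). eval2 p (z, w))"
      using continuous_on_eval2[of UNIV p] by (simp add: case_prod_unfold)
    show "(\<lambda>z. eval2 p (z, w)) holomorphic_on ball 0 1" for w by (rule holomorphic_eval2_1)
    show "finite {z. eval2 p (z, z2) = 0}" using irr by (intro finite_slice_z1)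
  qed (use that nz in simp_all)
  show "eval2 p (z1, z2) \<noteq> 0" if "cmod z1 \<le> 1" "cmod z2 < 1"
  proof (rule boundary_slice_nonvanishing[where h = "\<lambda>z w. eval2 p (w, z)"])
    have "continuous_on UNIV (\<lambda>z. eval2 p (snd z, fst z))"
      by (rule continuous_on_compose2[OF continuous_on_eval2[of UNIV]]) (auto intro!: continuous_intros)
    then show "continuous_on UNIV (\<lambda>(z, w). eval2 p (w, z))" by (simp add: case_prod_unfold)
    show "finite {z. eval2 p (z1, z) = 0}" using irr by (intro finite_slice_z2)
    show "(\<lambda>w. eval2 p (z, w)) holomorphic_on ball 0 1" for z by (rule holomorphic_eval2_2)
  qed (use that nz in simp_all)
qed

section \<open>The reflected polynomial\<close>

text \<open>The function \<open>z1^n z2^m cnj (p (1 / cnj z1, 1 / cnj z2))\<close>, given by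
  coefficients so that it is a polynomial also where a coordinate vanishes.\<close>

definition reflect2 :: "nat \<Rightarrow> nat \<Rightarrow> complex poly poly \<Rightarrow> complex poly poly" where
  "reflect2 n m p = mkp (\<lambda>(k, l). cnj (pc p (n - k, m - l))) ({..n} \<times> {..m})"

lemma sum_box_reflect:
  fixes f :: "nat \<Rightarrow> nat \<Rightarrow> 'a::comm_monoid_add"
  shows "(\<Sum>(i, j)\<in>{..n} \<times> {..m}. f (n - i) (m - j)) = (\<Sum>(i, j)\<in>{..n} \<times> {..m}. f i j)"
  by (rule sum.reindex_bij_witness[of _ "\<lambda>(i, j). (n - i, m - j)" "\<lambda>(i, j). (n - i, m - j)"]) auto

lemma inverse_cnj_unit_circle:
  assumes "cmod w = 1"
  shows "1 / cnj w = w"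
proof -
  have "w * cnj w = 1" using complex_norm_square[of w] assms by simp
  moreover have "w \<noteq> 0" using assms by auto
  ultimately show ?thesis by (simp add: field_simps)
qed

lemma eval2_reflect2:
  assumes supp: "{i. pc p i \<noteq> 0} \<subseteq> {..n} \<times> {..m}" and z: "z1 \<noteq> 0" "z2 \<noteq> 0"
  shows "eval2 (reflect2 n m p) (z1, z2) = z1 ^ n * z2 ^ m * cnj (eval2 p (1 / cnj z1, 1 / cnj z2))"
proof -
  have "eval2 (reflect2 n m p) (z1, z2) = (\<Sum>(k, l)\<in>{..n} \<times> {..m}. cnj (pc p (n - k, m - l)) * z1 ^ k * z2 ^ l)"
    by (simp add: reflect2_def eval2_mkp)
  also have "\<dots> = (\<Sum>(k, l)\<in>{..n} \<times> {..m}. (\<lambda>i j. cnj (pc p (i, j)) * z1 ^ (n - i) * z2 ^ (m - j)) (n - k) (m - l))"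
    by (intro sum.cong) auto
  also have "\<dots> = (\<Sum>(i, j)\<in>{..n} \<times> {..m}. cnj (pc p (i, j)) * z1 ^ (n - i) * z2 ^ (m - j))"
    by (rule sum_box_reflect)
  also have "\<dots> = (\<Sum>(i, j)\<in>{..n} \<times> {..m}. z1 ^ n * z2 ^ m * (cnj (pc p (i, j)) * (1 / z1) ^ i * (1 / z2) ^ j))"
    using z by (intro sum.cong) (auto simp: power_diff field_simps)
  also have "\<dots> = z1 ^ n * z2 ^ m * cnj (eval2 p (1 / cnj z1, 1 / cnj z2))"
    using eval2_expand[OF _ supp] by (simp add: sum_distrib_left case_prod_unfold)
  finally show ?thesis .
qed

text \<open>The Blaschke identity:
  \<open>|z - a|^2 - |1 - a cnj z|^2 = (1 - |z|^2) (|a|^2 - 1)\<close>.\<close>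

lemma reflected_factor_le:
  fixes a z :: complex
  assumes "1 \<le> cmod a" "cmod z \<le> 1" "z \<noteq> 0"
  shows "cmod z * cmod (1 / cnj z - a) \<le> cmod (z - a)"
proof -
  have "cmod z * cmod (1 / cnj z - a) = cmod (cnj z * (1 / cnj z - a))" by (simp add: norm_mult)
  also have "cnj z * (1 / cnj z - a) = 1 - a * cnj z" using assms by (simp add: field_simps)
  finally have e: "cmod z * cmod (1 / cnj z - a) = cmod (1 - a * cnj z)" .
  have "complex_of_real ((cmod (z - a))\<^sup>2 - (cmod (1 - a * cnj z))\<^sup>2) = complex_of_real ((1 - (cmod z)\<^sup>2) * ((cmod a)\<^sup>2 - 1))"
    unfolding of_real_diff of_real_mult complex_norm_square by (simp add: algebra_simps)
  then have "(cmod (z - a))\<^sup>2 - (cmod (1 - a * cnj z))\<^sup>2 = (1 - (cmod z)\<^sup>2) * ((cmod a)\<^sup>2 - 1)" by (simp only: of_real_eq_iff)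
  also have "\<dots> \<ge> 0" using assms by (intro mult_nonneg_nonneg) (auto simp: power_le_one)
  finally have "(cmod (1 - a * cnj z))\<^sup>2 \<le> (cmod (z - a))\<^sup>2" by simp
  then show ?thesis unfolding e by (rule power2_le_imp_le) simp
qed

lemma reflected_poly_le:
  fixes q :: "complex poly"
  assumes z: "cmod z \<le> 1" "z \<noteq> 0"
  shows "degree q = d \<Longrightarrow> (\<And>z. cmod z < 1 \<Longrightarrow> poly q z \<noteq> 0) \<Longrightarrow> cmod z ^ d * cmod (poly q (1 / cnj z)) \<le> cmod (poly q z)"
proof (induction d arbitrary: q)
  case 0
  then obtain a where "q = [:a:]" using degree_eq_zeroE by blast
  then show ?case by simp
next
  case (Suc d)
  obtain a Q where aQ: "q = [:- a, 1:] * Q" "degree Q = d" "1 \<le> cmod a" "\<And>z. cmod z < 1 \<Longrightarrow> poly Q z \<noteq> 0"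
    using poly_linear_factor[OF Suc.prems] by blast
  have q: "poly q w = (w - a) * poly Q w" for w by (simp add: aQ(1) algebra_simps)
  have "cmod z ^ Suc d * cmod (poly q (1 / cnj z)) = (cmod z * cmod (1 / cnj z - a)) * (cmod z ^ d * cmod (poly Q (1 / cnj z)))"
    by (simp only: q norm_mult) simp
  also have "\<dots> \<le> cmod (z - a) * cmod (poly Q z)"
    by (intro mult_mono reflected_factor_le Suc.IH aQ z) auto
  finally show ?case by (simp only: q norm_mult)
qed

text \<open>For \<open>z1\<close> on the circle, reflection in \<open>z1\<close> changes no modulus,
  and the one-variable inequality in \<open>z2\<close> applies. The maximum principle for the
  quotient extends this to the disc in \<open>z1\<close>.\<close>

lemma reflect2_le:
  assumes supp: "{i. pc p i \<noteq> 0} \<subseteq> {..n} \<times> {..m}"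
    and nz: "\<And>z1 z2. cmod z1 \<le> 1 \<Longrightarrow> cmod z2 < 1 \<Longrightarrow> eval2 p (z1, z2) \<noteq> 0"
    and z: "cmod z1 < 1" "cmod z2 < 1"
  shows "cmod (eval2 (reflect2 n m p) (z1, z2)) \<le> cmod (eval2 p (z1, z2))"
proof -
  have bd: "cmod (eval2 (reflect2 n m p) (w, u)) \<le> cmod (eval2 p (w, u))" if w: "cmod w = 1" and u: "cmod u < 1" "u \<noteq> 0" for w u
  proof -
    define q where "q = map_poly (\<lambda>c. poly c w) p"
    have q: "eval2 p (w, v) = poly q v" for v by (simp add: q_def eval2_as_poly_z2)
    have dq: "degree q \<le> m"
    proof -
      have "degree p \<le> m"
      proof (cases "p = 0")
        case False
        then have "coeff p (degree p) \<noteq> 0" by simp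
        then obtain k where "pc p (k, degree p) \<noteq> 0" by (metis pc_apply leading_coeff_0_iff)
        then show ?thesis using supp by auto
      qed simp
      then show ?thesis unfolding q_def by (intro degree_le) (simp add: coeff_map_poly coeff_eq_0)
    qed
    have w1: "1 / cnj w = w" using w by (rule inverse_cnj_unit_circle)
    have "w \<noteq> 0" using w by auto
    from eval2_reflect2[OF supp this u(2)]
    have "cmod (eval2 (reflect2 n m p) (w, u)) = cmod u ^ m * cmod (poly q (1 / cnj u))"
      by (simp add: norm_mult norm_power w w1 q)
    \<comment> \<open>The slice may have degree below \<open>m\<close>; the surplus powers of
      \<open>cmod u < 1\<close> only help.\<close>
    also have "\<dots> \<le> cmod u ^ degree q * cmod (poly q (1 / cnj u))"
      using u dq by (intro mult_right_mono power_decreasing) auto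
    also have "\<dots> \<le> cmod (poly q u)"
      using nz[of w] w u by (intro reflected_poly_le) (auto simp: q)
    finally show ?thesis by (simp add: q)
  qed
  have main: "cmod (eval2 (reflect2 n m p) (z1, u)) \<le> cmod (eval2 p (z1, u))" if u: "cmod u < 1" "u \<noteq> 0" for u
  proof -
    have "cmod (eval2 (reflect2 n m p) (z1, u) / eval2 p (z1, u)) \<le> 1"
    proof (rule maximum_modulus_frontier[where S = "ball 0 1" and f = "\<lambda>w. eval2 (reflect2 n m p) (w, u) / eval2 p (w, u)"])
      show "(\<lambda>w. eval2 (reflect2 n m p) (w, u) / eval2 p (w, u)) holomorphic_on interior (ball 0 1)"
        using nz u by (intro holomorphic_on_divide holomorphic_eval2_1) auto
      have "continuous_on (cball 0 1) (\<lambda>w. eval2 q (w, u))" for q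
        by (rule holomorphic_on_imp_continuous_on[OF holomorphic_eval2_1])
      then show "continuous_on (closure (ball 0 1)) (\<lambda>w. eval2 (reflect2 n m p) (w, u) / eval2 p (w, u))"
        using nz u by (intro continuous_on_divide) auto
      show "cmod (eval2 (reflect2 n m p) (w, u) / eval2 p (w, u)) \<le> 1" if "w \<in> frontier (ball 0 1)" for w
        using bd[of w u] that u nz[of w u] by (simp add: norm_divide divide_le_eq)
    qed (use z in auto)
    then show ?thesis using nz[of z1 u] z u by (simp add: norm_divide divide_le_eq)
  qed
  show ?thesis
  proof (cases "z2 = 0")
    case False then show ?thesis using main z by blast
  next
    \<comment> \<open>The reflection formula requires nonzero coordinates, so \<open>z2 = 0\<close>
      is reached by continuity.\<close>
    case True
    have c: "isCont (\<lambda>u. eval2 q (z1, u)) 0" for q by (rule DERIV_isCont[OF eval2_DERIV_2])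
    have "(\<lambda>u. cmod (eval2 q (z1, u))) \<midarrow>0\<rightarrow> cmod (eval2 q (z1, 0))" for q
      using c[of q] by (intro tendsto_norm) (simp add: isCont_def)
    moreover have "\<forall>\<^sub>F u in at 0. cmod (eval2 (reflect2 n m p) (z1, u)) \<le> cmod (eval2 p (z1, u))"
      unfolding eventually_at using main by (intro exI[of _ 1]) auto
    ultimately show ?thesis unfolding True by (intro tendsto_le[OF at_neq_bot])
  qed
qed

text \<open>\<open>r0\<close> has no zeros in the open disc, as dilation requires, while
  \<open>r1\<close> is bounded away from 0 near the circle and can be divided out there.\<close>

lemma polynomial_circle_split:
  fixes r :: "complex poly"
  shows "r \<noteq> 0 \<Longrightarrow> \<exists>r0 r1. r = r0 * r1 \<and> (\<forall>z. poly r0 z = 0 \<longrightarrow> cmod z = 1) \<and> (\<forall>z. cmod z = 1 \<longrightarrow> poly r1 z \<noteq> 0)"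
proof (induction "degree r" arbitrary: r rule: less_induct)
  case less
  show ?case
  proof (cases "\<exists>z. cmod z = 1 \<and> poly r z = 0")
    case False
    then show ?thesis by (intro exI[of _ 1] exI[of _ r]) auto
  next
    case True
    then obtain a where a: "cmod a = 1" "poly r a = 0" by blast
    then obtain Q where Q: "r = [:- a, 1:] * Q" by (metis dvdE poly_eq_0_iff_dvd)
    have Q0: "Q \<noteq> 0" using Q less.prems by auto
    have "degree r = Suc (degree Q)" unfolding Q using Q0 by (subst degree_mult_eq) auto
    then obtain r0 r1 where r: "Q = r0 * r1" "\<forall>z. poly r0 z = 0 \<longrightarrow> cmod z = 1" "\<forall>z. cmod z = 1 \<longrightarrow> poly r1 z \<noteq> 0"
      using less.hyps[of Q] Q0 by auto
    have "r = ([:- a, 1:] * r0) * r1" unfolding Q r(1) by (simp only: mult.assoc)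
    moreover have "\<forall>z. poly ([:- a, 1:] * r0) z = 0 \<longrightarrow> cmod z = 1" using r(2) a by auto
    ultimately show ?thesis using r(3) by blast
  qed
qed

section \<open>Quotients with bounded derivatives\<close>

text \<open>Termwise differentiation at fixed \<open>z2\<close>, followed by comparison of the
  resulting power series in \<open>z2\<close>.\<close>

lemma ps_deriv_1:
  assumes f: "ps f x" and g: "ps g y"
    and d: "\<And>z1 z2. cmod z1 < 1 \<Longrightarrow> cmod z2 < 1 \<Longrightarrow> ((\<lambda>w. f (w, z2)) has_field_derivative g (z1, z2)) (at z1)"
  shows "y (k, l) = of_nat (Suc k) * x (Suc k, l)"
proof -
  define c where "c k z2 = (\<Sum>\<^sub>\<infinity>l. x (k, l) * z2 ^ l)" for k z2
  define e where "e k z2 = (\<Sum>\<^sub>\<infinity>l. y (k, l) * z2 ^ l)" for k z2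
  have ce: "e k z2 = of_nat (Suc k) * c (Suc k) z2" if z2: "cmod z2 < 1" for k z2
  proof -
    have cs: "(\<lambda>k. c k z2 * z ^ k) sums f (z, z2)" if "cmod z < 1" for z
      using has_sum_imp_sums[OF ps_slice(2)[OF f z2 that]] by (simp add: c_def)
    have "(\<lambda>k. diffs (\<lambda>k. c k z2) k * z ^ k) sums g (z, z2)" if z: "cmod z < 1" for z
    proof -
      have "((\<lambda>z. \<Sum>k. c k z2 * z ^ k) has_field_derivative (\<Sum>k. diffs (\<lambda>k. c k z2) k * z ^ k)) (at z)"
        by (rule termdiffs_strong'[of 1]) (use cs z in \<open>auto simp: sums_iff\<close>)
      then have "((\<lambda>z. f (z, z2)) has_field_derivative (\<Sum>k. diffs (\<lambda>k. c k z2) k * z ^ k)) (at z)"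
        by (rule has_field_derivative_transform_within_open[of _ _ _ "ball 0 1"])
          (use z cs in \<open>auto simp: sums_iff\<close>)
      then have "(\<Sum>k. diffs (\<lambda>k. c k z2) k * z ^ k) = g (z, z2)" using d[OF z z2] by (rule DERIV_unique)
      moreover have "summable (\<lambda>k. diffs (\<lambda>k. c k z2) k * z ^ k)"
        by (rule termdiff_converges[of z 1]) (use cs z in \<open>auto simp: sums_iff\<close>)
      ultimately show ?thesis by (simp add: sums_iff)
    qed
    then have "diffs (\<lambda>k. c k z2) = (\<lambda>k. e k z2)"
      by (rule sums_powser_unique) (use ps_slice(2)[OF g z2] in \<open>simp_all add: e_def\<close>)
    then show ?thesis by (simp add: diffs_def fun_eq_iff)
  qed
  have "(\<lambda>l. y (k, l)) = (\<lambda>l. of_nat (Suc k) * x (Suc k, l))"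
  proof (rule has_sum_powser_unique)
    fix z2 :: complex assume "z2 \<in> ball 0 1"
    then have z2: "cmod z2 < 1" by simp
    show "((\<lambda>l. y (k, l) * z2 ^ l) has_sum e k z2) UNIV" unfolding e_def by (rule ps_slice(1)[OF g z2])
    have "((\<lambda>l. of_nat (Suc k) * (x (Suc k, l) * z2 ^ l)) has_sum of_nat (Suc k) * c (Suc k) z2) UNIV"
      unfolding c_def by (intro has_sum_cmult_right ps_slice(1)[OF f z2])
    then show "((\<lambda>l. of_nat (Suc k) * x (Suc k, l) * z2 ^ l) has_sum e k z2) UNIV"
      unfolding ce[OF z2] mult.assoc .
  qed
  then show ?thesis by (rule fun_cong)
qed

lemma ps_swap:
  assumes "ps f x"
  shows "ps (\<lambda>(z1, z2). f (z2, z1)) (\<lambda>i. x (prod.swap i))"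
  unfolding ps_on_def
proof (intro allI impI)
  fix z1 z2 :: complex assume z: "cmod z1 < 1" "cmod z2 < 1"
  define g where "g = (\<lambda>(k, l). x (k, l) * z2 ^ k * z1 ^ l)"
  have "(g has_sum f (z2, z1)) UNIV" unfolding g_def by (rule ps_onD[OF assms z(2,1)])
  then have "((\<lambda>i. g (prod.swap i)) has_sum f (z2, z1)) UNIV"
    by (subst has_sum_reindex_bij_betw[OF bij_swap])
  moreover have "(\<lambda>i. g (prod.swap i)) = (\<lambda>(k, l). x (prod.swap (k, l)) * z1 ^ k * z2 ^ l)"
    by (auto simp: g_def fun_eq_iff)
  ultimately show "((\<lambda>(k, l). x (prod.swap (k, l)) * z1 ^ k * z2 ^ l) has_sum (case (z1, z2) of (z1, z2) \<Rightarrow> f (z2, z1))) UNIV"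
    by simp
qed

lemma ps_deriv_2:
  assumes f: "ps f x" and g: "ps g y"
    and d: "\<And>z1 z2. cmod z1 < 1 \<Longrightarrow> cmod z2 < 1 \<Longrightarrow> ((\<lambda>w. f (z1, w)) has_field_derivative g (z1, z2)) (at z2)"
  shows "y (k, l) = of_nat (Suc l) * x (k, Suc l)"
  using ps_deriv_1[OF ps_swap[OF f] ps_swap[OF g], of l k] d by simp

section \<open>Decay of coefficients through derivatives\<close>

text \<open>Functions \<open>Q R^N / G^j\<close> form a class closed under differentiation: a
  derivative costs one power of \<open>R\<close> and adds one power of \<open>G\<close> to the
  denominator.\<close>

lemma DERIV_power_quotient:
  fixes Q R G :: "complex \<Rightarrow> complex"
  assumes "(Q has_field_derivative Q') (at z)" "(R has_field_derivative R') (at z)" "(G has_field_derivative G') (at z)"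
    and G: "G z \<noteq> 0"
  shows "((\<lambda>w. Q w * R w ^ Suc N / G w ^ j) has_field_derivative
    (Q' * R z * G z + of_nat (Suc N) * (Q z * R' * G z) - of_nat j * (Q z * R z * G')) * R z ^ N / G z ^ Suc j) (at z)"
proof (rule DERIV_cong[OF DERIV_divide[OF DERIV_mult[OF assms(1) DERIV_power[OF assms(2), of "Suc N"]] DERIV_power[OF assms(3), of j]]])
  show "((Q' * R z ^ Suc N + of_nat (Suc N) * (R' * R z ^ (Suc N - Suc 0)) * Q z) * G z ^ j -
      Q z * R z ^ Suc N * (of_nat j * (G' * G z ^ (j - Suc 0)))) / (G z ^ j * G z ^ j) =
    (Q' * R z * G z + of_nat (Suc N) * (Q z * R' * G z) - of_nat j * (Q z * R z * G')) * R z ^ N / G z ^ Suc j"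
  proof (cases j)
    case 0
    then show ?thesis using G by (simp add: field_simps)
  next
    case (Suc i)
    have "((Q' * R z ^ Suc N + of_nat (Suc N) * (R' * R z ^ N) * Q z) * G z ^ Suc i -
      Q z * R z ^ Suc N * (of_nat (Suc i) * (G' * G z ^ i))) =
      ((Q' * R z * G z + of_nat (Suc N) * (Q z * R' * G z) - of_nat (Suc i) * (Q z * R z * G')) * R z ^ N) * G z ^ i"
      by (simp add: algebra_simps)
    moreover have "G z ^ Suc i * G z ^ Suc i = G z ^ Suc (Suc i) * G z ^ i" by simp
    ultimately show ?thesis unfolding Suc using G by simp
  qed
qed (use G in simp)

lemma eval2_smult: "eval2 (smult [:c:] q) z = c * eval2 q z"
  by (cases z) (simp add: eval2_def)

lemma coeff_decay_step:
  fixes x y :: "nat \<times> nat \<Rightarrow> complex"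
  assumes yx: "\<And>k l. y (k, l) = of_nat (Suc k) * x (Suc k, l)"
    and y: "\<exists>K. \<forall>k l. cmod (y (k, l)) * (real k + 1) ^ s * (real l + 1) ^ t \<le> K"
    and x: "\<exists>K. \<forall>k l. cmod (x (k, l)) * (real k + 1) ^ s * (real l + 1) ^ t \<le> K"
  shows "\<exists>K. \<forall>k l. cmod (x (k, l)) * (real k + 1) ^ Suc s * (real l + 1) ^ t \<le> K"
proof -
  obtain K where K: "\<And>k l. cmod (y (k, l)) * (real k + 1) ^ s * (real l + 1) ^ t \<le> K" using y by blast
  obtain L where L: "\<And>k l. cmod (x (k, l)) * (real k + 1) ^ s * (real l + 1) ^ t \<le> L" using x by blast
  \<comment> \<open>\<open>L\<close> covers \<open>k = 0\<close>, which the derivative does not see;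
    the factor \<open>2 ^ Suc s\<close> comes from \<open>i + 2 \<le> 2 * (i + 1)\<close>.\<close>
  have "cmod (x (k, l)) * (real k + 1) ^ Suc s * (real l + 1) ^ t \<le> max L (2 ^ Suc s * K)" for k l
  proof (cases k)
    case 0
    then show ?thesis using L[of 0 l] by simp
  next
    case (Suc i)
    have "cmod (x (k, l)) * (real k + 1) ^ Suc s * (real l + 1) ^ t \<le> cmod (x (k, l)) * (2 * (real i + 1)) ^ Suc s * (real l + 1) ^ t"
      unfolding Suc by (intro mult_right_mono mult_left_mono power_mono) auto
    also have "\<dots> = 2 ^ Suc s * (((real i + 1) * cmod (x (Suc i, l))) * (real i + 1) ^ s * (real l + 1) ^ t)"
      unfolding power_mult_distrib Suc by simp
    also have "(real i + 1) * cmod (x (Suc i, l)) = cmod (y (i, l))"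
      unfolding yx norm_mult norm_of_nat by simp
    also have "2 ^ Suc s * (cmod (y (i, l)) * (real i + 1) ^ s * (real l + 1) ^ t) \<le> 2 ^ Suc s * K"
      by (intro mult_left_mono K) simp
    finally show ?thesis by simp
  qed
  then show ?thesis by blast
qed

text \<open>As long as \<open>j \<le> N\<close>, the bound \<open>le\<close> keeps the quotient
  bounded, hence also its coefficients. A derivative lowers \<open>N\<close> and raises
  \<open>j\<close>, so each order of decay uses up 2 of the margin \<open>N - j\<close>.\<close>

lemma smooth_quotient_decay:
  assumes nz: "\<And>z1 z2. cmod z1 < 1 \<Longrightarrow> cmod z2 < 1 \<Longrightarrow> eval2 p (z1, z2) \<noteq> 0"
    and le: "\<And>z1 z2. cmod z1 < 1 \<Longrightarrow> cmod z2 < 1 \<Longrightarrow> cmod (eval2 R (z1, z2)) \<le> C * cmod (eval2 p (z1, z2))"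
  shows "j + 2 * (s + t) \<le> N \<Longrightarrow> ps (\<lambda>z. eval2 q z * eval2 R z ^ N / eval2 p z ^ j) x \<Longrightarrow>
    \<exists>K. \<forall>k l. cmod (x (k, l)) * (real k + 1) ^ s * (real l + 1) ^ t \<le> K"
proof -
  have bh: "bihol (\<lambda>z. eval2 q z * eval2 R z ^ N / eval2 p z ^ j) 1 1" for q N j
  proof -
    have "bihol (\<lambda>z. eval2 (q * R ^ N) z / eval2 (p ^ j) z) 1 1"
      by (rule bihol_rational) (simp add: eval2_power nz)
    then show ?thesis by (simp add: eval2_mult eval2_power)
  qed
  have ex: "\<exists>y. ps (\<lambda>z. eval2 q z * eval2 R z ^ N / eval2 p z ^ j) y" for q N j
    by (rule bihol_ps[OF bh[of q N j]]) auto
  have base: "\<exists>K. \<forall>k l. cmod (x (k, l)) * (real k + 1) ^ 0 * (real l + 1) ^ 0 \<le> K"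
    if N: "j \<le> N" and x: "ps (\<lambda>z. eval2 q z * eval2 R z ^ N / eval2 p z ^ j) x" for q N j x
  proof -
    obtain Mq where Mq: "Mq > 0" "\<And>z1 z2. cmod z1 \<le> 1 \<Longrightarrow> cmod z2 \<le> 1 \<Longrightarrow> cmod (eval2 q (z1, z2)) \<le> Mq"
      by (rule eval2_bounded[of 1 1 q]) blast
    obtain MR where MR: "MR > 0" "\<And>z1 z2. cmod z1 \<le> 1 \<Longrightarrow> cmod z2 \<le> 1 \<Longrightarrow> cmod (eval2 R (z1, z2)) \<le> MR"
      by (rule eval2_bounded[of 1 1 R]) blast
    have "cmod (x (k, l)) * 1 ^ k * 1 ^ l \<le> Mq * MR ^ (N - j) * C ^ j" for k l
    proof (rule ps_coeff_bound[OF x bh])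
      fix z1 z2 :: complex assume z: "cmod z1 < 1" "cmod z2 < 1"
      have "cmod (eval2 q (z1, z2) * eval2 R (z1, z2) ^ N / eval2 p (z1, z2) ^ j)
          = cmod (eval2 q (z1, z2)) * cmod (eval2 R (z1, z2)) ^ (N - j) * (cmod (eval2 R (z1, z2)) / cmod (eval2 p (z1, z2))) ^ j"
        using N by (simp add: norm_mult norm_divide norm_power power_divide flip: power_add)
      also have "\<dots> \<le> Mq * MR ^ (N - j) * C ^ j"
        using z nz[OF z] le[OF z] Mq MR
        by (intro mult_mono power_mono mult_nonneg_nonneg) (auto simp: divide_le_eq mult.commute)
      finally show "cmod (eval2 q (z1, z2) * eval2 R (z1, z2) ^ N / eval2 p (z1, z2) ^ j) \<le> Mq * MR ^ (N - j) * C ^ j" .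
    qed auto
    then show ?thesis by auto
  qed
  define q1 where "q1 D q N j = D q * R * p + smult [:of_nat (Suc N):] (q * D R * p) - smult [:of_nat j:] (q * R * D p)"
    for D :: "complex poly poly \<Rightarrow> complex poly poly" and q N j
  have ev_q1: "eval2 (q1 D q N j) z = eval2 (D q) z * eval2 R z * eval2 p z + of_nat (Suc N) * (eval2 q z * eval2 (D R) z * eval2 p z)
      - of_nat j * (eval2 q z * eval2 R z * eval2 (D p) z)" for D q N j z
    unfolding q1_def by (simp only: eval2_add eval2_diff eval2_mult eval2_smult)
  \<comment> \<open>Decay in \<open>l\<close> alone is the base for the induction on
    \<open>s\<close>. The numerator and both exponents change with every derivative and must stay
    arbitrary.\<close>
  have col: "\<exists>K. \<forall>k l. cmod (x (k, l)) * (real k + 1) ^ 0 * (real l + 1) ^ t \<le> K"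
    if "j + 2 * t \<le> N" "ps (\<lambda>z. eval2 q z * eval2 R z ^ N / eval2 p z ^ j) x" for q N j x
    using that
  proof (induction t arbitrary: q N j x)
    case 0
    then show ?case using base by simp
  next
    case (Suc t)
    obtain M where M: "N = Suc M" using Suc.prems(1) by (cases N) auto
    obtain y where y: "ps (\<lambda>z. eval2 (q1 pderiv q M j) z * eval2 R z ^ M / eval2 p z ^ Suc j) y" using ex by blast
    have yx: "y (k, l) = of_nat (Suc l) * x (k, Suc l)" for k l
    proof (rule ps_deriv_2[OF Suc.prems(2) y])
      fix z1 z2 :: complex assume z: "cmod z1 < 1" "cmod z2 < 1"
      show "((\<lambda>w. eval2 q (z1, w) * eval2 R (z1, w) ^ N / eval2 p (z1, w) ^ j) has_field_derivative
          eval2 (q1 pderiv q M j) (z1, z2) * eval2 R (z1, z2) ^ M / eval2 p (z1, z2) ^ Suc j) (at z2)"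
        unfolding ev_q1 M by (rule DERIV_power_quotient[OF eval2_DERIV_2 eval2_DERIV_2 eval2_DERIV_2 nz[OF z]])
    qed
    obtain K1 where K1: "\<And>k l. cmod (y (k, l)) * (real k + 1) ^ 0 * (real l + 1) ^ t \<le> K1"
      using Suc.IH[OF _ y] Suc.prems(1) M by auto
    obtain K2 where K2: "\<And>k l. cmod (x (k, l)) * (real k + 1) ^ 0 * (real l + 1) ^ t \<le> K2"
      using Suc.IH[OF _ Suc.prems(2)] Suc.prems(1) by auto
    \<comment> \<open>With the indices exchanged, the step for \<open>k\<close> serves for
      \<open>l\<close>.\<close>
    have "\<exists>K. \<forall>k l. cmod (x (prod.swap (k, l))) * (real k + 1) ^ Suc t * (real l + 1) ^ 0 \<le> K"
    proof (rule coeff_decay_step[where y = "\<lambda>i. y (prod.swap i)" and x = "\<lambda>i. x (prod.swap i)"])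
      show "y (prod.swap (k, l)) = of_nat (Suc k) * x (prod.swap (Suc k, l))" for k l
        by (simp only: swap_simp yx)
      show "\<exists>K. \<forall>k l. cmod (y (prod.swap (k, l))) * (real k + 1) ^ t * (real l + 1) ^ 0 \<le> K"
        using K1 by (intro exI[of _ K1]) simp
      show "\<exists>K. \<forall>k l. cmod (x (prod.swap (k, l))) * (real k + 1) ^ t * (real l + 1) ^ 0 \<le> K"
        using K2 by (intro exI[of _ K2]) simp
    qed
    then obtain K3 where "\<And>k l. cmod (x (l, k)) * (real k + 1) ^ Suc t * (real l + 1) ^ 0 \<le> K3" by auto
    then show ?case by (intro exI[of _ K3]) (simp add: mult_ac)
  qed
  show "\<exists>K. \<forall>k l. cmod (x (k, l)) * (real k + 1) ^ s * (real l + 1) ^ t \<le> K"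
    if "j + 2 * (s + t) \<le> N" "ps (\<lambda>z. eval2 q z * eval2 R z ^ N / eval2 p z ^ j) x"
    using that
  proof (induction s arbitrary: q N j x)
    case 0
    then show ?case using col by simp
  next
    case (Suc s)
    obtain M where M: "N = Suc M" using Suc.prems(1) by (cases N) auto
    obtain y where y: "ps (\<lambda>z. eval2 (q1 (map_poly pderiv) q M j) z * eval2 R z ^ M / eval2 p z ^ Suc j) y" using ex by blast
    have yx: "y (k, l) = of_nat (Suc k) * x (Suc k, l)" for k l
    proof (rule ps_deriv_1[OF Suc.prems(2) y])
      fix z1 z2 :: complex assume z: "cmod z1 < 1" "cmod z2 < 1"
      show "((\<lambda>w. eval2 q (w, z2) * eval2 R (w, z2) ^ N / eval2 p (w, z2) ^ j) has_field_derivative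
          eval2 (q1 (map_poly pderiv) q M j) (z1, z2) * eval2 R (z1, z2) ^ M / eval2 p (z1, z2) ^ Suc j) (at z1)"
        unfolding ev_q1 M by (rule DERIV_power_quotient[OF eval2_DERIV_1 eval2_DERIV_1 eval2_DERIV_1 nz[OF z]])
    qed
    show ?case
    proof (rule coeff_decay_step[OF yx])
      show "\<exists>K. \<forall>k l. cmod (y (k, l)) * (real k + 1) ^ s * (real l + 1) ^ t \<le> K"
        by (rule Suc.IH[OF _ y]) (use Suc.prems(1) M in simp)
      show "\<exists>K. \<forall>k l. cmod (x (k, l)) * (real k + 1) ^ s * (real l + 1) ^ t \<le> K"
        by (rule Suc.IH[OF _ Suc.prems(2)]) (use Suc.prems(1) in simp)
    qed
  qed
qed

lemma summable_on_powr: "\<gamma> < -1 \<Longrightarrow> (\<lambda>k. (real k + 1) powr \<gamma>) summable_on UNIV"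
proof (rule summable_nonneg_imp_summable_on)
  assume "\<gamma> < -1"
  then have "summable (\<lambda>k. real k powr \<gamma>)" by (simp add: summable_real_powr_iff)
  then have "summable (\<lambda>k. real (Suc k) powr \<gamma>)" by (subst summable_Suc_iff)
  then show "summable (\<lambda>k. (real k + 1) powr \<gamma>)" by (simp add: add.commute)
qed simp

text \<open>After squaring, decay of order \<open>S\<close> exceeds \<open>\<alpha>1\<close> by two
  powers, and likewise \<open>T\<close> exceeds \<open>\<alpha>2\<close>; what remains is
  summable.\<close>

lemma decay_l2:
  assumes x: "\<And>s t. s \<le> S \<Longrightarrow> t \<le> T \<Longrightarrow> \<exists>K. \<forall>k l. cmod (x (k, l)) * (real k + 1) ^ s * (real l + 1) ^ t \<le> K"
    and S: "\<alpha>1 + 2 \<le> 2 * real S" and T: "\<alpha>2 + 2 \<le> 2 * real T"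
  shows "\<exists>C. sqle (wt \<alpha>1 \<alpha>2) x C"
proof -
  obtain K where K: "\<And>k l. cmod (x (k, l)) * (real k + 1) ^ S * (real l + 1) ^ T \<le> K" using x[of S T] by blast
  define g where "g = (\<lambda>(k, l). (real k + 1) powr -2 * (real l + 1) powr -2)"
  have g: "g summable_on UNIV" unfolding g_def by (intro summable_on_product summable_on_powr) auto
  have one: "(real k + 1) powr a * y \<le> (real k + 1) powr -2 * ((real k + 1) ^ U)\<^sup>2 * y"
    if "a + 2 \<le> 2 * real U" "0 \<le> y" for a U y k
  proof (rule mult_right_mono)
    have "(real k + 1) powr a \<le> (real k + 1) powr (-2 + real (U * 2))" using that by (intro powr_mono) auto
    also have "\<dots> = (real k + 1) powr -2 * (real k + 1) powr real (U * 2)" by (rule powr_add)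
    also have "(real k + 1) powr real (U * 2) = ((real k + 1) ^ U)\<^sup>2"
      by (subst powr_realpow) (simp_all add: power_mult)
    finally show "(real k + 1) powr a \<le> (real k + 1) powr -2 * ((real k + 1) ^ U)\<^sup>2" .
  qed (use that in simp)
  have pt: "wt \<alpha>1 \<alpha>2 i * (cmod (x i))\<^sup>2 \<le> K\<^sup>2 * g i" for i
  proof (cases i)
    case (Pair k l)
    have "wt \<alpha>1 \<alpha>2 i * (cmod (x i))\<^sup>2 = (real k + 1) powr \<alpha>1 * ((real l + 1) powr \<alpha>2 * (cmod (x i))\<^sup>2)"
      by (simp add: Pair wt_def)
    also have "\<dots> \<le> (real k + 1) powr -2 * ((real k + 1) ^ S)\<^sup>2 * ((real l + 1) powr \<alpha>2 * (cmod (x i))\<^sup>2)"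
      by (rule one[OF S]) simp
    also have "\<dots> \<le> (real k + 1) powr -2 * ((real k + 1) ^ S)\<^sup>2 * ((real l + 1) powr -2 * ((real l + 1) ^ T)\<^sup>2 * (cmod (x i))\<^sup>2)"
      by (intro mult_left_mono one[OF T]) auto
    also have "\<dots> = g i * (cmod (x (k, l)) * (real k + 1) ^ S * (real l + 1) ^ T)\<^sup>2"
      by (simp add: Pair g_def power_mult_distrib)
    also have "\<dots> \<le> g i * K\<^sup>2" by (intro mult_left_mono power_mono K) (auto simp: g_def Pair)
    finally show ?thesis by (simp add: mult.commute)
  qed
  have "sqle (wt \<alpha>1 \<alpha>2) x (K\<^sup>2 * infsum g UNIV)"
    by (rule sqle_comparison[OF pt g]) (auto simp: g_def)
  then show ?thesis by blast
qed

section \<open>Cyclic polynomials\<close>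

text \<open>A high power \<open>P\<close> of \<open>r0\<close> equals \<open>p\<close> times a
  series of finite norm, so it lies in the subspace of \<open>p\<close>. Its dilation quotients live
  on \<open>l = 0\<close>, where the weight is \<open>(real k + 1) powr \<alpha>1\<close> and
  \<open>\<alpha>1 \<le> 1\<close> bounds them.\<close>

lemma cyclic_if_dominates_one_variable_factor:
  assumes nz: "\<And>z1 z2. cmod z1 < 1 \<Longrightarrow> cmod z2 \<le> 1 \<Longrightarrow> eval2 p (z1, z2) \<noteq> 0"
    and r: "r \<noteq> 0"
    and le: "\<And>z1 z2. cmod z1 < 1 \<Longrightarrow> cmod z2 < 1 \<Longrightarrow> cmod (poly r z1) \<le> C * cmod (eval2 p (z1, z2))"
    and \<alpha>: "\<alpha>1 \<le> 1"
  shows "pc 1 \<in> inv_closure \<alpha>1 \<alpha>2 p"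
proof -
  obtain r0 r1 where rr: "r = r0 * r1" and r0: "\<And>z. poly r0 z = 0 \<Longrightarrow> cmod z = 1" and r1: "\<And>z. cmod z = 1 \<Longrightarrow> poly r1 z \<noteq> 0"
    using polynomial_circle_split[OF r] by blast
  \<comment> \<open>Near the circle \<open>r1\<close> is bounded below and may be cancelled; for
    \<open>cmod z1 < \<rho>\<close> the polynomial \<open>p\<close> itself is bounded below, and any
    bound on \<open>r0\<close> will do.\<close>
  have "\<exists>C'. \<forall>z1 z2. cmod z1 < 1 \<longrightarrow> cmod z2 < 1 \<longrightarrow> cmod (poly r0 z1) \<le> C' * cmod (eval2 p (z1, z2))"
  proof -
    have "continuous_on (sphere 0 1) (\<lambda>z. cmod (poly r1 z))" by (intro continuous_intros)
    from continuous_attains_inf[OF compact_sphere _ this] obtain z0 where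
      z0: "cmod z0 = 1" "\<And>z. cmod z = 1 \<Longrightarrow> cmod (poly r1 z0) \<le> cmod (poly r1 z)" by auto
    define c where "c = cmod (poly r1 z0) / 2"
    have c: "c > 0" using r1[OF z0(1)] by (simp add: c_def)
    define U where "U = {z. c < cmod (poly r1 z)}"
    have U: "open U" unfolding U_def by (intro open_Collect_less continuous_intros)
    have KU: "sphere 0 1 \<subseteq> U"
    proof
      fix z :: complex assume "z \<in> sphere 0 1"
      then have "cmod (poly r1 z0) \<le> cmod (poly r1 z)" using z0 by simp
      then show "z \<in> U" using c unfolding U_def c_def mem_Collect_eq by linarith
    qed
    obtain e where e: "e > 0" "{z. infdist z (sphere 0 1) \<le> e} \<subseteq> U"
      using compact_in_open_separated[OF _ compact_sphere U KU] by auto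
    define \<rho> where "\<rho> = max (1 - e) (1/2)"
    have \<rho>: "0 < \<rho>" "\<rho> < 1" "1 - e \<le> \<rho>" using e by (auto simp: \<rho>_def)
    have near: "c < cmod (poly r1 z)" if z: "\<rho> \<le> cmod z" "cmod z < 1" for z
    proof -
      have z0: "z \<noteq> 0" using z \<rho> by auto
      have "infdist z (sphere 0 1) \<le> dist z (sgn z)" using z0 by (intro infdist_le) (simp add: norm_sgn)
      also have "dist z (sgn z) = cmod ((1 - 1 / cmod z) *\<^sub>R z)" by (simp add: dist_norm sgn_div_norm algebra_simps divide_inverse)
      also have "\<dots> = 1 - cmod z" using z z0 by (simp add: abs_if field_simps)
      also have "\<dots> \<le> e" using z \<rho> by linarith
      finally show ?thesis using e(2) by (auto simp: U_def)
    qed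
    have "eval2 p (z1, z2) \<noteq> 0" if "cmod z1 \<le> \<rho>" "cmod z2 \<le> 1" for z1 z2 using that \<rho> by (intro nz) auto
    from polydisc_lower_bound[OF continuous_on_eval2 less_imp_le[OF \<rho>(1)] zero_le_one this] obtain \<delta> c2 where c2: "\<delta> > 0" "c2 > 0"
      "\<And>z1 z2. cmod z1 < \<rho> + \<delta> \<Longrightarrow> cmod z2 < 1 + \<delta> \<Longrightarrow> c2 \<le> cmod (eval2 p (z1, z2))" by auto
    obtain M0 where M0: "M0 > 0" "\<And>z1 z2. cmod z1 \<le> 1 \<Longrightarrow> cmod z2 \<le> 1 \<Longrightarrow> cmod (eval2 [:r0:] (z1, z2)) \<le> M0"
      by (rule eval2_bounded[of 1 1 "[:r0:]"]) blast
    have "cmod (poly r0 z1) \<le> max (C / c) (M0 / c2) * cmod (eval2 p (z1, z2))" if z: "cmod z1 < 1" "cmod z2 < 1" for z1 z2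
    proof (cases "\<rho> \<le> cmod z1")
      case True
      have "c * cmod (poly r0 z1) \<le> cmod (poly r1 z1) * cmod (poly r0 z1)"
        using near[OF True z(1)] by (intro mult_right_mono) auto
      also have "\<dots> \<le> C * cmod (eval2 p (z1, z2))" using le[OF z] by (simp add: rr norm_mult mult.commute)
      finally have "cmod (poly r0 z1) \<le> C / c * cmod (eval2 p (z1, z2))" using c by (simp add: field_simps)
      also have "\<dots> \<le> max (C / c) (M0 / c2) * cmod (eval2 p (z1, z2))" by (intro mult_right_mono) auto
      finally show ?thesis .
    next
      case False
      have "cmod (poly r0 z1) \<le> M0" using M0(2)[of z1 z2] z by (simp add: eval2_const)
      also have "M0 = M0 / c2 * c2" using c2 by simp
      also have "\<dots> \<le> M0 / c2 * cmod (eval2 p (z1, z2))"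
        using c2 M0 False z by (intro mult_left_mono c2(3)) auto
      also have "\<dots> \<le> max (C / c) (M0 / c2) * cmod (eval2 p (z1, z2))" by (intro mult_right_mono) auto
      finally show ?thesis .
    qed
    then show ?thesis by blast
  qed
  then obtain C' where C': "\<And>z1 z2. cmod z1 < 1 \<Longrightarrow> cmod z2 < 1 \<Longrightarrow> cmod (eval2 [:r0:] (z1, z2)) \<le> C' * cmod (eval2 p (z1, z2))"
    by (auto simp: eval2_const)
  have nz': "eval2 p (z1, z2) \<noteq> 0" if "cmod z1 < 1" "cmod z2 < 1" for z1 z2 using nz that by simp
  obtain S :: nat where S: "\<alpha>1 + 2 \<le> 2 * real S" using real_arch_simple[of "(\<alpha>1 + 2) / 2"] by (auto simp: field_simps)
  obtain T :: nat where T: "\<alpha>2 + 2 \<le> 2 * real T" using real_arch_simple[of "(\<alpha>2 + 2) / 2"] by (auto simp: field_simps)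
  \<comment> \<open>One power pays for the division by \<open>p\<close>, and two for each of the
    \<open>S + T\<close> derivatives.\<close>
  define N where "N = 1 + 2 * (S + T)"
  define P where "P = [:r0:] ^ N"
  have evP: "eval2 P (z1, z2) = poly r0 z1 ^ N" for z1 z2 by (simp add: P_def eval2_power eval2_const)
  have "bihol (\<lambda>z. eval2 P z / eval2 p z) 1 1" by (rule bihol_rational) (rule nz')
  then obtain x where x: "ps (\<lambda>z. eval2 P z / eval2 p z) x"
    by (rule bihol_ps) auto
  have x': "ps (\<lambda>z. eval2 1 z * eval2 [:r0:] z ^ N / eval2 p z ^ 1) x" using x by (simp add: P_def eval2_power eval2_1)
  have "\<exists>C. sqle (wt \<alpha>1 \<alpha>2) x C"
  proof (rule decay_l2[OF _ S T])
    fix s t assume "s \<le> S" "t \<le> T"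
    then show "\<exists>K. \<forall>k l. cmod (x (k, l)) * (real k + 1) ^ s * (real l + 1) ^ t \<le> K"
      by (intro smooth_quotient_decay[OF nz' C' _ x']) (simp_all add: N_def)
  qed
  then obtain X where X: "sqle (wt \<alpha>1 \<alpha>2) x X" by blast
  have "mul p x \<in> inv_closure \<alpha>1 \<alpha>2 p"
    using inv_closure_mul_l2[OF _ X] inv_closure_self[of 1 p] by simp
  moreover have "mul p x = pc P"
  proof (rule ps_unique[OF ps_on_mul[OF x]])
    show "ps (\<lambda>z. eval2 p z * (eval2 P z / eval2 p z)) (pc P)"
      by (subst ps_on_cong[of 1 1 _ "eval2 P"]) (simp_all add: nz' ps_on_eval2)
  qed
  ultimately have PI: "pc P \<in> inv_closure \<alpha>1 \<alpha>2 p" by simp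
  have nzP: "eval2 P (z1, z2) \<noteq> 0" if "cmod z1 < 1" for z1 z2 using r0[of z1] that by (auto simp: evP)
  obtain B where B: "\<And>\<rho> y. 0 < \<rho> \<Longrightarrow> \<rho> < 1 \<Longrightarrow> ps (\<lambda>z. eval2 P z / eval2 (dil \<rho> P) z) y \<Longrightarrow> sqle (\<lambda>(k, l). real k + 1) y B"
    by (rule dilate_quotient_bound[of P]) (use nzP in auto)
  show ?thesis
  proof (rule dilation_approximation[OF nzP _ PI])
    fix \<rho> y assume \<rho>: "0 < \<rho>" "\<rho> < 1" and y: "ps (\<lambda>z. eval2 P z / eval2 (dil \<rho> P) z) y"
    \<comment> \<open>The quotient does not involve \<open>z2\<close>, so comparison with its zero
      derivative removes every coefficient with positive second index.\<close>
    have y0: "y (k, Suc l) = 0" for k l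
    proof -
      have "(0::complex) = of_nat (Suc l) * y (k, Suc l)"
      proof (rule ps_deriv_2[OF y ps_on_0])
        fix z1 z2 :: complex
        show "((\<lambda>w. eval2 P (z1, w) / eval2 (dil \<rho> P) (z1, w)) has_field_derivative 0) (at z2)"
          by (simp add: eval2_dil evP)
      qed
      then show ?thesis by (simp del: of_nat_Suc)
    qed
    show "sqle (wt \<alpha>1 \<alpha>2) y B"
      unfolding sqle_def
    proof (intro allI impI)
      fix F :: "(nat \<times> nat) set" assume F: "finite F"
      have "(\<Sum>i\<in>F. wt \<alpha>1 \<alpha>2 i * (cmod (y i))\<^sup>2) \<le> (\<Sum>i\<in>F. (case i of (k, l) \<Rightarrow> real k + 1) * (cmod (y i))\<^sup>2)"
      proof (intro sum_mono)
        fix i :: "nat \<times> nat"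
        obtain k l where i: "i = (k, l)" by force
        show "wt \<alpha>1 \<alpha>2 i * (cmod (y i))\<^sup>2 \<le> (case i of (k, l) \<Rightarrow> real k + 1) * (cmod (y i))\<^sup>2"
        proof (cases l)
          case 0
          have "(real k + 1) powr \<alpha>1 \<le> (real k + 1) powr 1" using \<alpha> by (intro powr_mono) auto
          then show ?thesis by (simp add: i 0 wt_def mult_right_mono)
        next
          case (Suc l')
          then show ?thesis by (simp add: i y0)
        qed
      qed
      also have "\<dots> \<le> B" by (rule sqleD[OF B[OF \<rho> y] F])
      finally show "(\<Sum>i\<in>F. wt \<alpha>1 \<alpha>2 i * (cmod (y i))\<^sup>2) \<le> B" .
    qed
  qed
qed

text \<open>Neighbourhoods of the two closed discs on the coordinate axes. They supply the pair of
  Cauchy estimates that \<open>sqle_cone\<close> takes as hypotheses.\<close>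

lemma nonvanishing_thin_polydiscs:
  assumes "\<And>z2. cmod z2 \<le> 1 \<Longrightarrow> eval2 p (0, z2) \<noteq> 0" "\<And>z1. cmod z1 \<le> 1 \<Longrightarrow> eval2 p (z1, 0) \<noteq> 0"
  obtains s R c where "0 < s" "1 < R" "c > 0"
    "\<And>z1 z2. cmod z1 < s \<Longrightarrow> cmod z2 < R \<Longrightarrow> c \<le> cmod (eval2 p (z1, z2))"
    "\<And>z1 z2. cmod z1 < R \<Longrightarrow> cmod z2 < s \<Longrightarrow> c \<le> cmod (eval2 p (z1, z2))"
proof -
  have 1: "eval2 p (z1, z2) \<noteq> 0" if "cmod z1 \<le> 0" "cmod z2 \<le> 1" for z1 z2 using assms(1) that by simp
  have 2: "eval2 p (z1, z2) \<noteq> 0" if "cmod z1 \<le> 1" "cmod z2 \<le> 0" for z1 z2 using assms(2) that by simp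
  from polydisc_lower_bound[OF continuous_on_eval2 order_refl zero_le_one 1] obtain d c where dc: "d > 0" "c > 0"
      "\<And>z1 z2. cmod z1 < 0 + d \<Longrightarrow> cmod z2 < 1 + d \<Longrightarrow> c \<le> cmod (eval2 p (z1, z2))" by auto
  from polydisc_lower_bound[OF continuous_on_eval2 zero_le_one order_refl 2] obtain d' c' where dc': "d' > 0" "c' > 0"
      "\<And>z1 z2. cmod z1 < 1 + d' \<Longrightarrow> cmod z2 < 0 + d' \<Longrightarrow> c' \<le> cmod (eval2 p (z1, z2))" by auto
  show ?thesis
  proof (rule that[of "min d d'" "1 + min d d'" "min c c'"])
    fix z1 z2 :: complex
    show "min c c' \<le> cmod (eval2 p (z1, z2))" if "cmod z1 < min d d'" "cmod z2 < 1 + min d d'"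
    proof -
      have "cmod z1 < 0 + d" "cmod z2 < 1 + d" using that by linarith+
      from dc(3)[OF this] show ?thesis by linarith
    qed
    show "min c c' \<le> cmod (eval2 p (z1, z2))" if "cmod z1 < 1 + min d d'" "cmod z2 < min d d'"
    proof -
      have "cmod z1 < 1 + d'" "cmod z2 < 0 + d'" using that by linarith+
      from dc'(3)[OF this] show ?thesis by linarith
    qed
  qed (use dc dc' in auto)
qed

lemma cyclic_small_exponents:
  assumes nz1: "\<And>z1 z2. cmod z1 < 1 \<Longrightarrow> cmod z2 \<le> 1 \<Longrightarrow> eval2 p (z1, z2) \<noteq> 0"
    and nz2: "\<And>z1 z2. cmod z1 \<le> 1 \<Longrightarrow> cmod z2 < 1 \<Longrightarrow> eval2 p (z1, z2) \<noteq> 0"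
    and \<alpha>: "\<alpha>1 + \<alpha>2 \<le> 1"
  shows "pc 1 \<in> inv_closure \<alpha>1 \<alpha>2 p"
proof -
  obtain s R c where sR: "0 < s" "1 < R" and c: "c > 0"
    and lb1: "\<And>z1 z2. cmod z1 < s \<Longrightarrow> cmod z2 < R \<Longrightarrow> c \<le> cmod (eval2 p (z1, z2))"
    and lb2: "\<And>z1 z2. cmod z1 < R \<Longrightarrow> cmod z2 < s \<Longrightarrow> c \<le> cmod (eval2 p (z1, z2))"
    by (rule nonvanishing_thin_polydiscs[of p]) (use nz1 nz2 in auto)
  define m where "m = max s R"
  obtain M where M: "M > 0" "\<And>z1 z2. cmod z1 \<le> m \<Longrightarrow> cmod z2 \<le> m \<Longrightarrow> cmod (eval2 p (z1, z2)) \<le> M"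
    by (rule eval2_bounded[of m m p]) blast
  obtain B where B: "\<And>\<rho> y. 0 < \<rho> \<Longrightarrow> \<rho> < 1 \<Longrightarrow> ps (\<lambda>z. eval2 p z / eval2 (dil \<rho> p) z) y \<Longrightarrow> sqle (\<lambda>(k, l). real k + 1) y B"
    by (rule dilate_quotient_bound[of p]) (use nz1 in auto)
  obtain K D where K: "K \<ge> 0" and KD:
    "\<And>x C E. (\<And>k l. cmod (x (k, l)) * s ^ k * R ^ l \<le> C) \<Longrightarrow> (\<And>k l. cmod (x (k, l)) * R ^ k * s ^ l \<le> C) \<Longrightarrow>
      sqle (\<lambda>(k, l). (real k + 1) powr (\<alpha>1 + \<alpha>2)) x E \<Longrightarrow> sqle (wt \<alpha>1 \<alpha>2) x (K * E + C\<^sup>2 * D)"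
    by (rule sqle_cone[OF sR, where ?\<beta>1.0 = \<alpha>1 and ?\<beta>2.0 = \<alpha>2]) blast
  show ?thesis
  proof (rule dilation_approximation[OF nz1])
    show "pc p \<in> inv_closure \<alpha>1 \<alpha>2 p" using inv_closure_self[of 1 p] by simp
    fix \<rho> y assume \<rho>: "0 < \<rho>" "\<rho> < 1" and y: "ps (\<lambda>z. eval2 p z / eval2 (dil \<rho> p) z) y"
    \<comment> \<open>Dilation maps the thin polydiscs into themselves, so the lower bound for
      \<open>p\<close> serves all dilates and the estimate is uniform in
      \<open>\<rho>\<close>.\<close>
    have shrink: "cmod (of_real \<rho> * z) \<le> cmod z" for z :: complex
      unfolding norm_mult using \<rho> by (simp add: mult_left_le_one_le)
    have quot: "cmod (y (k, l)) * r1 ^ k * r2 ^ l \<le> M / c"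
      if r: "0 < r1" "0 < r2" "r1 \<le> m" "r2 \<le> m" and lb: "\<And>z1 z2. cmod z1 < r1 \<Longrightarrow> cmod z2 < r2 \<Longrightarrow> c \<le> cmod (eval2 p (z1, z2))" for r1 r2 k l
    proof (rule ps_coeff_bound[OF y _ r(1,2)])
      have lb': "c \<le> cmod (eval2 (dil \<rho> p) (z1, z2))" if "cmod z1 < r1" "cmod z2 < r2" for z1 z2
        unfolding eval2_dil by (rule lb[OF order_le_less_trans[OF shrink that(1)] that(2)])
      show "bihol (\<lambda>z. eval2 p z / eval2 (dil \<rho> p) z) r1 r2"
        using lb' c by (intro bihol_rational) fastforce
      fix z1 z2 :: complex assume z: "cmod z1 < r1" "cmod z2 < r2"
      show "cmod (eval2 p (z1, z2) / eval2 (dil \<rho> p) (z1, z2)) \<le> M / c"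
        unfolding norm_divide using M z r c lb'[OF z] by (intro frac_le M(2)) auto
    qed
    have "sqle (\<lambda>(k, l). (real k + 1) powr (\<alpha>1 + \<alpha>2)) y B"
    proof (rule sqle_weight_mono[OF B[OF \<rho> y]])
      fix i :: "nat \<times> nat"
      obtain k l where i: "i = (k, l)" by force
      have "(real k + 1) powr (\<alpha>1 + \<alpha>2) \<le> (real k + 1) powr 1" using \<alpha> by (intro powr_mono) auto
      then show "(case i of (k, l) \<Rightarrow> (real k + 1) powr (\<alpha>1 + \<alpha>2)) \<le> (case i of (k, l) \<Rightarrow> real k + 1)" by (simp add: i)
    qed
    with KD[of y "M / c"] show "sqle (wt \<alpha>1 \<alpha>2) y (K * B + (M / c)\<^sup>2 * D)"
      using quot[of s R] quot[of R s] sR lb1 lb2 by (simp add: m_def)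
  qed
qed

text \<open>The reciprocal of \<open>p\<close> belongs to the space for every pair of exponents and
  multiplies \<open>p\<close> to 1.\<close>

lemma cyclic_nonvanishing:
  assumes "\<And>z1 z2. cmod z1 \<le> 1 \<Longrightarrow> cmod z2 \<le> 1 \<Longrightarrow> eval2 p (z1, z2) \<noteq> 0"
  shows "pc 1 \<in> inv_closure \<alpha>1 \<alpha>2 p"
proof -
  obtain g G where g: "ps (\<lambda>z. 1 / eval2 p z) g" and G: "sqle (wt \<alpha>1 \<alpha>2) g G"
    using reciprocal_l2[OF assms] by blast
  have "mul p g \<in> inv_closure \<alpha>1 \<alpha>2 p"
    using inv_closure_mul_l2[OF _ G] inv_closure_self[of 1 p] by simp
  moreover have "mul p g = pc 1"
  proof (rule ps_unique[OF ps_on_mul[OF g]])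
    show "ps (\<lambda>z. eval2 p z * (1 / eval2 p z)) (pc 1)"
      by (subst ps_on_cong[of 1 1 _ "eval2 1"]) (simp_all add: assms ps_on_eval2 eval2_1)
  qed
  ultimately show ?thesis by simp
qed

section \<open>Non-cyclic polynomials\<close>

text \<open>The functional is evaluation at a torus zero. Exponents above 1 make the reciprocal
  weights summable, hence the evaluation bounded.\<close>

lemma not_cyclic_point_evaluation:
  assumes \<alpha>: "\<alpha>1 > 1" "\<alpha>2 > 1" and \<zeta>: "cmod \<zeta>1 = 1" "cmod \<zeta>2 = 1" and z: "eval2 p (\<zeta>1, \<zeta>2) = 0"
  shows "\<not> cyclic \<alpha>1 \<alpha>2 (eval2 p)"
proof (rule not_cyclic_by_functional[where b = "\<lambda>(k, l). \<zeta>1 ^ k * \<zeta>2 ^ l" and ?i0.0 = "(0, 0)"])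
  define g where "g = (\<lambda>(k, l). (real k + 1) powr (- \<alpha>1) * (real l + 1) powr (- \<alpha>2))"
  have g: "g summable_on UNIV" unfolding g_def using \<alpha> by (intro summable_on_product summable_on_powr) auto
  show "sqle (\<lambda>i. 1 / wt \<alpha>1 \<alpha>2 i) (\<lambda>(k, l). \<zeta>1 ^ k * \<zeta>2 ^ l) (1 * infsum g UNIV)"
    by (rule sqle_comparison[OF _ g]) (auto simp: g_def wt_def norm_mult norm_power \<zeta> powr_minus divide_inverse)
  fix k l
  have "(\<Sum>(i, j)\<in>{ij. pc p ij \<noteq> 0}. pc p (i, j) * (case (k + i, l + j) of (k, l) \<Rightarrow> \<zeta>1 ^ k * \<zeta>2 ^ l))
      = \<zeta>1 ^ k * \<zeta>2 ^ l * (\<Sum>(i, j)\<in>{ij. pc p ij \<noteq> 0}. pc p (i, j) * \<zeta>1 ^ i * \<zeta>2 ^ j)"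
    by (simp add: sum_distrib_left case_prod_unfold power_add mult_ac)
  also have "\<dots> = 0" using z eval2_expand[OF finite_pc order_refl, of p \<zeta>1 \<zeta>2] by simp
  finally show "(\<Sum>(i, j)\<in>{ij. pc p ij \<noteq> 0}. pc p (i, j) * (case (k + i, l + j) of (k, l) \<Rightarrow> \<zeta>1 ^ k * \<zeta>2 ^ l)) = 0" .
qed simp

text \<open>The annihilating functional is given by the conjugated coefficients of the logarithmic
  derivative of \<open>p\<close> in \<open>z1\<close>: multiplying it by \<open>p\<close> leaves a polynomial of degree less than \<open>n\<close>
  in \<open>z1\<close>, and self-reflectivity turns this into the required recurrence.\<close>

lemma not_cyclic_self_reflective:
  assumes nz1: "\<And>z1 z2. cmod z1 < 1 \<Longrightarrow> cmod z2 \<le> 1 \<Longrightarrow> eval2 p (z1, z2) \<noteq> 0"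
    and nz2: "\<And>z1 z2. cmod z1 \<le> 1 \<Longrightarrow> cmod z2 < 1 \<Longrightarrow> eval2 p (z1, z2) \<noteq> 0"
    and dep: "depends_on_z1 p" and \<alpha>: "\<alpha>1 + \<alpha>2 > 1"
    and supp: "{i. pc p i \<noteq> 0} \<subseteq> {..n} \<times> {..m}"
    and refl: "reflect2 n m p = smult [:c:] p" "c \<noteq> 0"
  shows "\<not> cyclic \<alpha>1 \<alpha>2 (eval2 p)"
proof -
  define d where "d = map_poly pderiv p"
  have pcd: "pc d (k, l) = of_nat (Suc k) * pc p (Suc k, l)" for k l
    by (simp add: d_def pc_apply coeff_map_poly coeff_pderiv)
  have nz: "eval2 p (z1, z2) \<noteq> 0" if "cmod z1 < 1" "cmod z2 < 1" for z1 z2 using nz1 that by simp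
  have "bihol (\<lambda>z. eval2 d z / eval2 p z) 1 1" by (rule bihol_rational) (rule nz)
  then obtain x where x: "ps (\<lambda>z. eval2 d z / eval2 p z) x"
    by (rule bihol_ps) auto
  have mx: "mul p x = pc d"
  proof (rule ps_unique[OF ps_on_mul[OF x]])
    show "ps (\<lambda>z. eval2 p z * (eval2 d z / eval2 p z)) (pc d)"
      by (subst ps_on_cong[of 1 1 _ "eval2 d"]) (simp_all add: nz ps_on_eval2)
  qed
  obtain s R a where sR: "0 < s" "1 < R" and a: "a > 0"
    and lb1: "\<And>z1 z2. cmod z1 < s \<Longrightarrow> cmod z2 < R \<Longrightarrow> a \<le> cmod (eval2 p (z1, z2))"
    and lb2: "\<And>z1 z2. cmod z1 < R \<Longrightarrow> cmod z2 < s \<Longrightarrow> a \<le> cmod (eval2 p (z1, z2))"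
    by (rule nonvanishing_thin_polydiscs[of p]) (use nz1 nz2 in auto)
  define r where "r = max s R"
  obtain M where M: "M > 0" "\<And>z1 z2. cmod z1 \<le> r \<Longrightarrow> cmod z2 \<le> r \<Longrightarrow> cmod (eval2 d (z1, z2)) \<le> M"
    by (rule eval2_bounded[of r r d]) blast
  have quot: "cmod (x (k, l)) * r1 ^ k * r2 ^ l \<le> M / a"
    if rr: "0 < r1" "0 < r2" "r1 \<le> r" "r2 \<le> r" and lb: "\<And>z1 z2. cmod z1 < r1 \<Longrightarrow> cmod z2 < r2 \<Longrightarrow> a \<le> cmod (eval2 p (z1, z2))" for r1 r2 k l
  proof (rule ps_coeff_bound[OF x _ rr(1,2)])
    show "bihol (\<lambda>z. eval2 d z / eval2 p z) r1 r2"
      using lb a by (intro bihol_rational) fastforce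
    fix z1 z2 :: complex assume z: "cmod z1 < r1" "cmod z2 < r2"
    show "cmod (eval2 d (z1, z2) / eval2 p (z1, z2)) \<le> M / a"
      unfolding norm_divide using M z rr a lb[OF z] by (intro frac_le M(2)) auto
  qed
  \<comment> \<open>The exponent of the dual weight on the cone;
    \<open>\<alpha>1 + \<alpha>2 > 1\<close> is what makes its sum over \<open>k\<close> finite
    against slice coefficients bounded by \<open>N\<close>.\<close>
  define \<gamma> where "\<gamma> = - \<alpha>1 + - \<alpha>2"
  have \<gamma>: "\<gamma> < -1" using \<alpha> by (simp add: \<gamma>_def)
  obtain N where N: "\<And>c. degree (poly p [:c:]) \<le> N" using poly_const_degree_bound by blast
  define E where "E = (real N)\<^sup>2 * infsum (\<lambda>k. (real k + 1) powr \<gamma>) UNIV"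
  have xE: "sqle (\<lambda>(k, l). (real k + 1) powr \<gamma>) x E"
  proof (rule sqle_by_slices)
    show "((\<lambda>l. x (k, l) * z ^ l) has_sum (\<Sum>\<^sub>\<infinity>l. x (k, l) * z ^ l)) UNIV" if "cmod z < 1" for k z
      by (rule ps_slice(1)[OF x that])
    fix K and z2 :: complex assume z2: "cmod z2 < 1"
    define P where "P = poly p [:z2:]"
    have nz': "poly P z \<noteq> 0" if "cmod z < 1" for z
      using nz[OF that z2] by (simp add: P_def eval2_poly_const)
    obtain e where e: "\<And>k. cmod (e k) \<le> real (degree P)"
      "\<And>z. cmod z < 1 \<Longrightarrow> (\<lambda>k. e k * z ^ k) sums (poly (pderiv P) z / poly P z)"
      using polynomial_logderiv_coeffs[OF HOL.refl nz'] by blast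
    have "e = (\<lambda>k. \<Sum>\<^sub>\<infinity>l. x (k, l) * z2 ^ l)"
    proof (rule sums_powser_unique[OF e(2)])
      fix z :: complex assume z: "cmod z < 1"
      show "((\<lambda>k. (\<Sum>\<^sub>\<infinity>l. x (k, l) * z2 ^ l) * z ^ k) has_sum poly (pderiv P) z / poly P z) UNIV"
        using ps_slice(2)[OF x z2 z] by (simp add: P_def eval2_poly_const poly_map_pderiv d_def)
    qed
    moreover have "cmod (e k) \<le> real N" for k using e(1)[of k] N[of z2] by (simp add: P_def)
    ultimately have ek: "cmod (\<Sum>\<^sub>\<infinity>l. x (k, l) * z2 ^ l) \<le> real N" for k by metis
    have "(\<Sum>k<K. (real k + 1) powr \<gamma> * (cmod (\<Sum>\<^sub>\<infinity>l. x (k, l) * z2 ^ l))\<^sup>2) \<le> (\<Sum>k<K. (real k + 1) powr \<gamma> * (real N)\<^sup>2)"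
      by (intro sum_mono mult_left_mono power_mono ek) auto
    also have "\<dots> = (real N)\<^sup>2 * (\<Sum>k<K. (real k + 1) powr \<gamma>)" by (simp add: sum_distrib_left mult.commute)
    also have "\<dots> \<le> E" unfolding E_def
      by (intro mult_left_mono finite_sum_le_infsum summable_on_powr \<gamma>) auto
    finally show "(\<Sum>k<K. (real k + 1) powr \<gamma> * (cmod (\<Sum>\<^sub>\<infinity>l. x (k, l) * z2 ^ l))\<^sup>2) \<le> E" .
  qed simp
  obtain K D where KD:
    "\<And>x C E. (\<And>k l. cmod (x (k, l)) * s ^ k * R ^ l \<le> C) \<Longrightarrow> (\<And>k l. cmod (x (k, l)) * R ^ k * s ^ l \<le> C) \<Longrightarrow>
      sqle (\<lambda>(k, l). (real k + 1) powr (- \<alpha>1 + - \<alpha>2)) x E \<Longrightarrow> sqle (wt (- \<alpha>1) (- \<alpha>2)) x (K * E + C\<^sup>2 * D)"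
    by (rule sqle_cone[OF sR, where ?\<beta>1.0 = "- \<alpha>1" and ?\<beta>2.0 = "- \<alpha>2"]) blast
  have xl2: "sqle (wt (- \<alpha>1) (- \<alpha>2)) x (K * E + (M / a)\<^sup>2 * D)"
    by (intro KD xE[unfolded \<gamma>_def] quot) (use sR lb1 lb2 in \<open>auto simp: r_def\<close>)
  have wt_inv: "wt (- \<alpha>1) (- \<alpha>2) = (\<lambda>i. 1 / wt \<alpha>1 \<alpha>2 i)"
    by (auto simp: wt_def powr_minus divide_inverse fun_eq_iff)
  have b: "sqle (\<lambda>i. 1 / wt \<alpha>1 \<alpha>2 i) (\<lambda>i. cnj (x i)) (K * E + (M / a)\<^sup>2 * D)"
    using xl2 unfolding wt_inv by (simp add: sqle_def)
  obtain k1 l1 where kl1: "pc p (Suc k1, l1) \<noteq> 0"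
    using dep unfolding depends_on_z1_def pc_apply[symmetric] by (metis gr0_implies_Suc)
  \<comment> \<open>If \<open>x\<close> vanished, so would \<open>mul p x\<close>, the derivative of
    \<open>p\<close> in \<open>z1\<close>; dependence on \<open>z1\<close> excludes that.\<close>
  have "\<exists>i. x i \<noteq> 0"
  proof (rule ccontr)
    assume "\<not> (\<exists>i. x i \<noteq> 0)"
    then have "x = (\<lambda>i. 0)" by auto
    then have "mul p x (k1, l1) = 0" by (simp add: mul_def shift_def case_prod_unfold)
    then show False using kl1 by (simp add: mx pcd del: of_nat_Suc)
  qed
  then obtain i0 where i0: "cnj (x i0) \<noteq> 0" by auto
  have box: "finite ({..n} \<times> {..m})" by simp
  have "(\<Sum>(i, j)\<in>{ij. pc p ij \<noteq> 0}. pc p (i, j) * cnj (x (k + i, l + j))) = 0" for k l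
  proof -
    \<comment> \<open>Self-reflectivity, coefficient by coefficient: it turns the correlation
      required of the functional into the conjugate of a convolution \<open>mul p x\<close>.\<close>
    have pr: "c * pc p (i, j) = cnj (pc p (n - i, m - j))" if "i \<le> n" "j \<le> m" for i j
      using arg_cong[OF refl(1), of "\<lambda>q. pc q (i, j)"] that by (simp add: pc_smult reflect2_def pc_mkp)
    have "c * (\<Sum>(i, j)\<in>{ij. pc p ij \<noteq> 0}. pc p (i, j) * cnj (x (k + i, l + j)))
        = c * (\<Sum>(i, j)\<in>{..n} \<times> {..m}. pc p (i, j) * cnj (x (k + i, l + j)))"
      using supp by (intro arg_cong[where f = "\<lambda>u. c * u"] sum.mono_neutral_left) auto
    also have "\<dots> = (\<Sum>(i, j)\<in>{..n} \<times> {..m}. (\<lambda>i' j'. cnj (pc p (i', j') * x (k + n - i', l + m - j'))) (n - i) (m - j))"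
      unfolding sum_distrib_left
    proof (intro sum.cong HOL.refl)
      fix ij assume box: "ij \<in> {..n} \<times> {..m}"
      obtain i j where eq: "ij = (i, j)" by force
      have ij: "i \<in> {..n}" "j \<in> {..m}" using box by (auto simp: eq)
      then have "k + n - (n - i) = k + i" "l + m - (m - j) = l + j" by auto
      then show "c * (case ij of (i, j) \<Rightarrow> pc p (i, j) * cnj (x (k + i, l + j))) =
          (case ij of (i, j) \<Rightarrow> (\<lambda>i' j'. cnj (pc p (i', j') * x (k + n - i', l + m - j'))) (n - i) (m - j))"
        using pr[of i j] ij by (simp add: eq mult.assoc[symmetric])
    qed
    also have "\<dots> = (\<Sum>(i, j)\<in>{..n} \<times> {..m}. cnj (pc p (i, j) * x (k + n - i, l + m - j)))"
      by (rule sum_box_reflect)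
    also have "\<dots> = cnj (\<Sum>(i, j)\<in>{..n} \<times> {..m}. pc p (i, j) * x (k + n - i, l + m - j))"
      by (simp add: case_prod_unfold)
    also have "(\<Sum>(i, j)\<in>{..n} \<times> {..m}. pc p (i, j) * x (k + n - i, l + m - j)) = (\<Sum>ij\<in>{..n} \<times> {..m}. pc p ij * shift ij x (k + n, l + m))"
      by (intro sum.cong) (auto simp: shift_apply)
    also have "\<dots> = mul p x (k + n, l + m)"
      unfolding mul_def using supp by (intro sum.mono_neutral_right) auto
    also have "\<dots> = 0"
    proof -
      \<comment> \<open>The derivative shifts the first index by one, past the degree bound
        \<open>n\<close> for every \<open>k\<close>, including 0.\<close>
      have "pc p (Suc (k + n), l + m) = 0" using supp by auto
      then show ?thesis by (simp add: mx pcd)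
    qed
    finally show ?thesis using refl(2) by simp
  qed
  from not_cyclic_by_functional[where b = "\<lambda>i. cnj (x i)", OF b i0 this] show ?thesis .
qed

text \<open>For \<open>z1\<close> on the circle, apart from the zeros of the leading coefficient,
  the slice has a root in \<open>z2\<close>. This root and its reflection in the circle both avoid
  the open disc, so the root lies on the circle.\<close>

lemma infinite_torus_zeros_self_reflective:
  assumes nz: "\<And>z1 z2. cmod z1 \<le> 1 \<Longrightarrow> cmod z2 < 1 \<Longrightarrow> eval2 p (z1, z2) \<noteq> 0"
    and deg: "degree p > 0"
    and supp: "{i. pc p i \<noteq> 0} \<subseteq> {..n} \<times> {..m}"
    and refl: "reflect2 n m p = smult [:c:] p" "c \<noteq> 0"
  shows "infinite (zero_set p \<inter> torus2)"
proof
  assume fin: "finite (zero_set p \<inter> torus2)"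
  have "lead_coeff p \<noteq> 0" using deg by auto
  then have "finite {z. poly (lead_coeff p) z = 0}" by (rule poly_roots_finite)
  moreover have "sphere 0 1 - {z. poly (lead_coeff p) z = 0} \<subseteq> fst ` (zero_set p \<inter> torus2)"
  proof
    fix z1 :: complex assume "z1 \<in> sphere 0 1 - {z. poly (lead_coeff p) z = 0}"
    then have z1: "cmod z1 = 1" and lc: "poly (lead_coeff p) z1 \<noteq> 0" by auto
    define q where "q = map_poly (\<lambda>c. poly c z1) p"
    have q: "eval2 p (z1, v) = poly q v" for v by (simp add: q_def eval2_as_poly_z2)
    have "coeff q (degree p) \<noteq> 0" using lc by (simp add: q_def coeff_map_poly)
    then have "degree q > 0" using deg le_degree[of q "degree p"] by simp
    then have "\<not> constant (poly q)" by (simp add: constant_degree)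
    then obtain w where w: "poly q w = 0" using fundamental_theorem_of_algebra by blast
    have w1: "cmod w \<ge> 1" using nz[of z1 w] z1 w q by force
    have w0: "w \<noteq> 0" "z1 \<noteq> 0" using w1 z1 by auto
    have c1: "1 / cnj z1 = z1" using z1 by (rule inverse_cnj_unit_circle)
    have "eval2 (reflect2 n m p) (z1, 1 / cnj w) = 0"
      using eval2_reflect2[OF supp w0(2), of "1 / cnj w"] w0 w by (simp add: c1 q)
    then have "eval2 p (z1, 1 / cnj w) = 0" using refl by (simp add: eval2_smult)
    then have "cmod (1 / cnj w) \<ge> 1" using nz[of z1 "1 / cnj w"] z1 by force
    then have "cmod w \<le> 1" using w0 by (simp add: norm_divide le_divide_eq)
    then have "(z1, w) \<in> zero_set p \<inter> torus2" using w1 z1 w q by (simp add: zero_set_def torus2_def)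
    then show "z1 \<in> fst ` (zero_set p \<inter> torus2)" by force
  qed
  then have "finite (sphere 0 1 - {z. poly (lead_coeff p) z = 0})" using fin finite_subset by blast
  ultimately have "finite (sphere (0::complex) 1)" by (meson finite_Diff2)
  \<comment> \<open>A finite circle would contain more roots of unity than it has points.\<close>
  moreover have "infinite (sphere (0::complex) 1)"
  proof
    assume "finite (sphere (0::complex) 1)"
    then have "card {z::complex. z ^ Suc (card (sphere (0::complex) 1)) = 1} \<le> card (sphere (0::complex) 1)"
    proof (intro card_mono subsetI)
      fix z :: complex assume "z \<in> {z. z ^ Suc (card (sphere (0::complex) 1)) = 1}"
      then show "z \<in> sphere 0 1"
        using power_eq_1_iff[of z "Suc (card (sphere (0::complex) 1))"] by simp
    qed
    moreover have "card {z::complex. z ^ Suc (card (sphere (0::complex) 1)) = 1} = Suc (card (sphere (0::complex) 1))"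
      by (rule card_roots_unity_eq) simp
    ultimately show False by simp
  qed
  ultimately show False by simp
qed

text \<open>The box is the smallest possible: \<open>n\<close> and \<open>m\<close> are the exact
  degrees. If \<open>p\<close> divides its reflection, degrees leave room only for a constant
  cofactor; otherwise irreducibility gives a Bezout relation.\<close>

lemma reflection_dichotomy:
  assumes irr: "irreducible p" and d2: "depends_on_z2 p"
  obtains n m where "{i. pc p i \<noteq> 0} \<subseteq> {..n} \<times> {..m}"
    "(\<exists>c. c \<noteq> 0 \<and> reflect2 n m p = smult [:c:] p) \<or> (\<exists>A B r. r \<noteq> 0 \<and> A * p + B * reflect2 n m p = [:r:])"
proof -
  have p0: "p \<noteq> 0" using irr by auto
  have deg: "degree p > 0" using d2 by (rule depends_on_z2_degree)
  define m where "m = degree p"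
  let ?S = "{i. pc p i \<noteq> 0}"
  have S: "finite ?S" "?S \<noteq> {}"
  proof -
    show "finite ?S" by (rule finite_pc)
    have "pc p \<noteq> pc 0" using p0 by (simp add: pc_inject)
    then show "?S \<noteq> {}" by (auto simp: fun_eq_iff pc_0)
  qed
  define n where "n = Max (fst ` ?S)"
  have supp: "?S \<subseteq> {..n} \<times> {..m}"
  proof clarify
    fix k l assume a: "pc p (k, l) \<noteq> 0"
    have "k \<le> n" unfolding n_def using S a by (intro Max_ge) (auto intro: rev_image_eqI)
    moreover have "l \<le> m" using a unfolding m_def pc_apply by (metis coeff_0 le_degree)
    ultimately show "k \<in> {..n} \<and> l \<in> {..m}" by simp
  qed
  have "n \<in> fst ` ?S" unfolding n_def using S by (intro Max_in) auto
  then obtain l0 where l0: "pc p (n, l0) \<noteq> 0" by auto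
  define q where "q = reflect2 n m p"
  have pcq: "pc q (k, l) = (if k \<le> n \<and> l \<le> m then cnj (pc p (n - k, m - l)) else 0)" for k l
    by (simp add: q_def reflect2_def pc_mkp)
  have "q \<noteq> 0"
  proof
    assume "q = 0"
    then have "pc q (0, m - l0) = 0" by (simp add: pc_0)
    moreover have "l0 \<le> m" using supp l0 by auto
    ultimately show False using l0 by (simp add: pcq)
  qed
  have "(\<exists>c. c \<noteq> 0 \<and> q = smult [:c:] p) \<or> (\<exists>A B r. r \<noteq> 0 \<and> A * p + B * q = [:r:])"
  proof (cases "p dvd q")
    case False
    from bezout_irreducible[OF irr deg this] show ?thesis by metis
  next
    case True
    then obtain t where t: "q = p * t" by blast
    have t0: "t \<noteq> 0" using t \<open>q \<noteq> 0\<close> by auto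
    have "degree q \<le> m"
    proof (rule degree_le, intro allI impI)
      fix l assume "m < l"
      then have "coeff (coeff q l) k = 0" for k using pcq[of k l] by (simp add: pc_apply)
      then show "coeff q l = 0" by (simp add: poly_eq_iff)
    qed
    moreover have "degree q = m + degree t" unfolding t m_def using p0 t0 by (rule degree_mult_eq)
    ultimately have "degree t = 0" by simp
    then obtain u where u: "t = [:u:]" using degree_eq_zeroE by blast
    have u0: "u \<noteq> 0" using t0 u by auto
    \<comment> \<open>In row \<open>l0\<close> the polynomial \<open>p\<close> attains its full
      degree \<open>n\<close> in \<open>z1\<close>, so the cofactor \<open>u\<close> cannot
      contribute any degree.\<close>
    have pl: "coeff p l0 \<noteq> 0" using l0 by (auto simp: pc_apply)
    have "degree (coeff q l0) \<le> n"
    proof (rule degree_le, intro allI impI)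
      fix k assume "n < k"
      then show "coeff (coeff q l0) k = 0" using pcq[of k l0] by (simp add: pc_apply)
    qed
    moreover have "coeff q l0 = coeff p l0 * u" unfolding t u by simp
    moreover have "degree (coeff p l0 * u) = degree (coeff p l0) + degree u" using pl u0 by (rule degree_mult_eq)
    moreover have "n \<le> degree (coeff p l0)" using l0 by (simp add: pc_apply le_degree)
    ultimately have "degree u = 0" by simp
    then obtain c where c: "u = [:c:]" using degree_eq_zeroE by blast
    then have "c \<noteq> 0" "q = smult [:c:] p" using u0 t u by auto
    then show ?thesis by blast
  qed
  then show ?thesis using that[OF supp] by (simp add: q_def)
qed

lemma cyclic_finite_zeros:
  assumes irr: "irreducible p" "depends_on_z1 p" "depends_on_z2 p"
    and nz: "\<And>z1 z2. cmod z1 < 1 \<Longrightarrow> cmod z2 < 1 \<Longrightarrow> eval2 p (z1, z2) \<noteq> 0"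
    and fin: "finite (zero_set p \<inter> torus2)" and \<alpha>: "\<alpha>1 \<le> 1"
  shows "pc 1 \<in> inv_closure \<alpha>1 \<alpha>2 p"
proof -
  note nzb = nonvanishing_boundary[OF irr nz]
  have deg: "degree p > 0" using irr(3) by (rule depends_on_z2_degree)
  obtain n m where supp: "{i. pc p i \<noteq> 0} \<subseteq> {..n} \<times> {..m}" and
    dich: "(\<exists>c. c \<noteq> 0 \<and> reflect2 n m p = smult [:c:] p) \<or> (\<exists>A B r. r \<noteq> 0 \<and> A * p + B * reflect2 n m p = [:r:])"
    using reflection_dichotomy[OF irr(1,3)] by metis
  have "\<not> (\<exists>c. c \<noteq> 0 \<and> reflect2 n m p = smult [:c:] p)"
    using infinite_torus_zeros_self_reflective[OF nzb(2) deg supp] fin by blast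
  then obtain A B r where r: "r \<noteq> 0" "A * p + B * reflect2 n m p = [:r:]" using dich by blast
  obtain MA where MA: "MA > 0" "\<And>z1 z2. cmod z1 \<le> 1 \<Longrightarrow> cmod z2 \<le> 1 \<Longrightarrow> cmod (eval2 A (z1, z2)) \<le> MA"
    by (rule eval2_bounded[of 1 1 A]) blast
  obtain MB where MB: "MB > 0" "\<And>z1 z2. cmod z1 \<le> 1 \<Longrightarrow> cmod z2 \<le> 1 \<Longrightarrow> cmod (eval2 B (z1, z2)) \<le> MB"
    by (rule eval2_bounded[of 1 1 B]) blast
  show ?thesis
  proof (rule cyclic_if_dominates_one_variable_factor[OF nzb(1) r(1) _ \<alpha>])
    fix z1 z2 :: complex assume z: "cmod z1 < 1" "cmod z2 < 1"
    have "poly r z1 = eval2 (A * p + B * reflect2 n m p) (z1, z2)" by (simp add: r(2) eval2_const)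
    also have "\<dots> = eval2 A (z1, z2) * eval2 p (z1, z2) + eval2 B (z1, z2) * eval2 (reflect2 n m p) (z1, z2)"
      by (simp add: eval2_add eval2_mult)
    also have "cmod \<dots> \<le> cmod (eval2 A (z1, z2)) * cmod (eval2 p (z1, z2)) + cmod (eval2 B (z1, z2)) * cmod (eval2 (reflect2 n m p) (z1, z2))"
      by (metis norm_mult norm_triangle_ineq)
    also have "\<dots> \<le> MA * cmod (eval2 p (z1, z2)) + MB * cmod (eval2 p (z1, z2))"
      using z MA MB by (intro add_mono mult_mono reflect2_le[OF supp nzb(2)]) auto
    finally show "cmod (poly r z1) \<le> (MA + MB) * cmod (eval2 p (z1, z2))" by (simp add: distrib_right)
  qed
qed

text \<open>A torus zero of \<open>p\<close> is also one of the reflection, so the Bezout relation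
  places \<open>z1\<close> among the roots of \<open>r\<close>; each such \<open>z1\<close> admits
  finitely many \<open>z2\<close>.\<close>

lemma finite_zeros_if_cyclic:
  assumes irr: "irreducible p" "depends_on_z1 p" "depends_on_z2 p"
    and nz: "\<And>z1 z2. cmod z1 < 1 \<Longrightarrow> cmod z2 < 1 \<Longrightarrow> eval2 p (z1, z2) \<noteq> 0"
    and \<alpha>: "\<alpha>1 + \<alpha>2 > 1" and cyc: "cyclic \<alpha>1 \<alpha>2 (eval2 p)"
  shows "finite (zero_set p \<inter> torus2)"
proof -
  note nzb = nonvanishing_boundary[OF irr nz]
  obtain n m where supp: "{i. pc p i \<noteq> 0} \<subseteq> {..n} \<times> {..m}" and
    dich: "(\<exists>c. c \<noteq> 0 \<and> reflect2 n m p = smult [:c:] p) \<or> (\<exists>A B r. r \<noteq> 0 \<and> A * p + B * reflect2 n m p = [:r:])"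
    using reflection_dichotomy[OF irr(1,3)] by metis
  have "\<not> (\<exists>c. c \<noteq> 0 \<and> reflect2 n m p = smult [:c:] p)"
    using not_cyclic_self_reflective[OF nzb irr(2) \<alpha> supp] cyc by blast
  then obtain A B r where r: "r \<noteq> 0" "A * p + B * reflect2 n m p = [:r:]" using dich by blast
  have "zero_set p \<inter> torus2 \<subseteq> (SIGMA z1:{z. poly r z = 0}. {z2. eval2 p (z1, z2) = 0})"
  proof
    fix z assume z12: "z \<in> zero_set p \<inter> torus2"
    obtain z1 z2 where zz: "z = (z1, z2)" by force
    have z: "eval2 p (z1, z2) = 0" "cmod z1 = 1" "cmod z2 = 1" using z12 by (auto simp: zz zero_set_def torus2_def)
    have "z1 \<noteq> 0" "z2 \<noteq> 0" using z by auto
    from eval2_reflect2[OF supp this] have "eval2 (reflect2 n m p) (z1, z2) = 0"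
      by (simp add: inverse_cnj_unit_circle z)
    then have "eval2 (A * p + B * reflect2 n m p) (z1, z2) = 0" by (simp add: eval2_add eval2_mult z)
    then show "z \<in> (SIGMA z1:{z. poly r z = 0}. {z2. eval2 p (z1, z2) = 0})"
      by (simp add: r(2) eval2_const z zz)
  qed
  moreover have "finite (SIGMA z1:{z. poly r z = 0}. {z2. eval2 p (z1, z2) = 0})"
    using poly_roots_finite[OF r(1)] finite_slice_z2[OF irr(1,3)] by (intro finite_SigmaI) auto
  ultimately show ?thesis by (rule finite_subset)
qed

theorem theorem1:
  fixes \<alpha>1 \<alpha>2 :: real and p :: "complex poly poly"
  assumes "irreducible p"
    and "depends_on_z1 p" and "depends_on_z2 p"
    and "zero_set p \<inter> bidisk = {}"
  shows "(\<alpha>1 + \<alpha>2 \<le> 1 \<longrightarrow> cyclic \<alpha>1 \<alpha>2 (eval2 p)) \<and>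
    (\<alpha>1 + \<alpha>2 > 1 \<and> min \<alpha>1 \<alpha>2 \<le> 1 \<longrightarrow>
       (cyclic \<alpha>1 \<alpha>2 (eval2 p) \<longleftrightarrow>
        zero_set p \<inter> torus2 = {} \<or> finite (zero_set p \<inter> torus2))) \<and>
    (min \<alpha>1 \<alpha>2 > 1 \<longrightarrow>
       (cyclic \<alpha>1 \<alpha>2 (eval2 p) \<longleftrightarrow> zero_set p \<inter> torus2 = {}))"
proof -
  have nz: "eval2 p (z1, z2) \<noteq> 0" if "cmod z1 < 1" "cmod z2 < 1" for z1 z2
    using assms(4) that by (auto simp: zero_set_def bidisk_def)
  note nzb = nonvanishing_boundary[OF assms(1-3) nz]
  have 1: "cyclic \<alpha>1 \<alpha>2 (eval2 p)" if "\<alpha>1 + \<alpha>2 \<le> 1"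
    unfolding cyclic_iff using nzb that by (rule cyclic_small_exponents)
  have 2: "cyclic \<alpha>1 \<alpha>2 (eval2 p)" if fin: "finite (zero_set p \<inter> torus2)" and \<alpha>: "min \<alpha>1 \<alpha>2 \<le> 1"
  proof (cases "\<alpha>1 \<le> 1")
    case True
    then show ?thesis unfolding cyclic_iff using cyclic_finite_zeros[OF assms(1-3) nz fin] by blast
  next
    \<comment> \<open>Now \<open>\<alpha>2 \<le> 1\<close>, and exchanging the variables brings this
      exponent to the front.\<close>
    case False
    have "zero_set (swp p) \<inter> torus2 \<subseteq> prod.swap ` (zero_set p \<inter> torus2)"
    proof
      fix z assume "z \<in> zero_set (swp p) \<inter> torus2"
      then have "prod.swap z \<in> zero_set p \<inter> torus2"
        by (cases z) (auto simp: zero_set_def torus2_def eval2_swp)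
      then show "z \<in> prod.swap ` (zero_set p \<inter> torus2)" by (rule rev_image_eqI) simp
    qed
    then have "finite (zero_set (swp p) \<inter> torus2)" using fin finite_subset by blast
    then have "pc 1 \<in> inv_closure \<alpha>2 \<alpha>1 (swp p)"
      using assms(1-3) nz False \<alpha> by (intro cyclic_finite_zeros irreducible_swp) (auto simp: depends_swp eval2_swp)
    then show ?thesis unfolding cyclic_iff by (rule inv_closure_swp)
  qed
  have 3: "finite (zero_set p \<inter> torus2)" if "\<alpha>1 + \<alpha>2 > 1" "cyclic \<alpha>1 \<alpha>2 (eval2 p)"
    using finite_zeros_if_cyclic[OF assms(1-3) nz that] .
  have 4: "cyclic \<alpha>1 \<alpha>2 (eval2 p)" if "zero_set p \<inter> torus2 = {}"
    unfolding cyclic_iff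
  proof (rule cyclic_nonvanishing)
    fix z1 z2 :: complex assume z: "cmod z1 \<le> 1" "cmod z2 \<le> 1"
    show "eval2 p (z1, z2) \<noteq> 0"
    proof (cases "cmod z1 = 1 \<and> cmod z2 = 1")
      case True
      then show ?thesis using that by (auto simp: zero_set_def torus2_def)
    next
      case False
      then show ?thesis using nzb[of z1 z2] z by linarith
    qed
  qed
  have 5: "zero_set p \<inter> torus2 = {}" if "min \<alpha>1 \<alpha>2 > 1" "cyclic \<alpha>1 \<alpha>2 (eval2 p)"
    using not_cyclic_point_evaluation[of \<alpha>1 \<alpha>2 _ _ p] that by (auto simp: zero_set_def torus2_def)
  show ?thesis
  proof (intro conjI impI)
    assume \<alpha>: "\<alpha>1 + \<alpha>2 > 1 \<and> min \<alpha>1 \<alpha>2 \<le> 1"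
    show "cyclic \<alpha>1 \<alpha>2 (eval2 p) \<longleftrightarrow> zero_set p \<inter> torus2 = {} \<or> finite (zero_set p \<inter> torus2)"
    proof
      assume "zero_set p \<inter> torus2 = {} \<or> finite (zero_set p \<inter> torus2)"
      then have "finite (zero_set p \<inter> torus2)" by (elim disjE) simp_all
      then show "cyclic \<alpha>1 \<alpha>2 (eval2 p)" using 2 \<alpha> by blast
    qed (use 3 \<alpha> in blast)
  next
    assume "min \<alpha>1 \<alpha>2 > 1"
    then show "cyclic \<alpha>1 \<alpha>2 (eval2 p) \<longleftrightarrow> zero_set p \<inter> torus2 = {}" using 4 5 by blast
  qed (rule 1)
qed

end
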